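(* Let $p\ge3$ be an integer. There exists $\beta_h(p)>0$ such that for every $0<\beta<\beta_h(p)$ there are constants $c_L=c_L(p,\beta)>0$ and $c>0$ such that, with $\mathbb P$-probability $1-O(e^{-cN})$ as $N\to\infty$, the Gibbs measure $\pi_N$ of the pure spherical $p$-spin model at inverse temperature $\beta$ satisfies a log-Sobolev inequality with constant $c_L$.
   Context: State space: $\mathcal S^N=\{\sigma\in\mathbb R^N:\sum_{i=1}^N\sigma_i^2=N\}$, with the Riemannian metric $g$ induced from $\mathbb R^N$, covariant derivative $\nabla$, and normalized volume (uniform probability) measure $dV$. Hamiltonian: $H(\sigma)=H_{N,p}(\sigma)=N^{-(p-1)/2}\sum_{i_1,\dots,i_p=1}^N J_{i_1\dots i_p}\sigma_{i_1}\cdots\sigma_{i_p}$, where the $J_{i_1\dots i_p}$ are i.i.d. standard Gaussian random variables with law $\mathbb P$. Gibbs measure: $d\pi_N(\sigma)=Z^{-1}e^{-\beta H(\sigma)}dV(\sigma)$ with $Z$ the normalizing constant. Log-Sobolev inequality: a probability measure $\mu$ on a Riemannian manifold $(M,g)$ satisfies a log-Sobolev inequality with constant $c>0$ if for every $f\in C^\infty(M)$, $$\int_M f^2\log\Big(\frac{f^2}{\int_M f^2\,d\mu}\Big)d\mu\le 2c\int_M g(\nabla f,\nabla f)\,d\mu .$$ *)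

theory Defs
  imports "HOL-Probability.Probability" "HOL-Library.Landau_Symbols"
begin

text \<open>
  The dimension N varies inside the statement, so points of N-dimensional Euclidean space are
  functions on \<open>{..<N}\<close> that are \<open>undefined\<close> elsewhere. On this set the
  product topology of the type \<open>nat \<Rightarrow> real\<close> is the Euclidean topology.
  Coordinates are numbered from 0.
\<close>

abbreviation euclidean_vectors :: "nat \<Rightarrow> (nat \<Rightarrow> real) set" where
  "euclidean_vectors N \<equiv> {..<N} \<rightarrow>\<^sub>E (UNIV :: real set)"

definition spin_sphere :: "nat \<Rightarrow> (nat \<Rightarrow> real) set" where
  "spin_sphere N = {\<sigma> \<in> euclidean_vectors N. (\<Sum>i<N. (\<sigma> i)\<^sup>2) = real N}"

definition tangent_space :: "nat \<Rightarrow> (nat \<Rightarrow> real) \<Rightarrow> (nat \<Rightarrow> real) set" where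
  "tangent_space N \<sigma> = {v \<in> euclidean_vectors N. (\<Sum>i<N. \<sigma> i * v i) = 0}"

text \<open>The induced metric; it is the same expression at every base point.\<close>

definition induced_metric :: "nat \<Rightarrow> (nat \<Rightarrow> real) \<Rightarrow> (nat \<Rightarrow> real) \<Rightarrow> real" where
  "induced_metric N v w = (\<Sum>i<N. v i * w i)"


subsection \<open>Riemannian volume\<close>

text \<open>
  For \<open>N \<ge> 1\<close>, up to the equator, which has volume 0, the sphere is the union of
  the graphs of \<open>hemisphere_height N\<close> and of its negative over the open ball of
  radius \<open>sqrt N\<close> in dimension \<open>N - 1\<close>. The Riemannian volume element
  \<open>sqrt (det g)\<close> of the graph of \<open>h\<close> is
  \<open>sqrt (1 + (\<Sum>i. (\<partial>\<^sub>i h)\<^sup>2))\<close>, and here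
  \<open>\<partial>\<^sub>i h x = - x i / h x\<close>.
\<close>

definition hemisphere_height :: "nat \<Rightarrow> (nat \<Rightarrow> real) \<Rightarrow> real" where
  "hemisphere_height N x = sqrt (real N - (\<Sum>i<N - 1. (x i)\<^sup>2))"

definition hemisphere_base :: "nat \<Rightarrow> (nat \<Rightarrow> real) measure" where
  "hemisphere_base N =
     density (restrict_space (\<Pi>\<^sub>M i\<in>{..<N - 1}. lborel) {x. (\<Sum>i<N - 1. (x i)\<^sup>2) < real N})
       (\<lambda>x. ennreal (sqrt (1 + (\<Sum>i<N - 1. (- x i / hemisphere_height N x)\<^sup>2))))"

definition sphere_volume :: "nat \<Rightarrow> (nat \<Rightarrow> real) measure" where
  "sphere_volume N =
     distr (count_space {1, - 1 :: real} \<Otimes>\<^sub>M hemisphere_base N)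
       (restrict_space (\<Pi>\<^sub>M i\<in>{..<N}. borel) (spin_sphere N))
       (\<lambda>(s, x). x(N - 1 := s * hemisphere_height N x))"

definition uniform_sphere :: "nat \<Rightarrow> (nat \<Rightarrow> real) measure" where
  "uniform_sphere N = uniform_measure (sphere_volume N) (spin_sphere N)"


subsection \<open>Smooth functions and gradients on the sphere\<close>

definition partial_derivative ::
    "nat \<Rightarrow> ((nat \<Rightarrow> real) \<Rightarrow> real) \<Rightarrow> (nat \<Rightarrow> real) \<Rightarrow> real" where
  "partial_derivative i F x = deriv (\<lambda>t. F (x(i := t))) (x i)"

text \<open>Partial derivatives of all orders exist and are continuous.\<close>

definition C_infinity_on :: "nat \<Rightarrow> (nat \<Rightarrow> real) set \<Rightarrow> ((nat \<Rightarrow> real) \<Rightarrow> real) \<Rightarrow> bool" where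
  "C_infinity_on N U F \<longleftrightarrow>
     (\<forall>js. set js \<subseteq> {..<N} \<longrightarrow>
        continuous_on U (foldr partial_derivative js F) \<and>
        (\<forall>i<N. \<forall>x\<in>U. (\<lambda>t. foldr partial_derivative js F (x(i := t))) field_differentiable at (x i)))"

text \<open>
  Smoothness on the embedded submanifold: \<open>f\<close> is the restriction of a smooth function
  on a neighbourhood of the sphere. Values of \<open>f\<close> off the sphere are irrelevant.
\<close>

definition smooth_on_sphere :: "nat \<Rightarrow> ((nat \<Rightarrow> real) \<Rightarrow> real) \<Rightarrow> bool" where
  "smooth_on_sphere N f \<longleftrightarrow>
     (\<exists>U F. openin (top_of_set (euclidean_vectors N)) U \<and> spin_sphere N \<subseteq> U \<and>
        C_infinity_on N U F \<and> (\<forall>\<sigma>\<in>spin_sphere N. f \<sigma> = F \<sigma>))"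

text \<open>
  The tangent vector \<open>v\<close> at \<open>\<sigma>\<close> such that \<open>df(w) = g(v, w)\<close> for
  every tangent vector \<open>w\<close>, where \<open>df(w)\<close> is the derivative of \<open>f\<close>
  along a curve in the sphere with velocity \<open>w\<close> at \<open>\<sigma>\<close>.
\<close>

definition sphere_gradient ::
    "nat \<Rightarrow> ((nat \<Rightarrow> real) \<Rightarrow> real) \<Rightarrow> (nat \<Rightarrow> real) \<Rightarrow> (nat \<Rightarrow> real)" where
  "sphere_gradient N f \<sigma> =
     (THE v. v \<in> tangent_space N \<sigma> \<and>
        (\<forall>\<gamma> w. (\<forall>t. \<gamma> t \<in> spin_sphere N) \<and> \<gamma> 0 = \<sigma> \<and>
               (\<forall>i<N. ((\<lambda>t. \<gamma> t i) has_real_derivative w i) (at 0)) \<longrightarrow>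
           ((\<lambda>t. f (\<gamma> t)) has_real_derivative induced_metric N v w) (at 0)))"

text \<open>The convention \<open>0 * log 0 = 0\<close> is built in, since \<open>ln 0 = 0\<close>.\<close>

definition log_sobolev :: "nat \<Rightarrow> (nat \<Rightarrow> real) measure \<Rightarrow> real \<Rightarrow> bool" where
  "log_sobolev N \<mu> c \<longleftrightarrow>
     (\<forall>f. smooth_on_sphere N f \<longrightarrow>
        (\<integral>\<sigma>. (f \<sigma>)\<^sup>2 * ln ((f \<sigma>)\<^sup>2 / (\<integral>\<tau>. (f \<tau>)\<^sup>2 \<partial>\<mu>)) \<partial>\<mu>)
          \<le> 2 * c * (\<integral>\<sigma>. induced_metric N (sphere_gradient N f \<sigma>) (sphere_gradient N f \<sigma>) \<partial>\<mu>))"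


subsection \<open>The pure spherical p-spin model\<close>

text \<open>A multi-index \<open>(i\<^sub>1, \<dots>, i\<^sub>p)\<close> is a function from \<open>{..<p}\<close> to \<open>{..<N}\<close>.\<close>

abbreviation spin_indices :: "nat \<Rightarrow> nat \<Rightarrow> (nat \<Rightarrow> nat) set" where
  "spin_indices N p \<equiv> {..<p} \<rightarrow>\<^sub>E {..<N}"

text \<open>The joint law of the i.i.d. standard Gaussian couplings.\<close>

definition disorder_law :: "nat \<Rightarrow> nat \<Rightarrow> ((nat \<Rightarrow> nat) \<Rightarrow> real) measure" where
  "disorder_law N p = (\<Pi>\<^sub>M i\<in>spin_indices N p. density lborel std_normal_density)"

definition hamiltonian ::
    "nat \<Rightarrow> nat \<Rightarrow> ((nat \<Rightarrow> nat) \<Rightarrow> real) \<Rightarrow> (nat \<Rightarrow> real) \<Rightarrow> real" where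
  "hamiltonian N p J \<sigma> =
     real N powr (- (real p - 1) / 2) * (\<Sum>i\<in>spin_indices N p. J i * (\<Prod>k<p. \<sigma> (i k)))"

definition partition_function ::
    "nat \<Rightarrow> nat \<Rightarrow> real \<Rightarrow> ((nat \<Rightarrow> nat) \<Rightarrow> real) \<Rightarrow> real" where
  "partition_function N p \<beta> J = (\<integral>\<sigma>. exp (- \<beta> * hamiltonian N p J \<sigma>) \<partial>uniform_sphere N)"

definition gibbs_measure ::
    "nat \<Rightarrow> nat \<Rightarrow> real \<Rightarrow> ((nat \<Rightarrow> nat) \<Rightarrow> real) \<Rightarrow> (nat \<Rightarrow> real) measure" where
  "gibbs_measure N p \<beta> J =
     density (uniform_sphere N)
       (\<lambda>\<sigma>. ennreal (exp (- \<beta> * hamiltonian N p J \<sigma>) / partition_function N p \<beta> J))"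

end

theory Submission
  imports Defs "HOL-Real_Asymp.Real_Asymp"
begin

text \<open>
  With probability at least \<open>1 - exp (- N)\<close> the tensor of couplings has injective norm at most
  \<open>C * sqrt N\<close> (union bound over a lattice net whose convex hull contains the unit ball).
  For such couplings and small \<open>\<beta>\<close>, the function
  \<open>V x = (norm x)^2 / 4 + \<beta> * H x\<close> is uniformly convex on the ball of radius
  \<open>sqrt N\<close>, so the argument of Bobkov and Ledoux, which applies the Prekopa-Leindler
  inequality to a sup-convolution, bounds entropies under \<open>exp (- V)\<close> by an integral of
  squared local slopes.

  Applied to functions of \<open>x / norm x\<close> this gives the inequality on the sphere: in
  polar coordinates the radial integral of \<open>exp (- V)\<close> concentrates at distance
  \<open>O(1 / N)\<close> (relative to the radius) from the boundary, over which \<open>\<beta> * H\<close> changes only by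
  \<open>O(1)\<close>. Hence the angular marginal has a density with respect to the Gibbs measure that is bounded
  above and below up to one common factor, and such perturbations change the constant only by a
  bounded factor.

  The event in the statement is measurable because for each test function the inequality is
  preserved under limits of couplings.
\<close>

subsection \<open>The Prekopa-Leindler inequality\<close>

text \<open>Passing to the ball replaces the curvature of the sphere by Euclidean strong convexity,
  which reduces to Brunn-Minkowski on the line by induction on the dimension. The difficulty is to
  lose only a factor free of N on the way back. With coefficient 1/2 of (norm x)^2 the radial weight
  s^(N-1) * exp (- N s^2 / 2) would spread over a layer of relative width N^(-1/2), where
  \<open>\<beta> * H\<close> may vary by order sqrt N; with 1/4 the exponent still has slope about
  N/2 at s = 1. The single condition \<open>\<beta> * C * p^2 \<le> 1/8\<close> serves twice: it
  costs at most half of the convexity modulus 1/2, and it bounds the radial variation of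
  \<open>\<beta> * H\<close> by (N/8) * (1 - s). The constant is explicit: modulus 1/4 gives a
  factor 2 in the entropy bound, the derivative of ln (f^2 + e) gives 4, the ratio of the radial
  bounds gives 8 * exp (9/8), and the product 64 * exp (9/8) is 2 * c_L. Two singularities occur: ln
  (f^2) at zeros of f, cured by adding e > 0, and the origin, where x / norm x is not Lipschitz but
  has square integrable slope.\<close>

lemma brunn_minkowski_real:
  fixes A B C :: "real set"
  assumes [measurable]: "A \<in> sets borel" "B \<in> sets borel" "C \<in> sets borel"
    and ne: "A \<noteq> {}" "B \<noteq> {}"
    and bdd: "bounded A" "bounded B" "bounded C"
    and sub: "\<And>a b. a \<in> A \<Longrightarrow> b \<in> B \<Longrightarrow> a + b \<in> C"
  shows "emeasure lborel A + emeasure lborel B \<le> emeasure lborel C"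
proof -
  have finC: "emeasure lborel C < \<infinity>"
    using bdd(3) by (rule emeasure_bounded_finite)
  have shift: "emeasure lborel ((\<lambda>x. c + x) -` S) = emeasure lborel S"
    if "S \<in> sets borel" for c and S :: "real set"
  proof -
    have "emeasure lborel S = emeasure (distr lborel borel ((+) c)) S"
      by (simp add: lborel_distr_plus)
    also have "\<dots> = emeasure lborel ((\<lambda>x. c + x) -` S)"
      using that by (subst emeasure_distr) auto
    finally show ?thesis by simp
  qed
  show ?thesis
  proof (rule ennreal_le_epsilon)
    fix e :: real assume "0 < e"
    have bA: "bdd_above A" and bB: "bdd_below B"
      using bdd by (auto simp: bounded_imp_bdd_above bounded_imp_bdd_below)
    obtain a where a: "a \<in> A" "Sup A - e/2 < a"
      using less_cSupD[of A "Sup A - e/2"] ne \<open>0 < e\<close> by auto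
    obtain b where b: "b \<in> B" "b < Inf B + e/2"
      using cInf_lessD[of B "Inf B + e/2"] ne \<open>0 < e\<close> by auto
    \<comment> \<open>\<open>A'\<close> is A + b and \<open>B'\<close> is B + a. Both lie in C, and
      since a nearly attains Sup A and b nearly attains Inf B, they meet only in an interval of
      length at most e.\<close>
    define A' where "A' = (\<lambda>x. - b + x) -` A"
    define B' where "B' = (\<lambda>x. - a + x) -` B"
    have mA': "A' \<in> sets borel" and mB': "B' \<in> sets borel"
      unfolding A'_def B'_def by (auto intro!: measurable_sets_borel[of _ borel])
    have A'C: "A' \<subseteq> C"
    proof
      fix x assume "x \<in> A'"
      then show "x \<in> C" using sub[of "-b + x" b] b by (simp add: A'_def)
    qed
    have B'C: "B' \<subseteq> C"
    proof
      fix x assume "x \<in> B'"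
      then show "x \<in> C" using sub[of a "-a + x"] a by (simp add: B'_def)
    qed
    have int: "A' \<inter> B' \<subseteq> {a + Inf B .. Sup A + b}"
    proof
      fix x assume x: "x \<in> A' \<inter> B'"
      then have "-b + x \<le> Sup A" using bA by (auto simp: A'_def intro!: cSup_upper)
      moreover have "Inf B \<le> -a + x" using x bB by (auto simp: B'_def intro!: cInf_lower)
      ultimately show "x \<in> {a + Inf B .. Sup A + b}" by auto
    qed
    have le: "a \<le> Sup A" "Inf B \<le> b" using a b bA bB by (auto intro!: cSup_upper cInf_lower)
    have "emeasure lborel (A' \<inter> B') \<le> emeasure lborel {a + Inf B .. Sup A + b}"
      using int by (intro emeasure_mono) auto
    also have "\<dots> \<le> ennreal e"
      using a b le by (auto intro!: ennreal_leI)
    finally have small: "emeasure lborel (A' \<inter> B') \<le> ennreal e" .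
    have "emeasure lborel A + emeasure lborel B = emeasure lborel A' + emeasure lborel B'"
      unfolding A'_def B'_def by (simp add: shift)
    also have "\<dots> = emeasure lborel (A' \<union> B') + emeasure lborel (A' \<inter> B')"
      using mA' mB' emeasure_Un_Int[of A' lborel B'] by simp
    also have "\<dots> \<le> emeasure lborel C + ennreal e"
      using small A'C B'C by (intro add_mono emeasure_mono) auto
    finally show "emeasure lborel A + emeasure lborel B \<le> emeasure lborel C + ennreal e" .
  qed
qed

text \<open>The levels stop at 1 because Brunn-Minkowski is applied level by level and needs both
  superlevel sets to be nonempty, which holds at the levels below the common supremum 1.\<close>

lemma nn_integral_layer_cake:
  fixes U :: "real \<Rightarrow> real"
  assumes [measurable]: "U \<in> borel_measurable borel" and nn: "\<And>x. 0 \<le> U x"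
  shows "(\<integral>\<^sup>+x. ennreal (min (U x) 1) \<partial>lborel) =
     (\<integral>\<^sup>+l. emeasure lborel {x. l < U x} * indicator {0<..<1} l \<partial>lborel)"
proof -
  have "(\<integral>\<^sup>+l. emeasure lborel {x. l < U x} * indicator {0<..<1} l \<partial>lborel)
     = (\<integral>\<^sup>+l. (\<integral>\<^sup>+x. indicator {0<..<min (U x) 1} l \<partial>lborel) \<partial>lborel)"
  proof (intro nn_integral_cong)
    fix l :: real
    have "(\<integral>\<^sup>+x. indicator {0<..<min (U x) 1} l \<partial>lborel) = (\<integral>\<^sup>+x. indicator {x. l < U x} x * indicator {0<..<1} l \<partial>lborel)"
      by (intro nn_integral_cong) (auto split: split_indicator)
    also have "\<dots> = emeasure lborel {x. l < U x} * indicator {0<..<1} l"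
      by (subst nn_integral_multc) auto
    finally show "emeasure lborel {x. l < U x} * indicator {0<..<1} l = (\<integral>\<^sup>+x. indicator {0<..<min (U x) 1} l \<partial>lborel)" by simp
  qed
  also have "\<dots> = (\<integral>\<^sup>+x. (\<integral>\<^sup>+l. indicator {0<..<min (U x) 1} l \<partial>lborel) \<partial>lborel)"
  proof -
    have "(\<lambda>(x,l). indicator {0<..<min (U x) 1} l :: ennreal) = (\<lambda>p. indicator {p. 0 < snd p \<and> snd p < min (U (fst p)) 1} p)"
      by (auto simp: fun_eq_iff split: split_indicator)
    also have "\<dots> \<in> borel_measurable (lborel \<Otimes>\<^sub>M lborel)"
      by measurable
    finally show ?thesis
      using lborel_pair.Fubini'[of "\<lambda>x l. indicator {0<..<min (U x) 1} l :: ennreal"] by simp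
  qed
  also have "\<dots> = (\<integral>\<^sup>+x. ennreal (min (U x) 1) \<partial>lborel)"
    using nn by (intro nn_integral_cong) simp
  finally show ?thesis by simp
qed

text \<open>For 0 < l < 1 the set {W > l} contains the sum of {U > l} and {V > l}. These are
  nonempty since both suprema are 1, and bounded since l is positive; Brunn-Minkowski is then
  integrated over l.\<close>

lemma nn_integral_sup_convolution:
  fixes U V W :: "real \<Rightarrow> real"
  assumes [measurable]: "U \<in> borel_measurable borel" "V \<in> borel_measurable borel" "W \<in> borel_measurable borel"
    and U: "\<And>x. 0 \<le> U x" "\<And>x. U x \<le> 1" "\<And>l. l < 1 \<Longrightarrow> \<exists>x. l < U x" "\<And>x. R < \<bar>x\<bar> \<Longrightarrow> U x = 0"
    and V: "\<And>x. 0 \<le> V x" "\<And>x. V x \<le> 1" "\<And>l. l < 1 \<Longrightarrow> \<exists>x. l < V x" "\<And>x. R < \<bar>x\<bar> \<Longrightarrow> V x = 0"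
    and W: "\<And>x. 0 \<le> W x" "\<And>x. R < \<bar>x\<bar> \<Longrightarrow> W x = 0"
    and sup: "\<And>x y. min (U x) (V y) \<le> W (x + y)"
  shows "(\<integral>\<^sup>+x. ennreal (U x) \<partial>lborel) + (\<integral>\<^sup>+x. ennreal (V x) \<partial>lborel) \<le> (\<integral>\<^sup>+x. ennreal (W x) \<partial>lborel)"
proof -
  have bdd: "bounded {x. l < F x}" if "0 < l" "\<And>x. R < \<bar>x\<bar> \<Longrightarrow> F x = 0" for l and F :: "real \<Rightarrow> real"
  proof (rule boundedI[of _ R])
    fix x assume "x \<in> {x. l < F x}"
    then have "F x \<noteq> 0" using that(1) by auto
    then show "norm x \<le> R" using that(2)[of x] by (metis not_less real_norm_def)
  qed
  have "(\<integral>\<^sup>+x. ennreal (U x) \<partial>lborel) + (\<integral>\<^sup>+x. ennreal (V x) \<partial>lborel)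
     = (\<integral>\<^sup>+x. ennreal (min (U x) 1) \<partial>lborel) + (\<integral>\<^sup>+x. ennreal (min (V x) 1) \<partial>lborel)"
    using U V by (simp add: min_absorb1)
  also have "\<dots> = (\<integral>\<^sup>+l. emeasure lborel {x. l < U x} * indicator {0<..<1} l +
      emeasure lborel {x. l < V x} * indicator {0<..<1} l \<partial>lborel)"
    unfolding nn_integral_layer_cake[OF assms(1) U(1)] nn_integral_layer_cake[OF assms(2) V(1)]
    by (rule nn_integral_add[symmetric]) measurable
  also have "\<dots> \<le> (\<integral>\<^sup>+l. emeasure lborel {x. l < W x} * indicator {0<..<1} l \<partial>lborel)"
  proof (intro nn_integral_mono)
    fix l :: real
    show "emeasure lborel {x. l < U x} * indicator {0<..<1} l + emeasure lborel {x. l < V x} * indicator {0<..<1} l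
       \<le> emeasure lborel {x. l < W x} * indicator {0<..<1} l"
    proof (cases "l \<in> {0<..<1}")
      case True
      have "emeasure lborel {x. l < U x} + emeasure lborel {x. l < V x} \<le> emeasure lborel {x. l < W x}"
      proof (rule brunn_minkowski_real)
        fix a b assume "a \<in> {x. l < U x}" "b \<in> {x. l < V x}"
        then show "a + b \<in> {x. l < W x}" using sup[of a b] by auto
      qed (use True U V W bdd in auto)
      then show ?thesis using True by simp
    qed auto
  qed
  also have "\<dots> = (\<integral>\<^sup>+x. ennreal (min (W x) 1) \<partial>lborel)"
    by (rule nn_integral_layer_cake[symmetric]) (use W in auto)
  also have "\<dots> \<le> (\<integral>\<^sup>+x. ennreal (W x) \<partial>lborel)"
    by (intro nn_integral_mono ennreal_leI) auto
  finally show ?thesis .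
qed


lemma integrable_lborel_bounded_support:
  fixes F :: "real \<Rightarrow> real"
  assumes [measurable]: "F \<in> borel_measurable borel"
    and "\<And>x. \<bar>F x\<bar> \<le> M" "\<And>x. R < \<bar>x\<bar> \<Longrightarrow> F x = 0"
  shows "integrable lborel F"
proof (rule integrableI_bounded_set[of "{-R..R}" _ _ M])
  show "AE x \<in> {-R..R} in lborel. norm (F x) \<le> M" using assms by auto
  show "AE x in lborel. x \<notin> {-R..R} \<longrightarrow> F x = 0"
  proof (intro AE_I2 impI)
    fix x assume "x \<notin> {-R..R}"
    then have "R < \<bar>x\<bar>" by auto
    then show "F x = 0" using assms by auto
  qed
qed (auto simp: emeasure_lborel_Icc_eq)

text \<open>Dividing U and V by their suprema and stretching them by t and 1 - t gives functions to
  which the additive inequality applies; the weighted arithmetic-geometric mean inequality turns the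
  resulting sum back into a product.\<close>

lemma prekopa_leindler_real:
  fixes U V W :: "real \<Rightarrow> real"
  assumes t: "0 < t" "t < 1"
    and [measurable]: "U \<in> borel_measurable borel" "V \<in> borel_measurable borel" "W \<in> borel_measurable borel"
    and U: "\<And>x. 0 \<le> U x" "\<And>x. U x \<le> M" "\<And>x. R < \<bar>x\<bar> \<Longrightarrow> U x = 0"
    and V: "\<And>x. 0 \<le> V x" "\<And>x. V x \<le> M" "\<And>x. R < \<bar>x\<bar> \<Longrightarrow> V x = 0"
    and W: "\<And>x. 0 \<le> W x" "\<And>x. W x \<le> M" "\<And>x. R < \<bar>x\<bar> \<Longrightarrow> W x = 0"
    and UVW: "\<And>x y. U x powr t * V y powr (1 - t) \<le> W (t * x + (1 - t) * y)"
  shows "(\<integral>x. U x \<partial>lborel) powr t * (\<integral>x. V x \<partial>lborel) powr (1 - t) \<le> (\<integral>x. W x \<partial>lborel)"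
proof -
  have int: "integrable lborel U" "integrable lborel V" "integrable lborel W"
    by (rule integrable_lborel_bounded_support[of _ M R]; use U V W in force)+
  have W0: "0 \<le> (\<integral>x. W x \<partial>lborel)" using W by simp
  show ?thesis
  proof (cases "(\<integral>x. U x \<partial>lborel) = 0 \<or> (\<integral>x. V x \<partial>lborel) = 0")
    case True
    then show ?thesis using W0 t by auto
  next
    case False
    define a where "a = Sup (range U)"
    define b where "b = Sup (range V)"
    have bU: "bdd_above (range U)" and bV: "bdd_above (range V)"
      using U(2) V(2) by (auto intro!: bdd_aboveI2)
    have "\<exists>x. F x \<noteq> 0" if "(\<integral>x. F x \<partial>lborel) \<noteq> 0" for F :: "real \<Rightarrow> real"
      by (rule ccontr) (use that in simp)
    then have "\<exists>x. U x \<noteq> 0" "\<exists>x. V x \<noteq> 0" using False by blast+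
    then obtain x0 y0 where "0 < U x0" "0 < V y0" using U(1) V(1) by (metis less_eq_real_def)
    then have a: "0 < a" and b: "0 < b"
      unfolding a_def b_def using bU bV by (auto intro: less_le_trans cSup_upper)
    have Ua: "U x \<le> a" for x unfolding a_def using bU by (auto intro: cSup_upper)
    have Vb: "V x \<le> b" for x unfolding b_def using bV by (auto intro: cSup_upper)
    have Ul: "\<exists>x. l < U x" if "l < a" for l
      using that bU unfolding a_def by (subst (asm) less_cSup_iff) auto
    have Vl: "\<exists>x. l < V x" if "l < b" for l
      using that bV unfolding b_def by (subst (asm) less_cSup_iff) auto
    define s where "s = 1 - t"
    have s: "0 < s" "s < 1" "s + t = 1" using t by (auto simp: s_def)
    define c where "c = a powr t * b powr s"
    have c: "0 < c" using a b by (auto simp: c_def)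
    have *: "(\<integral>\<^sup>+x. ennreal (U (x / t) / a) \<partial>lborel) + (\<integral>\<^sup>+x. ennreal (V (x / s) / b) \<partial>lborel)
        \<le> (\<integral>\<^sup>+x. ennreal (W x / c) \<partial>lborel)"
    proof (rule nn_integral_sup_convolution[of _ _ _ R])
      fix x y :: real
      let ?A = "U (x / t) / a" and ?B = "V (y / s) / b"
      have AB: "0 \<le> ?A" "0 \<le> ?B" using U V a b by auto
      \<comment> \<open>Since t + s = 1, the minimum is at most the weighted geometric mean, which
        the hypothesis bounds by W / c.\<close>
      have "min ?A ?B = min ?A ?B powr t * min ?A ?B powr s"
        using AB s by (cases "min ?A ?B = 0") (auto simp: powr_add[symmetric] add.commute)
      also have "\<dots> \<le> ?A powr t * ?B powr s"
        using AB s t by (intro mult_mono powr_mono2) auto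
      also have "\<dots> = (U (x / t) powr t * V (y / s) powr s) / c"
        using U V a b by (simp add: powr_divide c_def)
      also have "\<dots> \<le> W (t * (x / t) + s * (y / s)) / c"
        using UVW[of "x / t" "y / s"] c unfolding s_def by (intro divide_right_mono) simp_all
      also have "\<dots> = W (x + y) / c" using s t by simp
      finally show "min ?A ?B \<le> W (x + y) / c" .
    next
      fix l :: real assume "l < 1"
      then have "l * a < a" "l * b < b" using a b by auto
      then obtain x y where "l * a < U x" "l * b < V y" using Ul Vl by blast
      then have "l < U (t * x / t) / a" "l < V (s * y / s) / b" using a b s t by (auto simp: field_simps)
      then show "\<exists>x. l < U (x / t) / a" "\<exists>x. l < V (x / s) / b" by blast+
    next
      fix x :: real assume x: "R < \<bar>x\<bar>"
      \<comment> \<open>As t and s are below 1, the rescaled functions vanish outside the same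
        interval of radius R.\<close>
      have "\<bar>x\<bar> \<le> \<bar>x\<bar> / t" "\<bar>x\<bar> \<le> \<bar>x\<bar> / s" using s t by (auto simp: field_simps intro!: mult_left_le_one_le)
      then have "R < \<bar>x / t\<bar>" "R < \<bar>x / s\<bar>" using x s t by auto
      then show "U (x / t) / a = 0" "V (x / s) / b = 0" "W x / c = 0" using U V W x by auto
    qed (use U V W Ua Vb a b c in auto)
    have "(\<integral>\<^sup>+x. ennreal (U (x / t) / a) \<partial>lborel) = ennreal (t * (\<integral>x. U x \<partial>lborel) / a)"
    proof -
      have "(\<integral>\<^sup>+x. ennreal (U (x / t) / a) \<partial>lborel) = ennreal t * (\<integral>\<^sup>+x. ennreal (U x / a) \<partial>lborel)"
        using t by (subst nn_integral_real_affine[of _ t 0]) auto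
      also have "(\<integral>\<^sup>+x. ennreal (U x / a) \<partial>lborel) = ennreal (\<integral>x. U x / a \<partial>lborel)"
        using int U a by (intro nn_integral_eq_integral) auto
      finally show ?thesis using t by (simp add: ennreal_mult'[symmetric])
    qed
    moreover have "(\<integral>\<^sup>+x. ennreal (V (x / s) / b) \<partial>lborel) = ennreal (s * (\<integral>x. V x \<partial>lborel) / b)"
    proof -
      have "(\<integral>\<^sup>+x. ennreal (V (x / s) / b) \<partial>lborel) = ennreal s * (\<integral>\<^sup>+x. ennreal (V x / b) \<partial>lborel)"
        using s by (subst nn_integral_real_affine[of _ s 0]) auto
      also have "(\<integral>\<^sup>+x. ennreal (V x / b) \<partial>lborel) = ennreal (\<integral>x. V x / b \<partial>lborel)"
        using int V b by (intro nn_integral_eq_integral) auto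
      finally show ?thesis using s by (simp add: ennreal_mult'[symmetric])
    qed
    moreover have "(\<integral>\<^sup>+x. ennreal (W x / c) \<partial>lborel) = ennreal ((\<integral>x. W x \<partial>lborel) / c)"
    proof -
      have "(\<integral>\<^sup>+x. ennreal (W x / c) \<partial>lborel) = ennreal (\<integral>x. W x / c \<partial>lborel)"
        using int W c by (intro nn_integral_eq_integral) auto
      then show ?thesis by simp
    qed
    moreover have IU: "0 \<le> (\<integral>x. U x \<partial>lborel)" and IV: "0 \<le> (\<integral>x. V x \<partial>lborel)" using U V by auto
    ultimately have "t * (\<integral>x. U x \<partial>lborel) / a + s * (\<integral>x. V x \<partial>lborel) / b \<le> (\<integral>x. W x \<partial>lborel) / c"
      using * W0 s t a b c by (simp add: ennreal_plus[symmetric] del: ennreal_plus)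
    moreover have "((\<integral>x. U x \<partial>lborel) / a) powr t * ((\<integral>x. V x \<partial>lborel) / b) powr s
       \<le> t * ((\<integral>x. U x \<partial>lborel) / a) + s * ((\<integral>x. V x \<partial>lborel) / b)"
      using IU IV a b s t False by (intro Youngs_inequality_0) (auto simp: less_le)
    moreover have "((\<integral>x. U x \<partial>lborel) / a) powr t * ((\<integral>x. V x \<partial>lborel) / b) powr s =
       (\<integral>x. U x \<partial>lborel) powr t * (\<integral>x. V x \<partial>lborel) powr s / c"
      using IU IV a b by (simp add: powr_divide c_def)
    ultimately have "(\<integral>x. U x \<partial>lborel) powr t * (\<integral>x. V x \<partial>lborel) powr s / c \<le> (\<integral>x. W x \<partial>lborel) / c"
      by simp
    then show ?thesis using c by (simp add: s_def[symmetric] divide_le_cancel)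
  qed
qed

section \<open>Prekopa-Leindler in dimension n\<close>

abbreviation lebesgue_vectors :: "nat \<Rightarrow> (nat \<Rightarrow> real) measure" where
  "lebesgue_vectors n \<equiv> \<Pi>\<^sub>M i\<in>{..<n}. lborel"

interpretation lborel_prod: product_sigma_finite "\<lambda>i::nat. lborel :: real measure" ..

lemma integrable_bounded_support:
  fixes f :: "(nat \<Rightarrow> real) \<Rightarrow> real"
  assumes [measurable]: "f \<in> borel_measurable (lebesgue_vectors n)"
    and "\<And>x. \<bar>f x\<bar> \<le> M" "\<And>x i. i < n \<Longrightarrow> R < \<bar>x i\<bar> \<Longrightarrow> f x = 0"
  shows "integrable (lebesgue_vectors n) f"
proof (rule integrableI_bounded_set[of "{..<n} \<rightarrow>\<^sub>E {-R..R}" _ _ M])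
  show "AE x \<in> {..<n} \<rightarrow>\<^sub>E {-R..R} in lebesgue_vectors n. norm (f x) \<le> M" using assms by auto
  show "emeasure (lebesgue_vectors n) ({..<n} \<rightarrow>\<^sub>E {-R..R}) < \<infinity>"
    by (subst lborel_prod.emeasure_PiM) (auto simp: emeasure_lborel_Icc_eq power_less_top_ennreal power_0_left)
  show "AE x in lebesgue_vectors n. x \<notin> {..<n} \<rightarrow>\<^sub>E {-R..R} \<longrightarrow> f x = 0"
  proof (intro AE_I2 impI)
    fix x assume "x \<in> space (lebesgue_vectors n)" "x \<notin> {..<n} \<rightarrow>\<^sub>E {-R..R}"
    then obtain i where "i < n" "x i \<notin> {-R..R}" by (auto simp: space_PiM PiE_iff)
    then have "R < \<bar>x i\<bar>" by auto
    then show "f x = 0" using assms(3) \<open>i < n\<close> by blast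
  qed
qed (auto intro!: sets_PiM_I_finite)

lemma measurable_upd_last [measurable]:
  "(\<lambda>x. x(n := a)) \<in> lebesgue_vectors n \<rightarrow>\<^sub>M lebesgue_vectors (Suc n)"
  unfolding lessThan_Suc by (rule measurable_fun_upd[where J = "{..<n}"]) auto

text \<open>Slice integrals over all but the last coordinate inherit measurability, boundedness and
  bounded support, which are the hypotheses of the one-dimensional inequality in the induction
  step.\<close>

lemma integral_lebesgue_vectors_Suc:
  fixes f :: "(nat \<Rightarrow> real) \<Rightarrow> real"
  assumes f[measurable]: "f \<in> borel_measurable (lebesgue_vectors (Suc n))"
    and nn: "\<And>x. 0 \<le> f x" and M: "\<And>x. f x \<le> M"
    and supp: "\<forall>x i. i < Suc n \<longrightarrow> R < \<bar>x i\<bar> \<longrightarrow> f x = 0"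
  shows "(\<lambda>a. \<integral>x. f (x(n := a)) \<partial>lebesgue_vectors n) \<in> borel_measurable borel"
    and "(\<integral>x. f x \<partial>lebesgue_vectors (Suc n)) = (\<integral>a. (\<integral>x. f (x(n := a)) \<partial>lebesgue_vectors n) \<partial>lborel)"
    and "\<And>a. R < \<bar>a\<bar> \<Longrightarrow> (\<integral>x. f (x(n := a)) \<partial>lebesgue_vectors n) = 0"
    and "\<exists>M'. \<forall>a. (\<integral>x. f (x(n := a)) \<partial>lebesgue_vectors n) \<le> M'"
proof -
  have R: "\<And>x i. i < Suc n \<Longrightarrow> R < \<bar>x i\<bar> \<Longrightarrow> f x = 0" using supp by blast
  interpret L: sigma_finite_measure "lebesgue_vectors n" by (rule lborel_prod.sigma_finite) simp
  have pm: "(\<lambda>(a, x). f (x(n := a))) \<in> borel_measurable (borel \<Otimes>\<^sub>M lebesgue_vectors n)"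
  proof -
    have "(\<lambda>(a, x). x(n := a)) \<in> borel \<Otimes>\<^sub>M lebesgue_vectors n \<rightarrow>\<^sub>M lebesgue_vectors (Suc n)"
      unfolding lessThan_Suc case_prod_unfold by (rule measurable_fun_upd[where J = "{..<n}"]) auto
    from measurable_compose[OF this f] show ?thesis by (simp add: case_prod_unfold)
  qed
  have int: "integrable (lebesgue_vectors n) (\<lambda>x. f (x(n := a)))" for a
  proof (rule integrable_bounded_support[of _ _ M R])
    fix x i assume "i < n" "R < \<bar>x i\<bar>"
    then show "f (x(n := a)) = 0" by (intro R[of i]) auto
  qed (use nn M in auto)
  show U: "(\<lambda>a. \<integral>x. f (x(n := a)) \<partial>lebesgue_vectors n) \<in> borel_measurable borel"
    using pm by (rule L.borel_measurable_lebesgue_integral)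
  have "(\<integral>x. f x \<partial>lebesgue_vectors (Suc n)) = enn2real (\<integral>\<^sup>+x. ennreal (f x) \<partial>lebesgue_vectors (Suc n))"
    by (rule integral_eq_nn_integral) (use nn in auto)
  also have "(\<integral>\<^sup>+x. ennreal (f x) \<partial>lebesgue_vectors (Suc n)) =
      (\<integral>\<^sup>+a. (\<integral>\<^sup>+x. ennreal (f (x(n := a))) \<partial>lebesgue_vectors n) \<partial>lborel)"
    unfolding lessThan_Suc by (rule lborel_prod.product_nn_integral_insert_rev) (use f in \<open>auto simp: lessThan_Suc\<close>)
  also have "\<dots> = (\<integral>\<^sup>+a. ennreal (\<integral>x. f (x(n := a)) \<partial>lebesgue_vectors n) \<partial>lborel)"
    using int nn by (intro nn_integral_cong nn_integral_eq_integral) auto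
  also have "enn2real \<dots> = (\<integral>a. (\<integral>x. f (x(n := a)) \<partial>lebesgue_vectors n) \<partial>lborel)"
    using U nn by (intro integral_eq_nn_integral[symmetric]) auto
  finally show "(\<integral>x. f x \<partial>lebesgue_vectors (Suc n)) = (\<integral>a. (\<integral>x. f (x(n := a)) \<partial>lebesgue_vectors n) \<partial>lborel)" .
  show "(\<integral>x. f (x(n := a)) \<partial>lebesgue_vectors n) = 0" if "R < \<bar>a\<bar>" for a
  proof -
    have "f (x(n := a)) = 0" for x by (rule R[of n]) (use that in auto)
    then show ?thesis by simp
  qed
  have intM: "integrable (lebesgue_vectors n) (\<lambda>x. M * indicator ({..<n} \<rightarrow>\<^sub>E {-R..R}) x)"
  proof (rule integrable_bounded_support[of _ _ "\<bar>M\<bar>" R])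
    show "(\<lambda>x. M * indicator ({..<n} \<rightarrow>\<^sub>E {-R..R}) x) \<in> borel_measurable (lebesgue_vectors n)"
      by (intro borel_measurable_times borel_measurable_indicator) (auto intro!: sets_PiM_I_finite)
    fix x :: "nat \<Rightarrow> real" and i assume "i < n" "R < \<bar>x i\<bar>"
    then have "x \<notin> {..<n} \<rightarrow>\<^sub>E {-R..R}" by (force simp: PiE_iff)
    then show "M * indicator ({..<n} \<rightarrow>\<^sub>E {-R..R}) x = 0" by simp
  qed (auto split: split_indicator)
  have "(\<integral>x. f (x(n := a)) \<partial>lebesgue_vectors n) \<le> (\<integral>x. M * indicator ({..<n} \<rightarrow>\<^sub>E {-R..R}) x \<partial>lebesgue_vectors n)" for a
  proof (rule integral_mono[OF int intM])
    fix x assume x: "x \<in> space (lebesgue_vectors n)"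
    show "f (x(n := a)) \<le> M * indicator ({..<n} \<rightarrow>\<^sub>E {-R..R}) x"
    proof (cases "x \<in> {..<n} \<rightarrow>\<^sub>E {-R..R}")
      case False
      then obtain i where "i < n" "x i \<notin> {-R..R}" using x by (auto simp: space_PiM PiE_iff)
      then have "f (x(n := a)) = 0" by (intro R[of i]) auto
      then show ?thesis using False by simp
    qed (use M in auto)
  qed
  then show "\<exists>M'. \<forall>a. (\<integral>x. f (x(n := a)) \<partial>lebesgue_vectors n) \<le> M'" by blast
qed

text \<open>Induction on n. The slices of u at a, of v at b and of w at t * a + (1 - t) * b satisfy
  the hypothesis in dimension n, so the slice integrals satisfy it in dimension 1.\<close>

theorem prekopa_leindler:
  fixes u v w :: "(nat \<Rightarrow> real) \<Rightarrow> real"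
  assumes t: "0 < t" "t < 1"
    and [measurable]: "u \<in> borel_measurable (lebesgue_vectors n)" "v \<in> borel_measurable (lebesgue_vectors n)"
      "w \<in> borel_measurable (lebesgue_vectors n)"
    and u: "\<And>x. 0 \<le> u x" "\<And>x. u x \<le> M" "\<And>x i. i < n \<Longrightarrow> R < \<bar>x i\<bar> \<Longrightarrow> u x = 0"
    and v: "\<And>x. 0 \<le> v x" "\<And>x. v x \<le> M" "\<And>x i. i < n \<Longrightarrow> R < \<bar>x i\<bar> \<Longrightarrow> v x = 0"
    and w: "\<And>x. 0 \<le> w x" "\<And>x. w x \<le> M" "\<And>x i. i < n \<Longrightarrow> R < \<bar>x i\<bar> \<Longrightarrow> w x = 0"
    and uvw: "\<And>x y. x \<in> {..<n} \<rightarrow>\<^sub>E UNIV \<Longrightarrow> y \<in> {..<n} \<rightarrow>\<^sub>E UNIV \<Longrightarrow>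
      u x powr t * v y powr (1 - t) \<le> w (\<lambda>i\<in>{..<n}. t * x i + (1 - t) * y i)"
  shows "(\<integral>x. u x \<partial>lebesgue_vectors n) powr t * (\<integral>x. v x \<partial>lebesgue_vectors n) powr (1 - t)
    \<le> (\<integral>x. w x \<partial>lebesgue_vectors n)"
  using assms(3-)
proof (induction n arbitrary: u v w M)
  \<comment> \<open>Dimension 0 has the single point that is \<open>undefined\<close> everywhere,
    and the hypothesis at this point is the claim.\<close>
  case 0
  have [simp]: "(\<lambda>i\<in>{}. f i) = (\<lambda>_::nat. undefined :: real)" for f by (auto simp: restrict_def)
  have e: "(\<integral>x. f x \<partial>lebesgue_vectors 0) = f (\<lambda>_. undefined)" for f :: "(nat \<Rightarrow> real) \<Rightarrow> real"
    by (simp add: PiM_empty lebesgue_integral_count_space_finite)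
  show ?case using "0.prems"(13)[of "\<lambda>_. undefined" "\<lambda>_. undefined"] unfolding e by simp
next
  case (Suc n)
  note m = Suc.prems(1-3)
  note u = Suc.prems(4-6) and v = Suc.prems(7-9) and w = Suc.prems(10-12)
  have s: "\<forall>x i. i < Suc n \<longrightarrow> R < \<bar>x i\<bar> \<longrightarrow> u x = 0" "\<forall>x i. i < Suc n \<longrightarrow> R < \<bar>x i\<bar> \<longrightarrow> v x = 0"
    "\<forall>x i. i < Suc n \<longrightarrow> R < \<bar>x i\<bar> \<longrightarrow> w x = 0" using u(3) v(3) w(3) by blast+
  let ?I = "\<lambda>f a. \<integral>x. f (x(n := a)) \<partial>lebesgue_vectors n"
  note Iu = integral_lebesgue_vectors_Suc[OF m(1) u(1,2) s(1)] and Iv = integral_lebesgue_vectors_Suc[OF m(2) v(1,2) s(2)]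
    and Iw = integral_lebesgue_vectors_Suc[OF m(3) w(1,2) s(3)]
  obtain Mu Mv Mw where M: "\<And>a. ?I u a \<le> Mu" "\<And>a. ?I v a \<le> Mv" "\<And>a. ?I w a \<le> Mw"
    using Iu(4) Iv(4) Iw(4) by blast
  have "(\<integral>a. ?I u a \<partial>lborel) powr t * (\<integral>a. ?I v a \<partial>lborel) powr (1 - t) \<le> (\<integral>a. ?I w a \<partial>lborel)"
  proof (rule prekopa_leindler_real[OF t Iu(1) Iv(1) Iw(1), of "max Mu (max Mv Mw)" R])
    fix a b :: real
    show "?I u a powr t * ?I v b powr (1 - t) \<le> ?I w (t * a + (1 - t) * b)"
    proof (rule Suc.IH[of _ _ _ M])
      show "(\<lambda>x. u (x(n := a))) \<in> borel_measurable (lebesgue_vectors n)"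
        "(\<lambda>x. v (x(n := b))) \<in> borel_measurable (lebesgue_vectors n)"
        "(\<lambda>x. w (x(n := t * a + (1 - t) * b))) \<in> borel_measurable (lebesgue_vectors n)"
        using m by (auto intro: measurable_compose[OF measurable_upd_last])
      fix x i assume i: "i < n" "R < \<bar>x i\<bar>"
      show "u (x(n := a)) = 0" by (rule u(3)[of i]) (use i in auto)
      show "v (x(n := b)) = 0" by (rule v(3)[of i]) (use i in auto)
      show "w (x(n := t * a + (1 - t) * b)) = 0" by (rule w(3)[of i]) (use i in auto)
    next
      fix x y :: "nat \<Rightarrow> real" assume xy: "x \<in> {..<n} \<rightarrow>\<^sub>E UNIV" "y \<in> {..<n} \<rightarrow>\<^sub>E UNIV"
      have "(\<lambda>i\<in>{..<n}. t * x i + (1 - t) * y i)(n := t * a + (1 - t) * b)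
         = (\<lambda>i\<in>{..<Suc n}. t * (x(n := a)) i + (1 - t) * (y(n := b)) i)"
        by (auto simp: fun_eq_iff restrict_def)
      note upd = this
      have "x(n := a) \<in> {..<Suc n} \<rightarrow>\<^sub>E UNIV" "y(n := b) \<in> {..<Suc n} \<rightarrow>\<^sub>E UNIV"
        using xy by (auto simp: PiE_iff extensional_def)
      then show "u (x(n := a)) powr t * v (y(n := b)) powr (1 - t) \<le>
          w ((\<lambda>i\<in>{..<n}. t * x i + (1 - t) * y i)(n := t * a + (1 - t) * b))"
        unfolding upd by (rule Suc.prems(13))
    qed (use u v w in auto)
  qed (use u v w M Iu(3) Iv(3) Iw(3) in \<open>auto simp: le_max_iff_disj\<close>)
  then show ?case unfolding Iu(2) Iv(2) Iw(2) .
qed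

subsection \<open>Entropy and local slopes under a strongly convex potential\<close>

abbreviation vnorm :: "nat \<Rightarrow> (nat \<Rightarrow> real) \<Rightarrow> real" where
  "vnorm n x \<equiv> L2_set x {..<n}"

abbreviation vdist :: "nat \<Rightarrow> (nat \<Rightarrow> real) \<Rightarrow> (nat \<Rightarrow> real) \<Rightarrow> real" where
  "vdist n x y \<equiv> L2_set (\<lambda>i. x i - y i) {..<n}"

text \<open>The restriction keeps the combination \<open>undefined\<close> off
  \<open>{..<n}\<close>, hence inside the space of the product measure.\<close>

definition convex_comb :: "nat \<Rightarrow> real \<Rightarrow> (nat \<Rightarrow> real) \<Rightarrow> (nat \<Rightarrow> real) \<Rightarrow> nat \<Rightarrow> real" where
  "convex_comb n t x y = (\<lambda>i\<in>{..<n}. t * x i + (1 - t) * y i)"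

lemma vnorm_sq: "(vnorm n x)\<^sup>2 = (\<Sum>i<n. (x i)\<^sup>2)"
  by (simp add: L2_set_def sum_nonneg)

lemma vdist_convex_comb:
  assumes "0 \<le> t" "t \<le> 1"
  shows "vdist n x (convex_comb n t x y) = (1 - t) * vdist n x y"
proof -
  have "vdist n x (convex_comb n t x y) = L2_set (\<lambda>i. (1 - t) * (x i - y i)) {..<n}"
    by (intro L2_set_cong) (auto simp: convex_comb_def algebra_simps)
  also have "\<dots> = (1 - t) * vdist n x y"
    using assms by (simp add: L2_set_right_distrib)
  finally show ?thesis .
qed

text \<open>Makes functions that are continuous for the product topology on
  \<open>nat \<Rightarrow> real\<close> measurable for the finite product: on its space the
  remaining coordinates are the constant \<open>undefined\<close>.\<close>

lemma measurable_vectors_borel: "(\<lambda>x. x) \<in> (\<Pi>\<^sub>M i\<in>{..<n::nat}. (borel :: real measure)) \<rightarrow>\<^sub>M borel"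
proof -
  have "(\<lambda>x. x) \<in> (\<Pi>\<^sub>M i\<in>{..<n}. (borel :: real measure)) \<rightarrow>\<^sub>M (\<Pi>\<^sub>M i\<in>UNIV. borel)"
  proof (rule measurable_PiM_single')
    fix i :: nat
    show "(\<lambda>x. x i) \<in> (\<Pi>\<^sub>M i\<in>{..<n}. (borel :: real measure)) \<rightarrow>\<^sub>M borel"
    proof (cases "i < n")
      case False
      have "(\<lambda>x. x i) \<in> (\<Pi>\<^sub>M i\<in>{..<n}. (borel :: real measure)) \<rightarrow>\<^sub>M borel \<longleftrightarrow>
        (\<lambda>x. undefined) \<in> (\<Pi>\<^sub>M i\<in>{..<n}. (borel :: real measure)) \<rightarrow>\<^sub>M (borel :: real measure)"
        using False by (intro measurable_cong) (auto simp: space_PiM PiE_iff extensional_def)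
      then show ?thesis by simp
    qed simp
  qed auto
  then show ?thesis by (simp add: measurable_cong_sets[OF refl sets_PiM_equal_borel])
qed

lemma sets_lebesgue_vectors: "sets (lebesgue_vectors n) = sets (\<Pi>\<^sub>M i\<in>{..<n}. (borel :: real measure))"
  by (intro sets_PiM_cong) auto

lemma measurable_lebesgue_vectors_borel: "(\<lambda>x. x) \<in> lebesgue_vectors n \<rightarrow>\<^sub>M borel"
  using measurable_vectors_borel measurable_cong_sets[OF sets_lebesgue_vectors refl] by blast

lemma vnorm_measurable [measurable]: "vnorm n \<in> borel_measurable (lebesgue_vectors n)"
  unfolding L2_set_def by measurable

text \<open>The Hopf-Lax formula at time \<open>\<tau>\<close> in its supremum form, with the
  supremum taken over B only.\<close>

definition sup_convolution :: "nat \<Rightarrow> (nat \<Rightarrow> real) set \<Rightarrow> real \<Rightarrow> ((nat \<Rightarrow> real) \<Rightarrow> real) \<Rightarrow> (nat \<Rightarrow> real) \<Rightarrow> real" where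
  "sup_convolution n B \<tau> g z = (SUP x\<in>B. g x - (vdist n x z)\<^sup>2 / (2 * \<tau>))"

text \<open>\<open>V_convex\<close> says that V - (\<open>\<kappa>\<close> / 2) * (norm x)^2 is
  convex on B, in a form free of derivatives. The bounds on B and V make every bounded measurable
  function integrable.\<close>

locale strongly_log_concave =
  fixes n :: nat and B :: "(nat \<Rightarrow> real) set" and V :: "(nat \<Rightarrow> real) \<Rightarrow> real" and \<kappa> R M :: real
  assumes B_sub: "B \<subseteq> {..<n} \<rightarrow>\<^sub>E UNIV"
    and B_meas [measurable]: "B \<in> sets (lebesgue_vectors n)"
    and B_bdd: "\<And>x i. x \<in> B \<Longrightarrow> i < n \<Longrightarrow> \<bar>x i\<bar> \<le> R"
    and B_convex: "\<And>x y t. x \<in> B \<Longrightarrow> y \<in> B \<Longrightarrow> 0 < t \<Longrightarrow> t < 1 \<Longrightarrow> convex_comb n t x y \<in> B"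
    and B_pos: "0 < emeasure (lebesgue_vectors n) B"
    and V_meas [measurable]: "V \<in> borel_measurable (lebesgue_vectors n)"
    and V_bdd: "\<And>x. x \<in> B \<Longrightarrow> \<bar>V x\<bar> \<le> M"
    and \<kappa>: "0 < \<kappa>"
    and V_convex: "\<And>x y t. x \<in> B \<Longrightarrow> y \<in> B \<Longrightarrow> 0 < t \<Longrightarrow> t < 1 \<Longrightarrow>
      V (convex_comb n t x y) \<le> t * V x + (1 - t) * V y - \<kappa> * t * (1 - t) / 2 * (vdist n x y)\<^sup>2"
begin

text \<open>Not normalised: the mass appears explicitly as the integral of 1 in the entropies
  below.\<close>

definition \<nu> :: "(nat \<Rightarrow> real) measure" where
  "\<nu> = density (lebesgue_vectors n) (\<lambda>x. ennreal (indicator B x * exp (- V x)))"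

lemma sets_\<nu> [measurable_cong, simp]: "sets \<nu> = sets (lebesgue_vectors n)"
  by (simp add: \<nu>_def)

lemma AE_\<nu>: "(\<And>x. x \<in> B \<Longrightarrow> P x) \<Longrightarrow> AE x in \<nu>. P x"
  unfolding \<nu>_def by (subst AE_density) (auto simp: indicator_def)

lemma integral_\<nu>:
  fixes F :: "(nat \<Rightarrow> real) \<Rightarrow> real"
  assumes [measurable]: "F \<in> borel_measurable (lebesgue_vectors n)"
  shows "(\<integral>x. F x \<partial>\<nu>) = (\<integral>x. indicator B x * (exp (- V x) * F x) \<partial>lebesgue_vectors n)"
  unfolding \<nu>_def by (subst integral_density) (auto intro!: Bochner_Integration.integral_cong)

lemma integrable_\<nu>:
  fixes F :: "(nat \<Rightarrow> real) \<Rightarrow> real"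
  assumes [measurable]: "F \<in> borel_measurable (lebesgue_vectors n)"
  shows "integrable \<nu> F \<longleftrightarrow> integrable (lebesgue_vectors n) (\<lambda>x. indicator B x * (exp (- V x) * F x))"
  unfolding \<nu>_def by (subst integrable_density) (auto intro!: Bochner_Integration.integrable_cong)

lemma B_not_large: "x \<in> B \<Longrightarrow> i < n \<Longrightarrow> R < \<bar>x i\<bar> \<Longrightarrow> False"
  using B_bdd[of x i] by simp

lemma integrable_bounded:
  fixes F :: "(nat \<Rightarrow> real) \<Rightarrow> real"
  assumes [measurable]: "F \<in> borel_measurable (lebesgue_vectors n)" and "\<And>x. x \<in> B \<Longrightarrow> \<bar>F x\<bar> \<le> C"
  shows "integrable \<nu> F"
  unfolding integrable_\<nu>[OF assms(1)]
proof -
  show "integrable (lebesgue_vectors n) (\<lambda>x. indicator B x * (exp (- V x) * F x))"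
  proof (rule integrable_bounded_support[of _ _ "exp M * \<bar>C\<bar>" R])
    fix x :: "nat \<Rightarrow> real"
    show "\<bar>indicator B x * (exp (- V x) * F x)\<bar> \<le> exp M * \<bar>C\<bar>"
    proof (cases "x \<in> B")
      case True
      have "exp (- V x) * \<bar>F x\<bar> \<le> exp M * \<bar>C\<bar>"
        using V_bdd[OF True] assms(2)[OF True] by (intro mult_mono) auto
      then show ?thesis using True by (simp add: abs_mult)
    qed simp
  qed (auto dest: B_not_large split: split_indicator)
qed

lemma mass_pos: "0 < (\<integral>x. (1::real) \<partial>\<nu>)"
proof -
  have i: "integrable \<nu> (\<lambda>x. 1 :: real)" by (rule integrable_bounded[of _ 1]) auto
  have "(\<integral>x. (1::real) \<partial>\<nu>) \<noteq> 0"
  proof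
    assume "(\<integral>x. 1 \<partial>\<nu>) = (0::real)"
    then have "AE x in \<nu>. (1::real) = 0" by (subst (asm) integral_nonneg_eq_0_iff_AE[OF i]) auto
    then have "AE x in lebesgue_vectors n. x \<notin> B"
      unfolding \<nu>_def by (subst (asm) AE_density) (auto simp: indicator_def)
    then have "emeasure (lebesgue_vectors n) B = 0"
      using B_sub by (subst (asm) AE_iff_measurable[OF B_meas]) (auto simp: space_PiM)
    then show False using B_pos by simp
  qed
  moreover have "0 \<le> (\<integral>x. (1::real) \<partial>\<nu>)" by (rule integral_nonneg_AE) auto
  ultimately show ?thesis by (simp add: less_le)
qed

section \<open>Sup-convolutions and entropy\<close>

lemma sup_convolution_bdd_above:
  assumes "\<And>x. x \<in> B \<Longrightarrow> \<bar>g x\<bar> \<le> C" "0 < \<tau>"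
  shows "bdd_above ((\<lambda>x. g x - (vdist n x z)\<^sup>2 / (2 * \<tau>)) ` B)"
proof (rule bdd_aboveI2)
  fix x assume "x \<in> B"
  then have "g x \<le> C" using assms(1)[of x] by simp
  moreover have "0 \<le> (vdist n x z)\<^sup>2 / (2 * \<tau>)" using assms(2) by simp
  ultimately show "g x - (vdist n x z)\<^sup>2 / (2 * \<tau>) \<le> C" by linarith
qed

lemma B_ne: "B \<noteq> {}" using B_pos by auto

text \<open>The supremum runs over an uncountable set, but of functions continuous in z, so its
  strict superlevel sets are unions of open sets.\<close>

lemma sup_convolution_measurable:
  assumes "\<And>x. x \<in> B \<Longrightarrow> \<bar>g x\<bar> \<le> C" "0 < \<tau>"
  shows "sup_convolution n B \<tau> g \<in> borel_measurable (lebesgue_vectors n)"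
proof -
  have "sup_convolution n B \<tau> g \<in> borel_measurable borel"
  proof (rule borel_measurableI_greater)
    fix c :: real
    have "{z \<in> space borel. c < sup_convolution n B \<tau> g z}
       = (\<Union>x\<in>B. {z. c < g x - (vdist n x z)\<^sup>2 / (2 * \<tau>)})"
      unfolding sup_convolution_def
      by (subst less_cSUP_iff[OF B_ne sup_convolution_bdd_above[OF assms]]) auto
    moreover have "open (\<Union>x\<in>B. {z. c < g x - (vdist n x z)\<^sup>2 / (2 * \<tau>)})"
      unfolding vnorm_sq using assms(2)
      by (intro open_UN ballI open_Collect_less continuous_intros continuous_on_product_coordinates) auto
    ultimately show "{z \<in> space borel. c < sup_convolution n B \<tau> g z} \<in> sets borel" by simp
  qed
  then show ?thesis by (rule measurable_compose[OF measurable_lebesgue_vectors_borel])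
qed

lemma sup_convolution_ge:
  assumes "\<And>x. x \<in> B \<Longrightarrow> \<bar>g x\<bar> \<le> C" "0 < \<tau>" "x \<in> B"
  shows "g x - (vdist n x z)\<^sup>2 / (2 * \<tau>) \<le> sup_convolution n B \<tau> g z"
  unfolding sup_convolution_def by (rule cSUP_upper[OF assms(3) sup_convolution_bdd_above[OF assms(1,2)]])

lemma sup_convolution_le:
  assumes "\<And>x. x \<in> B \<Longrightarrow> g x - (vdist n x z)\<^sup>2 / (2 * \<tau>) \<le> c"
  shows "sup_convolution n B \<tau> g z \<le> c"
  unfolding sup_convolution_def by (rule cSUP_least[OF B_ne assms])

text \<open>Prekopa-Leindler with t = 1 - s for exp (g / t - V), exp (- V) and exp (Q g - V). At z =
  t x + (1 - t) y the distance from x to z is s |x - y|, so the convexity gain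
  \<open>\<kappa>\<close> t s / 2 * |x - y|^2 is exactly the penalty of the sup-convolution at time
  s / (\<open>\<kappa>\<close> (1 - s)).\<close>

lemma integral_exp_sup_convolution:
  fixes g :: "(nat \<Rightarrow> real) \<Rightarrow> real"
  assumes s: "0 < s" "s < 1" and [measurable]: "g \<in> borel_measurable (lebesgue_vectors n)"
    and C: "\<And>x. x \<in> B \<Longrightarrow> \<bar>g x\<bar> \<le> C"
  shows "(\<integral>x. exp (g x / (1 - s)) \<partial>\<nu>) powr (1 - s) * (\<integral>x. 1 \<partial>\<nu>) powr s
    \<le> (\<integral>x. exp (sup_convolution n B (s / (\<kappa> * (1 - s))) g x) \<partial>\<nu>)"
proof -
  define t where "t = 1 - s"
  define \<tau> where "\<tau> = s / (\<kappa> * t)"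
  have t: "0 < t" "t < 1" "s = 1 - t" using s by (auto simp: t_def)
  have \<tau>: "0 < \<tau>" using t s \<kappa> by (simp add: \<tau>_def)
  let ?Q = "sup_convolution n B \<tau> g"
  have [measurable]: "?Q \<in> borel_measurable (lebesgue_vectors n)"
    by (rule sup_convolution_measurable[OF C \<tau>])
  have QC: "?Q z \<le> C" for z
  proof (rule sup_convolution_le)
    fix x assume "x \<in> B"
    then have "g x \<le> C" using C[of x] by simp
    moreover have "0 \<le> (vdist n x z)\<^sup>2 / (2 * \<tau>)" using \<tau> by simp
    ultimately show "g x - (vdist n x z)\<^sup>2 / (2 * \<tau>) \<le> C" by linarith
  qed
  define u where "u = (\<lambda>x. indicator B x * (exp (- V x) * exp (g x / t)))"
  define v where "v = (\<lambda>x. indicator B x * (exp (- V x) * 1))"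
  define w where "w = (\<lambda>x. indicator B x * (exp (- V x) * exp (?Q x)))"
  let ?M = "exp (M + \<bar>C\<bar> / t)"
  have bound: "indicator B x * (exp (- V x) * exp y) \<le> ?M" if "x \<in> B \<Longrightarrow> y \<le> \<bar>C\<bar> / t" for x y
    using that V_bdd[of x] by (auto split: split_indicator simp: mult_exp_exp abs_le_iff intro!: add_mono)
  have Ct: "C \<le> \<bar>C\<bar> / t" "0 \<le> \<bar>C\<bar> / t"
  proof -
    have "\<bar>C\<bar> * t \<le> \<bar>C\<bar>" using t by (intro mult_left_le) auto
    then have "\<bar>C\<bar> \<le> \<bar>C\<bar> / t" using t by (simp add: field_simps)
    then show "C \<le> \<bar>C\<bar> / t" by linarith
  qed (use t in auto)
  have "(\<integral>x. u x \<partial>lebesgue_vectors n) powr t * (\<integral>x. v x \<partial>lebesgue_vectors n) powr (1 - t)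
    \<le> (\<integral>x. w x \<partial>lebesgue_vectors n)"
  proof (rule prekopa_leindler[OF t(1,2), of u n v w ?M R])
    show "u \<in> borel_measurable (lebesgue_vectors n)" "v \<in> borel_measurable (lebesgue_vectors n)"
      "w \<in> borel_measurable (lebesgue_vectors n)"
      unfolding u_def v_def w_def by measurable
    fix x :: "nat \<Rightarrow> real"
    show "0 \<le> u x" "0 \<le> v x" "0 \<le> w x" by (auto simp: u_def v_def w_def)
    show "u x \<le> ?M" unfolding u_def
    proof (rule bound)
      assume "x \<in> B"
      then have "g x \<le> \<bar>C\<bar>" using C[of x] by simp
      then show "g x / t \<le> \<bar>C\<bar> / t" using t by (simp add: divide_right_mono)
    qed
    show "v x \<le> ?M" unfolding v_def using bound[of x 0] Ct by simp
    show "w x \<le> ?M" unfolding w_def using QC[of x] Ct by (intro bound) linarith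
    show "u x = 0" "v x = 0" "w x = 0" if "i < n" "R < \<bar>x i\<bar>" for i
      using that B_not_large[of x i] by (auto simp: u_def v_def w_def indicator_def)
  next
    fix x y :: "nat \<Rightarrow> real"
    assume "x \<in> {..<n} \<rightarrow>\<^sub>E UNIV" "y \<in> {..<n} \<rightarrow>\<^sub>E UNIV"
    let ?z = "convex_comb n t x y"
    show "u x powr t * v y powr (1 - t) \<le> w (\<lambda>i\<in>{..<n}. t * x i + (1 - t) * y i)"
      unfolding convex_comb_def[symmetric]
    proof (cases "x \<in> B \<and> y \<in> B")
      case True
      then have z: "?z \<in> B" using B_convex t by blast
      have "u x powr t * v y powr (1 - t) = exp (t * (g x / t - V x) + (1 - t) * (- V y))"
        using True by (simp add: u_def v_def exp_powr_real mult_exp_exp algebra_simps)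
      also have "\<dots> \<le> exp (- V ?z + ?Q ?z)"
      proof -
        have "(vdist n x ?z)\<^sup>2 / (2 * \<tau>) = \<kappa> * t * (1 - t) / 2 * (vdist n x y)\<^sup>2"
        proof -
          have "(s * d)\<^sup>2 / (2 * (s / (\<kappa> * t))) = \<kappa> * t * s / 2 * d\<^sup>2" for d
            using s t \<kappa> by (simp add: field_simps power2_eq_square)
          then show ?thesis
            using t by (simp add: vdist_convex_comb \<tau>_def)
        qed
        then have "g x - \<kappa> * t * (1 - t) / 2 * (vdist n x y)\<^sup>2 \<le> ?Q ?z"
          using sup_convolution_ge[where g = g and x = x and z = ?z, OF C \<tau>] True by simp
        moreover have "V ?z \<le> t * V x + (1 - t) * V y - \<kappa> * t * (1 - t) / 2 * (vdist n x y)\<^sup>2"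
          using V_convex True t by blast
        moreover have "t * (g x / t - V x) = g x - t * V x" using t by (simp add: field_simps)
        ultimately show ?thesis by simp
      qed
      also have "\<dots> = w ?z" using z by (simp add: w_def mult_exp_exp)
      finally show "u x powr t * v y powr (1 - t) \<le> w ?z" .
    next
      case False
      then show "u x powr t * v y powr (1 - t) \<le> w ?z"
        using t by (auto simp: u_def v_def w_def)
    qed
  qed
  moreover have "(\<integral>x. u x \<partial>lebesgue_vectors n) = (\<integral>x. exp (g x / t) \<partial>\<nu>)"
    "(\<integral>x. v x \<partial>lebesgue_vectors n) = (\<integral>x. 1 \<partial>\<nu>)" "(\<integral>x. w x \<partial>lebesgue_vectors n) = (\<integral>x. exp (?Q x) \<partial>\<nu>)"
    unfolding u_def v_def w_def by (rule integral_\<nu>[symmetric], measurable)+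
  ultimately show ?thesis
    unfolding \<tau>_def t_def by simp
qed

text \<open>Jensen's inequality for the tilted measure \<open>exp g\<close> replaces the differentiation in the
  parameter of the Prekopa-Leindler inequality.\<close>

lemma entropy_le_sup_convolution:
  fixes g :: "(nat \<Rightarrow> real) \<Rightarrow> real"
  assumes s: "0 < s" "s < 1" and [measurable]: "g \<in> borel_measurable (lebesgue_vectors n)"
    and C: "\<And>x. x \<in> B \<Longrightarrow> \<bar>g x\<bar> \<le> C"
  shows "(\<integral>x. g x * exp (g x) \<partial>\<nu>) - (\<integral>x. exp (g x) \<partial>\<nu>) * ln ((\<integral>x. exp (g x) \<partial>\<nu>) / (\<integral>x. 1 \<partial>\<nu>))
    \<le> (\<integral>x. (exp (sup_convolution n B (s / (\<kappa> * (1 - s))) g x) - exp (g x)) / s \<partial>\<nu>)"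
proof -
  define t where "t = 1 - s"
  have t: "0 < t" "t < 1" using s by (auto simp: t_def)
  define \<tau> where "\<tau> = s / (\<kappa> * (1 - s))"
  let ?Q = "sup_convolution n B \<tau> g"
  have \<tau>: "0 < \<tau>" using s \<kappa> by (simp add: \<tau>_def)
  have [measurable]: "?Q \<in> borel_measurable (lebesgue_vectors n)"
    by (rule sup_convolution_measurable[OF C \<tau>])
  have Qg: "g x \<le> ?Q x" if "x \<in> B" for x using sup_convolution_ge[where g = g and x = x and z = x, OF C \<tau> that] by (simp add: L2_set_def)
  have QC: "?Q x \<le> C" for x
  proof (rule sup_convolution_le)
    fix y assume "y \<in> B"
    then have "g y \<le> C" using C[of y] by simp
    moreover have "0 \<le> (vdist n y x)\<^sup>2 / (2 * \<tau>)" using \<tau> by simp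
    ultimately show "g y - (vdist n y x)\<^sup>2 / (2 * \<tau>) \<le> C" by linarith
  qed
  have gC: "g x \<le> C" if "x \<in> B" for x using C[OF that] by simp
  have iQ: "integrable \<nu> (\<lambda>x. exp (?Q x))"
    by (rule integrable_bounded[of _ "exp C"]) (use QC in auto)
  have ig: "integrable \<nu> (\<lambda>x. exp (g x))"
    by (rule integrable_bounded[of _ "exp C"]) (use gC in auto)
  have igg: "integrable \<nu> (\<lambda>x. g x * exp (g x))"
  proof (rule integrable_bounded[of _ "\<bar>C\<bar> * exp C"])
    fix x assume "x \<in> B"
    then show "\<bar>g x * exp (g x)\<bar> \<le> \<bar>C\<bar> * exp C"
      using C[of x] by (auto simp: abs_mult intro!: mult_mono)
  qed simp
  have igt: "integrable \<nu> (\<lambda>x. exp (g x / t))"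
    by (rule integrable_bounded[of _ "exp (C / t)"]) (use gC t in \<open>auto simp: divide_right_mono\<close>)
  have i1: "integrable \<nu> (\<lambda>x. 1 :: real)" by (rule integrable_bounded[of _ 1]) auto
  define a where "a = (\<integral>x. exp (g x) \<partial>\<nu>)"
  define G where "G = (\<integral>x. g x * exp (g x) \<partial>\<nu>)"
  define Z where "Z = (\<integral>x. (1::real) \<partial>\<nu>)"
  have Z: "0 < Z" using mass_pos by (simp add: Z_def)
  have "(\<integral>x. exp (- C) * 1 \<partial>\<nu>) \<le> a" unfolding a_def
  proof (rule integral_mono_AE[OF integrable_mult_right[OF i1] ig], rule AE_\<nu>)
    fix x assume "x \<in> B"
    then show "exp (- C) * 1 \<le> exp (g x)" using C[of x] by simp
  qed
  then have "exp (- C) * Z \<le> a" unfolding Z_def by (simp only: integral_mult_right_zero)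
  moreover have "0 < exp (- C) * Z" using Z by simp
  ultimately have a: "0 < a" by linarith
  \<comment> \<open>The mean of (s / t) * g under the normalised tilted measure; Jensen's inequality
    is then the integrated tangent line bound exp y \<ge> exp c * (1 + y - c).\<close>
  define c where "c = s / t * (G / a)"
  have "exp c * a = (\<integral>x. exp c * (exp (g x) + s / t * (g x * exp (g x)) - c * exp (g x)) \<partial>\<nu>)"
    using ig igg a by (simp add: a_def[symmetric] G_def[symmetric] c_def)
  also have "\<dots> \<le> (\<integral>x. exp (g x / t) \<partial>\<nu>)"
  proof (rule integral_mono)
    fix x
    have "exp c * (1 + (s / t * g x - c)) \<le> exp c * exp (s / t * g x - c)"
      by (intro mult_left_mono) (auto simp: exp_ge_add_one_self)
    also have "\<dots> = exp (s / t * g x)" by (simp add: exp_diff)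
    finally have "exp (g x) * (exp c * (1 + (s / t * g x - c))) \<le> exp (g x) * exp (s / t * g x)"
      by (intro mult_left_mono) auto
    also have "\<dots> = exp (g x / t)"
      using t by (simp add: exp_add[symmetric] t_def field_simps)
    finally show "exp c * (exp (g x) + s / t * (g x * exp (g x)) - c * exp (g x)) \<le> exp (g x / t)"
      by (simp add: algebra_simps)
  qed (use ig igg igt in auto)
  finally have "(exp c * a) powr t \<le> (\<integral>x. exp (g x / t) \<partial>\<nu>) powr t"
    using a t by (intro powr_mono2) auto
  then have "(exp c * a) powr t * Z powr s \<le> (\<integral>x. exp (g x / t) \<partial>\<nu>) powr t * Z powr s"
    by (intro mult_right_mono) auto
  also have "\<dots> \<le> (\<integral>x. exp (?Q x) \<partial>\<nu>)"
    using integral_exp_sup_convolution[OF s _ C] by (simp add: t_def Z_def \<tau>_def)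
  also have "(exp c * a) powr t * Z powr s = exp (t * (c + ln a) + s * ln Z)"
    using a Z by (simp add: powr_def ln_mult exp_add)
  also have "t * (c + ln a) + s * ln Z = ln a + s * (G / a - ln (a / Z))"
    using a Z t by (simp add: c_def ln_div t_def field_simps)
  also have "exp \<dots> = a * exp (s * (G / a - ln (a / Z)))"
    using a by (simp add: exp_add)
  finally have "a * exp (s * (G / a - ln (a / Z))) \<le> (\<integral>x. exp (?Q x) \<partial>\<nu>)" .
  \<comment> \<open>The tangent line bound once more. It makes the inequality linear in s and valid
    for each fixed s, so no derivative at s = 0 is taken.\<close>
  moreover have "a * (1 + s * (G / a - ln (a / Z))) \<le> a * exp (s * (G / a - ln (a / Z)))"
    using a by (intro mult_left_mono) (auto simp: exp_ge_add_one_self)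
  moreover have "a * (1 + s * (G / a - ln (a / Z))) = a + s * (G - a * ln (a / Z))"
    using a by (simp add: field_simps)
  ultimately have "s * (G - a * ln (a / Z)) \<le> (\<integral>x. exp (?Q x) \<partial>\<nu>) - a"
    by linarith
  then have "G - a * ln (a / Z) \<le> ((\<integral>x. exp (?Q x) \<partial>\<nu>) - a) / s"
    using s by (simp add: field_simps)
  also have "\<dots> = (\<integral>x. (exp (?Q x) - exp (g x)) / s \<partial>\<nu>)"
    using iQ ig by (simp add: a_def)
  finally show ?thesis by (simp add: a_def G_def Z_def \<tau>_def)
qed

text \<open>Here s tends to 0 in the previous bound. Near z the function g grows at rate at most
  \<open>D z\<close>, so Q g - g is at most about \<open>\<tau>\<close> * (D z)^2 / 2, and
  \<open>\<tau>\<close> / s tends to 1 / \<open>\<kappa>\<close>. The global rate \<open>K\<close>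
  provides domination only; \<open>B'\<close> leaves room for a null set on which slopes are not
  controlled.\<close>

lemma entropy_le_local_slope:
  fixes g D K :: "(nat \<Rightarrow> real) \<Rightarrow> real" and B' :: "(nat \<Rightarrow> real) set"
  assumes [measurable]: "g \<in> borel_measurable (lebesgue_vectors n)"
      "D \<in> borel_measurable (lebesgue_vectors n)" "K \<in> borel_measurable (lebesgue_vectors n)"
    and C: "\<And>x. x \<in> B \<Longrightarrow> \<bar>g x\<bar> \<le> C"
    and B': "B' \<subseteq> B" "AE z in \<nu>. z \<in> B'"
    and D: "\<And>z. z \<in> B' \<Longrightarrow> 0 \<le> D z" "\<And>z. z \<in> B' \<Longrightarrow> D z \<le> K z"
    and slope: "\<And>z \<eta>. z \<in> B' \<Longrightarrow> 0 < \<eta> \<Longrightarrow>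
      \<exists>\<delta>>0. \<forall>x\<in>B. vdist n x z < \<delta> \<longrightarrow> g x - g z \<le> (D z + \<eta>) * vdist n x z"
    and lip: "\<And>x z. x \<in> B \<Longrightarrow> z \<in> B' \<Longrightarrow> g x - g z \<le> K z * vdist n x z"
    and K: "integrable \<nu> (\<lambda>z. (K z)\<^sup>2)"
  shows "(\<integral>x. g x * exp (g x) \<partial>\<nu>) - (\<integral>x. exp (g x) \<partial>\<nu>) * ln ((\<integral>x. exp (g x) \<partial>\<nu>) / (\<integral>x. 1 \<partial>\<nu>))
    \<le> (\<integral>x. (D x)\<^sup>2 * exp (g x) \<partial>\<nu>) / (2 * \<kappa>)"
proof -
  have AE': "AE z in \<nu>. P z" if "\<And>z. z \<in> B' \<Longrightarrow> P z" for P
    using B'(2) by (rule AE_mp) (use that in auto)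
  have B'B: "z \<in> B" if "z \<in> B'" for z using that B'(1) by blast
  \<comment> \<open>Starting at 1/2 keeps 1 - s k \<ge> 1/2, hence
    \<open>\<tau> k / s k \<le> 2 / \<kappa>\<close>, as the dominating function requires.\<close>
  define s where "s k = 1 / (real k + 2)" for k
  define \<tau> where "\<tau> k = s k / (\<kappa> * (1 - s k))" for k
  have s: "0 < s k" "s k \<le> 1 / 2" "s k < 1" for k by (auto simp: s_def field_simps)
  have \<tau>: "0 < \<tau> k" for k using s[of k] \<kappa> by (simp add: \<tau>_def)
  have s0: "s \<longlonglongrightarrow> 0"
    unfolding s_def by real_asymp
  have \<tau>0: "\<tau> \<longlonglongrightarrow> 0"
  proof -
    have "(\<lambda>k. s k / (\<kappa> * (1 - s k))) \<longlonglongrightarrow> 0 / (\<kappa> * (1 - 0))"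
      using \<kappa> by (intro tendsto_intros s0) auto
    then show ?thesis by (simp add: \<tau>_def[abs_def])
  qed
  have \<tau>s: "\<tau> k / s k = 1 / (\<kappa> * (1 - s k))" for k using s[of k] by (simp add: \<tau>_def)
  have \<tau>s2: "\<tau> k / s k \<le> 2 / \<kappa>" for k
    using s[of k] \<kappa> unfolding \<tau>s by (simp add: field_simps)
  let ?Q = "\<lambda>k. sup_convolution n B (\<tau> k) g"
  have [measurable]: "?Q k \<in> borel_measurable (lebesgue_vectors n)" for k
    by (rule sup_convolution_measurable[OF C \<tau>])
  have Qg: "g x \<le> ?Q k x" if "x \<in> B'" for x k
    using sup_convolution_ge[where g = g and x = x and z = x, OF C \<tau> B'B[OF that]] by (simp add: L2_set_def)
  have QC: "?Q k x \<le> C" for x k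
  proof (rule sup_convolution_le)
    fix y assume "y \<in> B"
    then have "g y \<le> C" using C[of y] by simp
    moreover have "0 \<le> (vdist n y x)\<^sup>2 / (2 * \<tau> k)" using \<tau>[of k] by simp
    ultimately show "g y - (vdist n y x)\<^sup>2 / (2 * \<tau> k) \<le> C" by linarith
  qed
  \<comment> \<open>The maximum of a linear growth A * d minus the quadratic penalty, by completing
    the square.\<close>
  have quad: "A * d - d\<^sup>2 / (2 * \<tau> k) \<le> \<tau> k * (A\<^sup>2 / 2)" for A d k
  proof -
    have "0 \<le> (d - \<tau> k * A)\<^sup>2 / (2 * \<tau> k)" using \<tau>[of k] by simp
    then show ?thesis using \<tau>[of k] by (simp add: field_simps power2_eq_square)
  qed
  have Qle: "?Q k z - g z \<le> \<tau> k * ((K z)\<^sup>2 / 2)" if "z \<in> B'" for z k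
  proof -
    have "?Q k z \<le> g z + \<tau> k * ((K z)\<^sup>2 / 2)"
    proof (rule sup_convolution_le)
      fix x assume "x \<in> B"
      then show "g x - (vdist n x z)\<^sup>2 / (2 * \<tau> k) \<le> g z + \<tau> k * ((K z)\<^sup>2 / 2)"
        using lip[OF \<open>x \<in> B\<close> that] quad[of "K z" "vdist n x z" k] by linarith
    qed
    then show ?thesis by simp
  qed
  have exp_diff_le: "(exp (?Q k z) - exp (g z)) / s k \<le> exp (?Q k z) * (A / (\<kappa> * (1 - s k)))"
    if "?Q k z - g z \<le> \<tau> k * A" for z k A
  proof -
    have "exp (?Q k z) * (1 + (g z - ?Q k z)) \<le> exp (?Q k z) * exp (g z - ?Q k z)"
      by (intro mult_left_mono) (auto simp: exp_ge_add_one_self)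
    then have "exp (?Q k z) - exp (g z) \<le> exp (?Q k z) * (?Q k z - g z)"
      by (simp add: exp_diff algebra_simps)
    also have "\<dots> \<le> exp (?Q k z) * (\<tau> k * A)" using that by (intro mult_left_mono) auto
    finally have "(exp (?Q k z) - exp (g z)) / s k \<le> exp (?Q k z) * (\<tau> k * A) / s k"
      using s[of k] by (simp add: divide_right_mono)
    also have "\<dots> = exp (?Q k z) * (A * (\<tau> k / s k))" by simp
    finally show ?thesis unfolding \<tau>s by simp
  qed
  define h where "h k z = (exp (?Q k z) - exp (g z)) / s k" for k z
  define L where "L z = (D z)\<^sup>2 * exp (g z) / (2 * \<kappa>)" for z
  have [measurable]: "h k \<in> borel_measurable (lebesgue_vectors n)" for k unfolding h_def by measurable
  have [measurable]: "L \<in> borel_measurable (lebesgue_vectors n)" unfolding L_def by measurable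
  define W where "W z = exp C / \<kappa> * (K z)\<^sup>2" for z
  have iW: "integrable \<nu> W" unfolding W_def using K by simp
  have h0: "0 \<le> h k z" if "z \<in> B'" for k z
    using Qg[OF that, of k] s[of k] by (simp add: h_def)
  have hW: "h k z \<le> W z" if "z \<in> B'" for k z
  proof -
    have "h k z \<le> exp (?Q k z) * ((K z)\<^sup>2 / 2 / (\<kappa> * (1 - s k)))"
      unfolding h_def by (rule exp_diff_le[OF Qle[OF that]])
    also have "\<dots> \<le> exp C * ((K z)\<^sup>2 / 2 * (2 / \<kappa>))"
    proof (intro mult_mono)
      have "(K z)\<^sup>2 / 2 * (\<tau> k / s k) \<le> (K z)\<^sup>2 / 2 * (2 / \<kappa>)"
        using \<tau>s2[of k] by (intro mult_left_mono) auto
      then show "(K z)\<^sup>2 / 2 / (\<kappa> * (1 - s k)) \<le> (K z)\<^sup>2 / 2 * (2 / \<kappa>)" unfolding \<tau>s by simp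
    qed (use QC s[of k] \<kappa> in auto)
    finally show ?thesis by (simp add: W_def)
  qed
  have LW: "L z \<le> W z" if "z \<in> B'" for z
  proof -
    have "g z \<le> C" using C[OF B'B[OF that]] by simp
    moreover have "(D z)\<^sup>2 \<le> (K z)\<^sup>2" using D[OF that] by (intro power_mono) auto
    ultimately have "(D z)\<^sup>2 * exp (g z) \<le> (K z)\<^sup>2 * exp C" by (intro mult_mono) auto
    then have "L z \<le> (K z)\<^sup>2 * exp C / (2 * \<kappa>)" unfolding L_def using \<kappa> by (simp add: divide_right_mono)
    also have "\<dots> \<le> W z" using \<kappa> by (simp add: W_def field_simps)
    finally show ?thesis .
  qed
  have L0: "0 \<le> L z" for z using \<kappa> by (simp add: L_def)
  have ih: "integrable \<nu> (h k)" for k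
  proof (rule Bochner_Integration.integrable_bound[OF iW])
    show "AE z in \<nu>. norm (h k z) \<le> norm (W z)"
    proof (rule AE')
      fix z assume "z \<in> B'"
      then show "norm (h k z) \<le> norm (W z)" using h0[of z k] hW[of z k] by simp
    qed
  qed simp
  \<comment> \<open>Only the upper limit of \<open>h k z\<close> is controlled, by
    \<open>L z\<close>. Taking the maximum with \<open>L z\<close> gives a sequence that converges,
    so that dominated convergence applies.\<close>
  have lim: "(\<lambda>k. max (h k z) (L z)) \<longlonglongrightarrow> L z" if z: "z \<in> B'" for z
  proof (rule order_tendstoI)
    fix c assume "c < L z"
    then show "\<forall>\<^sub>F k in sequentially. c < max (h k z) (L z)" by (simp add: less_max_iff_disj)
  next
    fix c assume c: "L z < c"
    let ?U = "\<lambda>\<eta>. exp (g z) * ((D z + \<eta>)\<^sup>2 / 2 / \<kappa>)"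
    have "(?U \<longlongrightarrow> exp (g z) * ((D z + 0)\<^sup>2 / 2 / \<kappa>)) (at_right 0)"
      using \<kappa> by (intro tendsto_intros) auto
    also have "exp (g z) * ((D z + 0)\<^sup>2 / 2 / \<kappa>) = L z" by (simp add: L_def)
    finally have "\<forall>\<^sub>F \<eta> in at_right 0. ?U \<eta> < c" using c by (rule order_tendstoD)
    moreover have "\<forall>\<^sub>F \<eta> in at_right (0::real). 0 < \<eta>" by (rule eventually_at_right_less)
    ultimately have "\<forall>\<^sub>F \<eta> in at_right 0. ?U \<eta> < c \<and> 0 < \<eta>" by (rule eventually_conj)
    then obtain \<eta> where \<eta>: "?U \<eta> < c" "0 < \<eta>"
      using eventually_happens'[OF trivial_limit_at_right_real] by blast
    obtain \<delta> where \<delta>: "0 < \<delta>" "\<And>x. x \<in> B \<Longrightarrow> vdist n x z < \<delta> \<Longrightarrow> g x - g z \<le> (D z + \<eta>) * vdist n x z"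
      using slope[OF z \<eta>(2)] by blast
    define A where "A = (D z + \<eta>)\<^sup>2 / 2"
    have K0: "0 \<le> K z" using D[OF z] by linarith
    \<comment> \<open>As soon as \<open>2 * K z * \<tau> k < \<delta>\<close>, the penalty is at
      least K z * d for all distances d \<ge> \<delta>, so far points cannot compete in the
      supremum.\<close>
    have "(\<lambda>k. 2 * K z * \<tau> k) \<longlonglongrightarrow> 2 * K z * 0" by (intro tendsto_intros \<tau>0)
    then have "\<forall>\<^sub>F k in sequentially. 2 * K z * \<tau> k < \<delta>" using \<delta>(1) by (intro order_tendstoD) auto
    moreover have "(\<lambda>k. exp (g z + \<tau> k * A) * (A / (\<kappa> * (1 - s k)))) \<longlonglongrightarrow> exp (g z + 0 * A) * (A / (\<kappa> * (1 - 0)))"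
      using \<kappa> by (intro tendsto_intros s0 \<tau>0) auto
    then have "\<forall>\<^sub>F k in sequentially. exp (g z + \<tau> k * A) * (A / (\<kappa> * (1 - s k))) < c"
      using \<eta>(1) by (intro order_tendstoD) (auto simp: A_def)
    ultimately show "\<forall>\<^sub>F k in sequentially. max (h k z) (L z) < c"
    proof eventually_elim
      case (elim k)
      have "?Q k z \<le> g z + \<tau> k * A"
      proof (rule sup_convolution_le)
        fix x assume x: "x \<in> B"
        let ?d = "vdist n x z"
        show "g x - ?d\<^sup>2 / (2 * \<tau> k) \<le> g z + \<tau> k * A"
        proof (cases "?d < \<delta>")
          case True
          then show ?thesis using \<delta>(2)[OF x True] quad[of "D z + \<eta>" ?d k] unfolding A_def by linarith
        next
          case False
          have "K z * ?d \<le> ?d\<^sup>2 / (2 * \<tau> k)"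
          proof -
            have "2 * K z * \<tau> k * ?d \<le> ?d * ?d" using elim(1) False by (intro mult_right_mono) auto
            then show ?thesis using \<tau>[of k] by (simp add: field_simps power2_eq_square)
          qed
          moreover have "0 \<le> \<tau> k * A" using \<tau>[of k] by (simp add: A_def)
          ultimately show ?thesis using lip[OF x z] by linarith
        qed
      qed
      note Q = this
      have "h k z \<le> exp (?Q k z) * (A / (\<kappa> * (1 - s k)))"
        unfolding h_def by (rule exp_diff_le) (use Q in simp)
      also have "\<dots> \<le> exp (g z + \<tau> k * A) * (A / (\<kappa> * (1 - s k)))"
        using Q s[of k] \<kappa> by (intro mult_right_mono) (auto simp: A_def)
      finally show ?case using elim(2) c by simp
    qed
  qed
  have "(\<lambda>k. \<integral>z. max (h k z) (L z) \<partial>\<nu>) \<longlonglongrightarrow> (\<integral>z. L z \<partial>\<nu>)"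
  proof (rule integral_dominated_convergence[OF _ _ iW])
    show "AE z in \<nu>. norm (max (h k z) (L z)) \<le> W z" for k
    proof (rule AE')
      fix z assume "z \<in> B'"
      then show "norm (max (h k z) (L z)) \<le> W z"
        using hW[of z k] LW[of z] L0[of z] by simp
    qed
  qed (auto intro!: AE' lim)
  moreover have "(\<integral>x. g x * exp (g x) \<partial>\<nu>) - (\<integral>x. exp (g x) \<partial>\<nu>) * ln ((\<integral>x. exp (g x) \<partial>\<nu>) / (\<integral>x. 1 \<partial>\<nu>))
    \<le> (\<integral>z. max (h k z) (L z) \<partial>\<nu>)" (is "?E \<le> _") for k
  proof -
    have "?E \<le> (\<integral>z. h k z \<partial>\<nu>)"
      using entropy_le_sup_convolution[OF s(1,3)[of k] assms(1) C] by (simp add: h_def \<tau>_def)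
    also have "\<dots> \<le> (\<integral>z. max (h k z) (L z) \<partial>\<nu>)"
    proof (rule integral_mono[OF ih])
      show "integrable \<nu> (\<lambda>z. max (h k z) (L z))"
      proof (rule Bochner_Integration.integrable_bound[OF iW])
        show "AE z in \<nu>. norm (max (h k z) (L z)) \<le> norm (W z)"
        proof (rule AE')
          fix z assume "z \<in> B'"
          then show "norm (max (h k z) (L z)) \<le> norm (W z)"
            using hW[of z k] LW[of z] L0[of z] by simp
        qed
      qed simp
    qed simp
    finally show ?thesis .
  qed
  ultimately have "?E \<le> (\<integral>z. L z \<partial>\<nu>)" by (intro LIMSEQ_le_const) auto
  then show ?thesis by (simp add: L_def)
qed

end

subsection \<open>Polar coordinates\<close>

definition scale_vector :: "nat \<Rightarrow> real \<Rightarrow> (nat \<Rightarrow> real) \<Rightarrow> nat \<Rightarrow> real" where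
  "scale_vector n s x = (\<lambda>i\<in>{..<n}. s * x i)"

lemma scale_vector_measurable [measurable]:
  "scale_vector n s \<in> lebesgue_vectors n \<rightarrow>\<^sub>M lebesgue_vectors n"
  unfolding scale_vector_def[abs_def] by (rule measurable_restrict) measurable

lemma nn_integral_lebesgue_vectors_Suc:
  assumes [measurable]: "F \<in> borel_measurable (lebesgue_vectors (Suc n))"
  shows "(\<integral>\<^sup>+x. F x \<partial>lebesgue_vectors (Suc n)) = (\<integral>\<^sup>+x. (\<integral>\<^sup>+a. F (x(n := a)) \<partial>lborel) \<partial>lebesgue_vectors n)"
    and "(\<integral>\<^sup>+x. F x \<partial>lebesgue_vectors (Suc n)) = (\<integral>\<^sup>+a. (\<integral>\<^sup>+x. F (x(n := a)) \<partial>lebesgue_vectors n) \<partial>lborel)"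
proof -
  have F: "F \<in> borel_measurable (Pi\<^sub>M (insert n {..<n}) (\<lambda>_. lborel))"
    using assms by (simp add: lessThan_Suc)
  show "(\<integral>\<^sup>+x. F x \<partial>lebesgue_vectors (Suc n)) = (\<integral>\<^sup>+x. (\<integral>\<^sup>+a. F (x(n := a)) \<partial>lborel) \<partial>lebesgue_vectors n)"
    unfolding lessThan_Suc by (rule lborel_prod.product_nn_integral_insert[OF _ _ F]) auto
  show "(\<integral>\<^sup>+x. F x \<partial>lebesgue_vectors (Suc n)) = (\<integral>\<^sup>+a. (\<integral>\<^sup>+x. F (x(n := a)) \<partial>lebesgue_vectors n) \<partial>lborel)"
    unfolding lessThan_Suc by (rule lborel_prod.product_nn_integral_insert_rev[OF _ _ F]) auto
qed

lemma measurable_upd_pair: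
  "(\<lambda>(a, x). x(n := a)) \<in> borel \<Otimes>\<^sub>M lebesgue_vectors n \<rightarrow>\<^sub>M lebesgue_vectors (Suc n)"
  unfolding lessThan_Suc case_prod_unfold by (rule measurable_fun_upd[where J = "{..<n}"]) auto

lemma measurable_upd_vector:
  assumes "f \<in> M \<rightarrow>\<^sub>M lebesgue_vectors n" "g \<in> borel_measurable M"
  shows "(\<lambda>p. (f p)(n := g p)) \<in> M \<rightarrow>\<^sub>M lebesgue_vectors (Suc n)"
  unfolding lessThan_Suc by (rule measurable_fun_upd[where J = "{..<n}"]) (use assms in auto)

lemma sigma_finite_lebesgue_vectors: "sigma_finite_measure (lebesgue_vectors n)"
  by (rule lborel_prod.sigma_finite) simp

lemma nn_integral_scale_vector:
  assumes "0 < s" and G: "G \<in> borel_measurable (lebesgue_vectors n)"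
  shows "(\<integral>\<^sup>+x. G x \<partial>lebesgue_vectors n) = ennreal (s ^ n) * (\<integral>\<^sup>+x. G (scale_vector n s x) \<partial>lebesgue_vectors n)"
  using G
proof (induction n arbitrary: G)
  case 0
  have "scale_vector 0 s (\<lambda>_. undefined) = (\<lambda>_. undefined)" by (auto simp: scale_vector_def restrict_def)
  then show ?case by (simp add: PiM_empty nn_integral_count_space_finite)
next
  case (Suc n)
  note [measurable] = Suc.prems
  interpret L: sigma_finite_measure "lebesgue_vectors n" by (rule sigma_finite_lebesgue_vectors)
  have Gm: "(\<lambda>(a, x). G (x(n := a))) \<in> borel_measurable (borel \<Otimes>\<^sub>M lebesgue_vectors n)"
    using measurable_compose[OF measurable_upd_pair Suc.prems] by (simp only: case_prod_unfold)
  have Gsm: "(\<lambda>(a, x). G ((scale_vector n s x)(n := a))) \<in> borel_measurable (borel \<Otimes>\<^sub>M lebesgue_vectors n)"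
  proof -
    have "(\<lambda>p. (fst p, scale_vector n s (snd p))) \<in> borel \<Otimes>\<^sub>M lebesgue_vectors n \<rightarrow>\<^sub>M borel \<Otimes>\<^sub>M lebesgue_vectors n"
      by measurable
    from measurable_compose[OF this Gm] show ?thesis by (simp only: case_prod_unfold fst_conv snd_conv)
  qed
  have [measurable]: "(\<lambda>a. \<integral>\<^sup>+x. G ((scale_vector n s x)(n := a)) \<partial>lebesgue_vectors n) \<in> borel_measurable borel"
    using L.borel_measurable_nn_integral[OF Gsm] .
  have upd: "(scale_vector n s x)(n := s * a) = scale_vector (Suc n) s (x(n := a))" for x a
    by (auto simp: scale_vector_def fun_eq_iff)
  have "(\<integral>\<^sup>+x. G x \<partial>lebesgue_vectors (Suc n)) = (\<integral>\<^sup>+a. (\<integral>\<^sup>+x. G (x(n := a)) \<partial>lebesgue_vectors n) \<partial>lborel)"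
    by (rule nn_integral_lebesgue_vectors_Suc) fact
  also have "\<dots> = (\<integral>\<^sup>+a. ennreal (s ^ n) * (\<integral>\<^sup>+x. G ((scale_vector n s x)(n := a)) \<partial>lebesgue_vectors n) \<partial>lborel)"
    by (intro nn_integral_cong Suc.IH) (rule measurable_compose[OF measurable_upd_last Suc.prems])
  also have "\<dots> = ennreal (s ^ n) * (\<integral>\<^sup>+a. (\<integral>\<^sup>+x. G ((scale_vector n s x)(n := a)) \<partial>lebesgue_vectors n) \<partial>lborel)"
    by (rule nn_integral_cmult) measurable
  also have "(\<integral>\<^sup>+a. (\<integral>\<^sup>+x. G ((scale_vector n s x)(n := a)) \<partial>lebesgue_vectors n) \<partial>lborel) =
      ennreal s * (\<integral>\<^sup>+a. (\<integral>\<^sup>+x. G ((scale_vector n s x)(n := s * a)) \<partial>lebesgue_vectors n) \<partial>lborel)"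
    using assms(1) by (subst nn_integral_real_affine[of _ s 0]) auto
  also have "(\<integral>\<^sup>+a. (\<integral>\<^sup>+x. G ((scale_vector n s x)(n := s * a)) \<partial>lebesgue_vectors n) \<partial>lborel)
     = (\<integral>\<^sup>+x. G (scale_vector (Suc n) s x) \<partial>lebesgue_vectors (Suc n))"
    unfolding upd by (rule nn_integral_lebesgue_vectors_Suc(2)[symmetric]) measurable
  finally show ?case using assms(1) by (simp add: ennreal_mult mult_ac)
qed

text \<open>Over a base point y with b = |y|^2, the point at height z lies on the sphere of radius s
  * sqrt N with s = g z. The derivative z / (N s) of this substitution cancels the surface weight
  sqrt N * s / z up to the constant 1 / sqrt N. \<open>g\<close> and \<open>g'\<close> are
  parameters because the formula for g with the square root is not differentiable at z = 0 when b =
  0.\<close>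

lemma nn_integral_sphere_height_aux:
  fixes f :: "real \<Rightarrow> ennreal"
  assumes [measurable]: "f \<in> borel_measurable borel" and b: "0 \<le> b" "b < N"
    and g: "\<And>z. 0 \<le> z \<Longrightarrow> z \<le> sqrt (N - b) \<Longrightarrow> g z = sqrt ((z\<^sup>2 + b) / N)"
    and deriv: "\<And>z. z \<in> {0..sqrt (N - b)} \<Longrightarrow> (g has_real_derivative g' z) (at z)"
    and cont: "continuous_on {0..sqrt (N - b)} g'"
    and g': "\<And>z. 0 < z \<Longrightarrow> z \<le> sqrt (N - b) \<Longrightarrow> g' z = z / (N * g z)" "0 \<le> g' 0"
  shows "(\<integral>\<^sup>+s. indicator {s. 0 < s \<and> s < 1 \<and> b < N * s\<^sup>2} s * (ennreal (sqrt N * s / sqrt (N * s\<^sup>2 - b)) * f (sqrt (N * s\<^sup>2 - b))) \<partial>lborel)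
    = ennreal (1 / sqrt N) * (\<integral>\<^sup>+z. indicator {z. 0 < z \<and> b + z\<^sup>2 < N} z * f z \<partial>lborel)"
proof -
  have N: "0 < N" using b by simp
  let ?k = "\<lambda>s. ennreal (sqrt N * s / sqrt (N * s\<^sup>2 - b)) * f (sqrt (N * s\<^sup>2 - b))"
  let ?m = "sqrt (N - b)"
  have m: "0 < ?m" using b by simp
  have g0: "g 0 = sqrt (b / N)" and gm: "g ?m = 1" using g[of 0] g[of ?m] b N by auto
  have iff: "0 < s \<and> s < 1 \<and> b < N * s\<^sup>2 \<longleftrightarrow> sqrt (b / N) < s \<and> s < 1" for s :: real
  proof -
    have "b < N * s\<^sup>2 \<longleftrightarrow> sqrt (b / N) < s" if "0 < s"
    proof -
      have "sqrt (b / N) < s \<longleftrightarrow> sqrt (b / N) < sqrt (s\<^sup>2)" using that by simp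
      also have "\<dots> \<longleftrightarrow> b / N < s\<^sup>2" by (rule real_sqrt_less_iff)
      also have "\<dots> \<longleftrightarrow> b < N * s\<^sup>2" using N by (simp add: field_simps)
      finally show ?thesis by simp
    qed
    moreover have "0 \<le> sqrt (b / N)" using b N by simp
    ultimately show ?thesis by (meson order_le_less_trans)
  qed
  have "(\<integral>\<^sup>+s. indicator {s. 0 < s \<and> s < 1 \<and> b < N * s\<^sup>2} s * ?k s \<partial>lborel)
     = (\<integral>\<^sup>+s. ?k s * indicator {g 0..g ?m} s \<partial>lborel)"
  proof (rule nn_integral_cong_AE)
    have "AE s in lborel. s \<noteq> sqrt (b / N)" "AE s in lborel. s \<noteq> (1::real)"
      by (rule AE_lborel_singleton)+
    then show "AE s in lborel. indicator {s. 0 < s \<and> s < 1 \<and> b < N * s\<^sup>2} s * ?k s = ?k s * indicator {g 0..g ?m} s"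
      unfolding iff g0 gm by eventually_elim (auto split: split_indicator)
  qed
  also have "\<dots> = (\<integral>\<^sup>+z. ?k (g z) * ennreal (g' z) * indicator {0..?m} z \<partial>lborel)"
  proof (rule nn_integral_substitution_aux[OF _ _ deriv cont])
    fix z assume "z \<in> {0..?m}"
    then show "0 \<le> g' z" using g' g[of z] b N by (cases "z = 0") auto
  qed (use m in auto)
  also have "\<dots> = (\<integral>\<^sup>+z. ennreal (1 / sqrt N) * (indicator {z. 0 < z \<and> b + z\<^sup>2 < N} z * f z) \<partial>lborel)"
  proof (rule nn_integral_cong_AE)
    have "AE z in lborel. z \<noteq> ?m" "AE z in lborel. z \<noteq> (0::real)"
      by (rule AE_lborel_singleton)+
    then show "AE z in lborel. ?k (g z) * ennreal (g' z) * indicator {0..?m} z =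
        ennreal (1 / sqrt N) * (indicator {z. 0 < z \<and> b + z\<^sup>2 < N} z * f z)"
    proof eventually_elim
      case (elim z)
      show ?case
      proof (cases "0 < z \<and> z < ?m")
        case True
        then have "z\<^sup>2 < ?m\<^sup>2" by (intro power_strict_mono) auto
        then have bz: "b + z\<^sup>2 < N" using b by simp
        have gz: "g z = sqrt ((z\<^sup>2 + b) / N)" "g' z = z / (N * g z)" using g[of z] g'(1)[of z] True by auto
        have pos: "0 < z\<^sup>2 + b" using True b by (simp add: add_pos_nonneg)
        then have gp: "0 < g z" unfolding gz(1) using N by simp
        have "(g z)\<^sup>2 = (z\<^sup>2 + b) / N" unfolding gz(1) using pos N by simp
        then have r: "sqrt (N * (g z)\<^sup>2 - b) = z" using N True by simp
        have "ennreal (sqrt N * g z / z) * ennreal (g' z) = ennreal (sqrt N * g z / z * g' z)"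
          using True gp N by (intro ennreal_mult[symmetric]) (auto simp: gz(2))
        also have "sqrt N * g z / z * g' z = 1 / sqrt N"
          unfolding gz(2) using True gp N by (simp add: real_div_sqrt field_simps)
        finally have *: "ennreal (sqrt N * g z / z) * ennreal (g' z) = ennreal (1 / sqrt N)" .
        have "?k (g z) * ennreal (g' z) = (ennreal (sqrt N * g z / z) * ennreal (g' z)) * f z"
          unfolding r by (simp add: mult_ac)
        then show ?thesis using True bz by (simp add: *)
      next
        case False
        have "\<not> (0 < z \<and> b + z\<^sup>2 < N)"
        proof
          assume z: "0 < z \<and> b + z\<^sup>2 < N"
          then have "sqrt (z\<^sup>2) < sqrt (N - b)" by (intro real_sqrt_less_mono) simp
          then show False using False z by simp
        qed
        moreover have "z \<notin> {0..?m}" using False elim by auto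
        ultimately show ?thesis by simp
      qed
    qed
  qed
  also have "\<dots> = ennreal (1 / sqrt N) * (\<integral>\<^sup>+z. indicator {z. 0 < z \<and> b + z\<^sup>2 < N} z * f z \<partial>lborel)"
    by (rule nn_integral_cmult) measurable
  finally show ?thesis .
qed

lemma nn_integral_sphere_height:
  fixes f :: "real \<Rightarrow> ennreal"
  assumes f: "f \<in> borel_measurable borel" and b: "0 \<le> b" and N: "0 < N"
  shows "(\<integral>\<^sup>+s. indicator {s. 0 < s \<and> s < 1 \<and> b < N * s\<^sup>2} s * (ennreal (sqrt N * s / sqrt (N * s\<^sup>2 - b)) * f (sqrt (N * s\<^sup>2 - b))) \<partial>lborel)
    = ennreal (1 / sqrt N) * (\<integral>\<^sup>+z. indicator {z. 0 < z \<and> b + z\<^sup>2 < N} z * f z \<partial>lborel)"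
proof -
  \<comment> \<open>At b = 0 the root sqrt (z^2 / N) is replaced by the linear function z / sqrt N;
    for b \<ge> N both domains of integration are empty.\<close>
  consider "b = 0" | "0 < b" "b < N" | "N \<le> b" using b by linarith
  then show ?thesis
  proof cases
    case 1
    show ?thesis
      by (rule nn_integral_sphere_height_aux[OF f b, where g = "\<lambda>z. z / sqrt N" and g' = "\<lambda>z. 1 / sqrt N"])
        (use N 1 in \<open>auto intro!: derivative_eq_intros simp: real_sqrt_divide field_simps\<close>)
  next
    case 2
    let ?g = "\<lambda>z. sqrt ((z\<^sup>2 + b) / N)"
    have pos: "0 < z\<^sup>2 + b" for z :: real using 2 by (simp add: add_nonneg_pos)
    show ?thesis
    proof (rule nn_integral_sphere_height_aux[OF f b 2(2), where g = ?g and g' = "\<lambda>z. z / (N * ?g z)"])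
      fix z assume "z \<in> {0..sqrt (N - b)}"
      have nz: "0 < (z\<^sup>2 + b) / N" using pos N by simp
      show "(?g has_real_derivative z / (N * ?g z)) (at z)"
        using nz N by (auto intro!: derivative_eq_intros simp: field_simps)
    next
      show "continuous_on {0..sqrt (N - b)} (\<lambda>z. z / (N * ?g z))"
        using pos N by (intro continuous_intros) (auto simp: less_imp_neq[OF pos, symmetric])
    qed (use N in auto)
  next
    case 3
    have "\<not> (0 < s \<and> s < 1 \<and> b < N * s\<^sup>2)" for s
    proof
      assume s: "0 < s \<and> s < 1 \<and> b < N * s\<^sup>2"
      then have "N * s\<^sup>2 \<le> N * 1" using N by (intro mult_left_mono) (auto simp: power_le_one)
      then show False using s 3 by simp
    qed
    moreover have "\<not> (0 < z \<and> b + z\<^sup>2 < N)" for z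
      using 3 zero_le_power2[of z] by linarith
    ultimately show ?thesis by simp
  qed
qed

text \<open>Since |x|^2 and the squared height add up to n + 1, the graph weight collapses to radius
  over height.\<close>

lemma hemisphere_weight:
  assumes "(\<Sum>i<n. (x i)\<^sup>2) < real (Suc n)"
  shows "sqrt (1 + (\<Sum>i<n. (- x i / hemisphere_height (Suc n) x)\<^sup>2)) = sqrt (real (Suc n)) / hemisphere_height (Suc n) x"
    and "0 < hemisphere_height (Suc n) x"
proof -
  let ?h = "hemisphere_height (Suc n) x"
  show h: "0 < ?h" using assms by (simp add: hemisphere_height_def)
  have h2: "?h\<^sup>2 = real (Suc n) - (\<Sum>i<n. (x i)\<^sup>2)"
    using assms by (simp add: hemisphere_height_def)
  have "(\<Sum>i<n. (- x i / ?h)\<^sup>2) = (\<Sum>i<n. (x i)\<^sup>2) / ?h\<^sup>2"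
    by (simp add: power_divide sum_divide_distrib)
  then have "1 + (\<Sum>i<n. (- x i / ?h)\<^sup>2) = (?h\<^sup>2 + (\<Sum>i<n. (x i)\<^sup>2)) / ?h\<^sup>2"
    using h by (simp add: field_simps)
  also have "\<dots> = real (Suc n) / ?h\<^sup>2" unfolding h2 by simp
  finally show "sqrt (1 + (\<Sum>i<n. (- x i / ?h)\<^sup>2)) = sqrt (real (Suc n)) / ?h"
    using h by (simp add: real_sqrt_divide)
qed

lemma hemisphere_height_measurable [measurable]:
  "hemisphere_height (Suc n) \<in> borel_measurable (lebesgue_vectors n)"
  unfolding hemisphere_height_def[abs_def] by simp

lemma hemisphere_base_Suc:
  "hemisphere_base (Suc n) = density (restrict_space (lebesgue_vectors n) {x. (\<Sum>i<n. (x i)\<^sup>2) < real (Suc n)})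
     (\<lambda>x. ennreal (sqrt (1 + (\<Sum>i<n. (- x i / hemisphere_height (Suc n) x)\<^sup>2))))"
  unfolding hemisphere_base_def diff_Suc_1 ..

lemma nn_integral_hemisphere_base:
  assumes [measurable]: "F \<in> borel_measurable (lebesgue_vectors n)"
  shows "(\<integral>\<^sup>+x. F x \<partial>hemisphere_base (Suc n)) = (\<integral>\<^sup>+x. indicator {x. (\<Sum>i<n. (x i)\<^sup>2) < real (Suc n)} x *
     (ennreal (sqrt (real (Suc n)) / hemisphere_height (Suc n) x) * F x) \<partial>lebesgue_vectors n)"
proof -
  let ?D = "{x. (\<Sum>i<n. (x i)\<^sup>2) < real (Suc n)}"
  have D: "?D \<inter> space (lebesgue_vectors n) \<in> sets (lebesgue_vectors n)"
  proof -
    have "?D \<inter> space (lebesgue_vectors n) = {x \<in> space (lebesgue_vectors n). (\<Sum>i<n. (x i)\<^sup>2) < real (Suc n)}" by auto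
    also have "\<dots> \<in> sets (lebesgue_vectors n)" by measurable
    finally show ?thesis .
  qed
  have "(\<integral>\<^sup>+x. F x \<partial>hemisphere_base (Suc n)) = (\<integral>\<^sup>+x. ennreal (sqrt (1 + (\<Sum>i<n. (- x i / hemisphere_height (Suc n) x)\<^sup>2))) * F x
     \<partial>restrict_space (lebesgue_vectors n) ?D)"
    unfolding hemisphere_base_Suc
    by (rule nn_integral_density; rule measurable_restrict_space1; measurable)
  also have "\<dots> = (\<integral>\<^sup>+x. ennreal (sqrt (1 + (\<Sum>i<n. (- x i / hemisphere_height (Suc n) x)\<^sup>2))) * F x * indicator ?D x
     \<partial>lebesgue_vectors n)"
    by (rule nn_integral_restrict_space[OF D])
  also have "\<dots> = (\<integral>\<^sup>+x. indicator ?D x *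
     (ennreal (sqrt (real (Suc n)) / hemisphere_height (Suc n) x) * F x) \<partial>lebesgue_vectors n)"
  proof (rule nn_integral_cong)
    fix x
    show "ennreal (sqrt (1 + (\<Sum>i<n. (- x i / hemisphere_height (Suc n) x)\<^sup>2))) * F x * indicator ?D x =
      indicator ?D x * (ennreal (sqrt (real (Suc n)) / hemisphere_height (Suc n) x) * F x)"
    proof (cases "(\<Sum>i<n. (x i)\<^sup>2) < real (Suc n)")
      case True
      show ?thesis unfolding hemisphere_weight(1)[OF True] by (simp add: mult.commute)
    qed (simp del: of_nat_Suc)
  qed
  finally show ?thesis .
qed

lemma space_hemisphere_base:
  "space (hemisphere_base (Suc n)) = {x \<in> {..<n} \<rightarrow>\<^sub>E UNIV. (\<Sum>i<n. (x i)\<^sup>2) < real (Suc n)}"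
  unfolding hemisphere_base_Suc by (auto simp: space_restrict_space space_PiM)

lemma sigma_finite_hemisphere_base: "sigma_finite_measure (hemisphere_base (Suc n))"
proof -
  interpret L: sigma_finite_measure "lebesgue_vectors n" by (rule sigma_finite_lebesgue_vectors)
  let ?D = "{x. (\<Sum>i<n. (x i)\<^sup>2) < real (Suc n)}"
  \<comment> \<open>\<open>?D\<close> also contains functions outside the space of the product
    measure; intersecting with that space makes it measurable without changing the
    restriction.\<close>
  let ?D' = "{x \<in> space (lebesgue_vectors n). (\<Sum>i<n. (x i)\<^sup>2) < real (Suc n)}"
  have "(\<inter>) ?D ` sets (lebesgue_vectors n) = (\<inter>) ?D' ` sets (lebesgue_vectors n)"
    by (intro image_cong refl) (auto dest: sets.sets_into_space)
  then have D': "restrict_space (lebesgue_vectors n) ?D = restrict_space (lebesgue_vectors n) ?D'"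
  proof -
    have "?D \<inter> space (lebesgue_vectors n) = ?D' \<inter> space (lebesgue_vectors n)" by auto
    then show ?thesis using \<open>(\<inter>) ?D ` _ = _\<close> unfolding restrict_space_def by (simp only:)
  qed
  interpret R: sigma_finite_measure "restrict_space (lebesgue_vectors n) ?D"
    unfolding D' by (rule sigma_finite_measure_restrict_space[OF sigma_finite_lebesgue_vectors]) measurable
  have nt: "ennreal c \<noteq> \<infinity>" for c by simp
  show ?thesis unfolding hemisphere_base_Suc
  proof (subst R.sigma_finite_iff_density_finite)
    show "(\<lambda>x. ennreal (sqrt (1 + (\<Sum>i<n. (- x i / hemisphere_height (Suc n) x)\<^sup>2))))
      \<in> borel_measurable (restrict_space (lebesgue_vectors n) ?D)"
      by (rule measurable_restrict_space1) measurable
  qed (rule AE_I2, rule nt)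
qed

lemma hemisphere_lift_in_sphere:
  assumes "x \<in> {..<n} \<rightarrow>\<^sub>E UNIV" "(\<Sum>i<n. (x i)\<^sup>2) < real (Suc n)" "e \<in> {1, -1}"
  shows "x(n := e * hemisphere_height (Suc n) x) \<in> spin_sphere (Suc n)"
proof -
  have "e\<^sup>2 = 1" using assms(3) by (auto simp: power2_eq_square)
  moreover have "(hemisphere_height (Suc n) x)\<^sup>2 = real (Suc n) - (\<Sum>i<n. (x i)\<^sup>2)"
    unfolding hemisphere_height_def diff_Suc_1 using assms(2) by (intro real_sqrt_pow2) simp
  ultimately have "(e * hemisphere_height (Suc n) x)\<^sup>2 = real (Suc n) - (\<Sum>i<n. (x i)\<^sup>2)"
    by (simp only: power_mult_distrib mult_1)
  then have "(\<Sum>i<Suc n. ((x(n := e * hemisphere_height (Suc n) x)) i)\<^sup>2) = real (Suc n)"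
    by simp
  moreover have "x(n := e * hemisphere_height (Suc n) x) \<in> {..<Suc n} \<rightarrow>\<^sub>E UNIV"
    using assms(1) by (auto simp: PiE_iff extensional_def)
  ultimately show ?thesis unfolding spin_sphere_def by blast
qed

lemma nn_integral_sphere_volume:
  assumes [measurable]: "F \<in> borel_measurable (lebesgue_vectors (Suc n))"
  shows "(\<integral>\<^sup>+\<sigma>. F \<sigma> \<partial>sphere_volume (Suc n)) = (\<Sum>e\<in>{1,-1}. \<integral>\<^sup>+x. indicator {x. (\<Sum>i<n. (x i)\<^sup>2) < real (Suc n)} x *
     (ennreal (sqrt (real (Suc n)) / hemisphere_height (Suc n) x) * F (x(n := e * hemisphere_height (Suc n) x))) \<partial>lebesgue_vectors n)"
proof -
  let ?S = "restrict_space (\<Pi>\<^sub>M i\<in>{..<Suc n}. (borel :: real measure)) (spin_sphere (Suc n))"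
  let ?P = "count_space {1, - 1 :: real} \<Otimes>\<^sub>M hemisphere_base (Suc n)"
  let ?T = "\<lambda>(s, x). x(n := s * hemisphere_height (Suc n) x)"
  interpret H: sigma_finite_measure "hemisphere_base (Suc n)" by (rule sigma_finite_hemisphere_base)
  have id: "(\<lambda>x. x) \<in> hemisphere_base (Suc n) \<rightarrow>\<^sub>M lebesgue_vectors n"
    unfolding hemisphere_base_Suc by (auto intro!: measurable_restrict_space1)
  have hm: "hemisphere_height (Suc n) \<in> borel_measurable (hemisphere_base (Suc n))"
    using measurable_compose[OF id hemisphere_height_measurable] .
  have snd: "snd \<in> ?P \<rightarrow>\<^sub>M lebesgue_vectors n" using measurable_compose[OF measurable_snd id] .
  have T': "?T \<in> ?P \<rightarrow>\<^sub>M lebesgue_vectors (Suc n)"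
    unfolding lessThan_Suc case_prod_unfold
  proof (rule measurable_fun_upd[where J = "{..<n}"])
    have "fst \<in> borel_measurable ?P"
      by (rule measurable_compose[OF measurable_fst]) simp
    from borel_measurable_times[OF this measurable_compose[OF measurable_snd hm]]
    show "(\<lambda>p. fst p * hemisphere_height (Suc n) (snd p)) \<in> ?P \<rightarrow>\<^sub>M lborel"
      by simp
  qed (use snd in auto)
  have T: "?T \<in> ?P \<rightarrow>\<^sub>M ?S"
  proof (rule measurable_restrict_space2)
    show "?T \<in> space ?P \<rightarrow> spin_sphere (Suc n)"
      using hemisphere_lift_in_sphere by (auto simp: space_pair_measure space_hemisphere_base)
    show "?T \<in> ?P \<rightarrow>\<^sub>M (\<Pi>\<^sub>M i\<in>{..<Suc n}. (borel :: real measure))"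
      using T' measurable_cong_sets[OF refl sets_lebesgue_vectors] by blast
  qed
  have F: "F \<in> borel_measurable ?S"
    using assms measurable_cong_sets[OF sets_lebesgue_vectors refl] by (blast intro: measurable_restrict_space1)
  have "(\<integral>\<^sup>+\<sigma>. F \<sigma> \<partial>sphere_volume (Suc n)) = (\<integral>\<^sup>+p. F (?T p) \<partial>?P)"
    unfolding sphere_volume_def diff_Suc_1 by (rule nn_integral_distr[OF T], subst measurable_distr_eq1, rule F)
  also have "\<dots> = (\<integral>\<^sup>+e. (\<integral>\<^sup>+x. F (?T (e, x)) \<partial>hemisphere_base (Suc n)) \<partial>count_space {1, -1})"
    by (rule H.nn_integral_fst[symmetric]) (rule measurable_compose[OF T F])
  also have "\<dots> = (\<Sum>e\<in>{1,-1}. \<integral>\<^sup>+x. F (x(n := e * hemisphere_height (Suc n) x)) \<partial>hemisphere_base (Suc n))"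
    by (simp add: nn_integral_count_space_finite)
  also have "\<dots> = (\<Sum>e\<in>{1,-1}. \<integral>\<^sup>+x. indicator {x. (\<Sum>i<n. (x i)\<^sup>2) < real (Suc n)} x *
     (ennreal (sqrt (real (Suc n)) / hemisphere_height (Suc n) x) * F (x(n := e * hemisphere_height (Suc n) x))) \<partial>lebesgue_vectors n)"
  proof (intro sum.cong refl nn_integral_hemisphere_base)
    fix e :: real
    have "(\<lambda>x. x(n := e * hemisphere_height (Suc n) x)) \<in> lebesgue_vectors n \<rightarrow>\<^sub>M lebesgue_vectors (Suc n)"
      unfolding lessThan_Suc by (rule measurable_fun_upd[where J = "{..<n}"]) auto
    then show "(\<lambda>x. F (x(n := e * hemisphere_height (Suc n) x))) \<in> borel_measurable (lebesgue_vectors n)"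
      by (rule measurable_compose) fact
  qed
  finally show ?thesis .
qed

text \<open>Each sphere of radius s * sqrt N is a pair of graphs over the hyperplane of the first n
  coordinates. Exchanging the integrals fixes the base point y and integrates over s, and
  \<open>nn_integral_sphere_height\<close> turns s into the last coordinate. The factor sqrt N comes
  from the radius r = s * sqrt N.\<close>

theorem nn_integral_polar:
  assumes F[measurable]: "F \<in> borel_measurable (lebesgue_vectors (Suc n))"
  shows "(\<integral>\<^sup>+x. indicator {x. (\<Sum>i<Suc n. (x i)\<^sup>2) < real (Suc n)} x * F x \<partial>lebesgue_vectors (Suc n)) =
    ennreal (sqrt (real (Suc n))) * (\<integral>\<^sup>+s. indicator {0<..<1} s * (ennreal (s ^ n) *
       (\<integral>\<^sup>+\<sigma>. F (scale_vector (Suc n) s \<sigma>) \<partial>sphere_volume (Suc n))) \<partial>lborel)"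
proof -
  define N where "N = real (Suc n)"
  have N: "0 < N" by (simp add: N_def)
  interpret L: sigma_finite_measure "lebesgue_vectors n" by (rule sigma_finite_lebesgue_vectors)
  interpret P: pair_sigma_finite lborel "lebesgue_vectors n" ..
  define q where "q y = (\<Sum>i<n. (y i)\<^sup>2)" for y :: "nat \<Rightarrow> real"
  have q0: "0 \<le> q y" for y by (simp add: q_def sum_nonneg)
  have [measurable]: "q \<in> borel_measurable (lebesgue_vectors n)" unfolding q_def by measurable
  define H where "H e s y = indicator {y. q y < N * s\<^sup>2} y * (ennreal (sqrt N * s / sqrt (N * s\<^sup>2 - q y)) *
     F (y(n := e * sqrt (N * s\<^sup>2 - q y))))" for e s and y :: "nat \<Rightarrow> real"
  have Fupd[measurable]: "(\<lambda>p. F ((snd p)(n := e * sqrt (N * (fst p)\<^sup>2 - q (snd p))))) \<in> borel_measurable (borel \<Otimes>\<^sub>M lebesgue_vectors n)" for e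
    by (rule measurable_compose[OF measurable_upd_vector F]) measurable
  have Hm: "(\<lambda>p. H e (fst p) (snd p)) \<in> borel_measurable (borel \<Otimes>\<^sub>M lebesgue_vectors n)" for e
  proof -
    have "(\<lambda>p. H e (fst p) (snd p)) = (\<lambda>p. indicator {p. q (snd p) < N * (fst p)\<^sup>2} p *
       (ennreal (sqrt N * fst p / sqrt (N * (fst p)\<^sup>2 - q (snd p))) * F ((snd p)(n := e * sqrt (N * (fst p)\<^sup>2 - q (snd p))))))"
      by (auto simp: H_def fun_eq_iff split: split_indicator)
    also have "\<dots> \<in> borel_measurable (borel \<Otimes>\<^sub>M lebesgue_vectors n)" by measurable
    finally show ?thesis .
  qed
  have Hm1: "H e s \<in> borel_measurable (lebesgue_vectors n)" for e s
    using measurable_compose[OF measurable_Pair1'[of s borel] Hm[of e]] by simp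
  \<comment> \<open>s^n is the Jacobian of the dilation of the n-dimensional base; it carries the
    shell of radius sqrt N to the one of radius s * sqrt N.\<close>
  have shell: "ennreal (s ^ n) * (\<integral>\<^sup>+\<sigma>. F (scale_vector (Suc n) s \<sigma>) \<partial>sphere_volume (Suc n))
     = (\<Sum>e\<in>{1,-1}. \<integral>\<^sup>+y. H e s y \<partial>lebesgue_vectors n)" if s: "0 < s" for s
  proof -
    have "(\<integral>\<^sup>+\<sigma>. F (scale_vector (Suc n) s \<sigma>) \<partial>sphere_volume (Suc n)) = (\<Sum>e\<in>{1,-1}. \<integral>\<^sup>+x. indicator {x. (\<Sum>i<n. (x i)\<^sup>2) < real (Suc n)} x *
     (ennreal (sqrt (real (Suc n)) / hemisphere_height (Suc n) x) * F (scale_vector (Suc n) s (x(n := e * hemisphere_height (Suc n) x)))) \<partial>lebesgue_vectors n)"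
      by (rule nn_integral_sphere_volume) measurable
    also have "\<dots> = (\<Sum>e\<in>{1,-1}. \<integral>\<^sup>+x. H e s (scale_vector n s x) \<partial>lebesgue_vectors n)"
    proof (intro sum.cong refl nn_integral_cong)
      fix e x
      have qs: "q (scale_vector n s x) = s\<^sup>2 * q x"
        by (simp add: q_def scale_vector_def power_mult_distrib sum_distrib_left)
      have h: "hemisphere_height (Suc n) x = sqrt (N - q x)"
        by (simp add: hemisphere_height_def N_def q_def)
      have r: "sqrt (N * s\<^sup>2 - s\<^sup>2 * q x) = s * sqrt (N - q x)"
      proof -
        have "N * s\<^sup>2 - s\<^sup>2 * q x = s\<^sup>2 * (N - q x)" by (simp add: algebra_simps)
        then show ?thesis using s by (simp add: real_sqrt_mult)
      qed
      have "scale_vector (Suc n) s (x(n := e * hemisphere_height (Suc n) x)) = (scale_vector n s x)(n := e * (s * sqrt (N - q x)))"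
        unfolding h by (auto simp: scale_vector_def fun_eq_iff)
      moreover have "sqrt N * s / (s * sqrt (N - q x)) = sqrt N / sqrt (N - q x)" using s by simp
      moreover have "s\<^sup>2 * q x < N * s\<^sup>2 \<longleftrightarrow> q x < N" using s by (simp add: mult.commute)
      ultimately show "indicator {x. (\<Sum>i<n. (x i)\<^sup>2) < real (Suc n)} x *
         (ennreal (sqrt (real (Suc n)) / hemisphere_height (Suc n) x) * F (scale_vector (Suc n) s (x(n := e * hemisphere_height (Suc n) x))))
        = H e s (scale_vector n s x)"
        unfolding H_def qs r h N_def[symmetric] q_def[symmetric] by (simp add: indicator_def qs)
    qed
    finally show ?thesis
      using nn_integral_scale_vector[OF s Hm1] by (simp add: distrib_left)
  qed
  have fubini: "(\<integral>\<^sup>+s. indicator {0<..<1} s * (\<integral>\<^sup>+y. H e s y \<partial>lebesgue_vectors n) \<partial>lborel)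
     = (\<integral>\<^sup>+y. (\<integral>\<^sup>+s. indicator {0<..<1} s * H e s y \<partial>lborel) \<partial>lebesgue_vectors n)" for e
  proof -
    have "(\<integral>\<^sup>+s. indicator {0<..<1} s * (\<integral>\<^sup>+y. H e s y \<partial>lebesgue_vectors n) \<partial>lborel)
      = (\<integral>\<^sup>+s. (\<integral>\<^sup>+y. indicator {0<..<1} s * H e s y \<partial>lebesgue_vectors n) \<partial>lborel)"
      by (intro nn_integral_cong nn_integral_cmult[symmetric] Hm1)
    also have "\<dots> = (\<integral>\<^sup>+y. (\<integral>\<^sup>+s. indicator {0<..<1} s * H e s y \<partial>lborel) \<partial>lebesgue_vectors n)"
    proof (rule P.Fubini'[symmetric])
      note Hm[measurable]
      have "(\<lambda>p. indicator {0<..<1} (fst p) * H e (fst p) (snd p)) \<in> borel_measurable (lborel \<Otimes>\<^sub>M lebesgue_vectors n)"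
        by measurable
      then show "(\<lambda>(s, y). indicator {0<..<1} s * H e s y) \<in> borel_measurable (lborel \<Otimes>\<^sub>M lebesgue_vectors n)"
        by (simp only: case_prod_unfold)
    qed
    finally show ?thesis .
  qed
  have radial: "(\<integral>\<^sup>+s. indicator {0<..<1} s * H e s y \<partial>lborel)
     = ennreal (1 / sqrt N) * (\<integral>\<^sup>+z. indicator {z. 0 < z \<and> q y + z\<^sup>2 < N} z * F (y(n := e * z)) \<partial>lborel)"
    if "y \<in> space (lebesgue_vectors n)" for e y
  proof -
    have fm: "(\<lambda>z. F (y(n := e * z))) \<in> borel_measurable borel"
      by (rule measurable_compose[OF measurable_upd_vector F]) (use that in measurable)
    have "(\<integral>\<^sup>+s. indicator {0<..<1} s * H e s y \<partial>lborel) = (\<integral>\<^sup>+s. indicator {s. 0 < s \<and> s < 1 \<and> q y < N * s\<^sup>2} s *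
        (ennreal (sqrt N * s / sqrt (N * s\<^sup>2 - q y)) * F (y(n := e * sqrt (N * s\<^sup>2 - q y)))) \<partial>lborel)"
      by (intro nn_integral_cong) (auto simp: H_def indicator_def)
    then show ?thesis using nn_integral_sphere_height[OF fm q0 N, of y] by simp
  qed
  have Fz: "(\<lambda>p. indicator {p. 0 < snd p \<and> q (fst p) + (snd p)\<^sup>2 < N} p * F ((fst p)(n := e * snd p))) \<in> borel_measurable (lebesgue_vectors n \<Otimes>\<^sub>M borel)" for e
  proof -
    have [measurable]: "(\<lambda>p. F ((fst p)(n := e * snd p))) \<in> borel_measurable (lebesgue_vectors n \<Otimes>\<^sub>M borel)"
      by (rule measurable_compose[OF measurable_upd_vector F]) measurable
    show ?thesis by measurable
  qed
  define G where "G e y = (\<integral>\<^sup>+z. indicator {z. 0 < z \<and> q y + z\<^sup>2 < N} z * F (y(n := e * z)) \<partial>lborel)" for e y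
  have Gm: "G e \<in> borel_measurable (lebesgue_vectors n)" for e
  proof -
    have "(\<lambda>(y,z). indicator {z. 0 < z \<and> q y + z\<^sup>2 < N} z * F (y(n := e * z))) \<in> borel_measurable (lebesgue_vectors n \<Otimes>\<^sub>M lborel)"
    proof -
      have "(\<lambda>(y,z). indicator {z. 0 < z \<and> q y + z\<^sup>2 < N} z * F (y(n := e * z))) =
        (\<lambda>p. indicator {p. 0 < snd p \<and> q (fst p) + (snd p)\<^sup>2 < N} p * F ((fst p)(n := e * snd p)))"
        by (auto simp: fun_eq_iff indicator_def)
      then show ?thesis using Fz[of e] by simp
    qed
    then show ?thesis unfolding G_def[abs_def] by (rule lborel.borel_measurable_nn_integral)
  qed
  have "(\<integral>\<^sup>+s. indicator {0<..<1} s * (ennreal (s ^ n) * (\<integral>\<^sup>+\<sigma>. F (scale_vector (Suc n) s \<sigma>) \<partial>sphere_volume (Suc n))) \<partial>lborel)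
      = (\<integral>\<^sup>+s. (\<Sum>e\<in>{1,-1}. indicator {0<..<1} s * (\<integral>\<^sup>+y. H e s y \<partial>lebesgue_vectors n)) \<partial>lborel)"
  proof (rule nn_integral_cong)
    fix s :: real
    show "indicator {0<..<1} s * (ennreal (s ^ n) * (\<integral>\<^sup>+\<sigma>. F (scale_vector (Suc n) s \<sigma>) \<partial>sphere_volume (Suc n)))
      = (\<Sum>e\<in>{1,-1}. indicator {0<..<1} s * (\<integral>\<^sup>+y. H e s y \<partial>lebesgue_vectors n))"
      unfolding sum_distrib_left[symmetric] by (cases "s \<in> {0<..<1}") (simp_all only: shell greaterThanLessThan_iff indicator_simps mult_1 mult_zero_left simp_thms)
  qed
  also have "\<dots> = (\<Sum>e\<in>{1,-1}. \<integral>\<^sup>+s. indicator {0<..<1} s * (\<integral>\<^sup>+y. H e s y \<partial>lebesgue_vectors n) \<partial>lborel)"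
  proof (rule nn_integral_sum)
    fix e :: real
    have "(\<lambda>s. \<integral>\<^sup>+y. H e s y \<partial>lebesgue_vectors n) \<in> borel_measurable borel"
      by (rule L.borel_measurable_nn_integral) (use Hm[of e] in \<open>simp only: case_prod_unfold\<close>)
    then show "(\<lambda>s. indicator {0<..<1} s * (\<integral>\<^sup>+y. H e s y \<partial>lebesgue_vectors n)) \<in> borel_measurable lborel"
      by measurable
  qed
  also have "\<dots> = (\<Sum>e\<in>{1,-1}. \<integral>\<^sup>+y. ennreal (1 / sqrt N) * G e y \<partial>lebesgue_vectors n)"
    unfolding fubini G_def by (intro sum.cong refl nn_integral_cong radial)
  also have "\<dots> = ennreal (1 / sqrt N) * (\<integral>\<^sup>+y. G 1 y + G (-1) y \<partial>lebesgue_vectors n)"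
    using Gm by (simp add: nn_integral_cmult nn_integral_add distrib_left)
  \<comment> \<open>The signs 1 and - 1 cover the half-lines z > 0 and z < 0; the point z = 0 is a
    null set.\<close>
  also have "(\<integral>\<^sup>+y. G 1 y + G (-1) y \<partial>lebesgue_vectors n) = (\<integral>\<^sup>+y. (\<integral>\<^sup>+z. indicator {z. q y + z\<^sup>2 < N} z * F (y(n := z)) \<partial>lborel) \<partial>lebesgue_vectors n)"
  proof (rule nn_integral_cong)
    fix y assume y: "y \<in> space (lebesgue_vectors n)"
    have [measurable]: "(\<lambda>z. F (y(n := z))) \<in> borel_measurable borel"
      by (rule measurable_compose[OF measurable_upd_vector F]) (use y in measurable)
    have "G (-1) y = (\<integral>\<^sup>+z. indicator {z. z < 0 \<and> q y + z\<^sup>2 < N} z * F (y(n := z)) \<partial>lborel)"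
      unfolding G_def
      by (subst nn_integral_real_affine[of _ "-1" 0]) (auto intro!: nn_integral_cong split: split_indicator)
    moreover have "G 1 y = (\<integral>\<^sup>+z. indicator {z. 0 < z \<and> q y + z\<^sup>2 < N} z * F (y(n := z)) \<partial>lborel)"
      by (simp add: G_def)
    ultimately have "G 1 y + G (-1) y = (\<integral>\<^sup>+z. indicator {z. 0 < z \<and> q y + z\<^sup>2 < N} z * F (y(n := z)) +
        indicator {z. z < 0 \<and> q y + z\<^sup>2 < N} z * F (y(n := z)) \<partial>lborel)"
      by (simp add: nn_integral_add)
    also have "\<dots> = (\<integral>\<^sup>+z. indicator {z. q y + z\<^sup>2 < N} z * F (y(n := z)) \<partial>lborel)"
    proof (rule nn_integral_cong_AE)
      have "AE z in lborel. z \<noteq> (0::real)" by (rule AE_lborel_singleton)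
      then show "AE z in lborel. indicator {z. 0 < z \<and> q y + z\<^sup>2 < N} z * F (y(n := z)) +
        indicator {z. z < 0 \<and> q y + z\<^sup>2 < N} z * F (y(n := z)) = indicator {z. q y + z\<^sup>2 < N} z * F (y(n := z))"
        by eventually_elim (auto split: split_indicator)
    qed
    finally show "G 1 y + G (-1) y = (\<integral>\<^sup>+z. indicator {z. q y + z\<^sup>2 < N} z * F (y(n := z)) \<partial>lborel)" .
  qed
  also have "\<dots> = (\<integral>\<^sup>+x. indicator {x. (\<Sum>i<Suc n. (x i)\<^sup>2) < real (Suc n)} x * F x \<partial>lebesgue_vectors (Suc n))"
  proof (subst nn_integral_lebesgue_vectors_Suc(1))
    have "(\<lambda>x. indicator {x. (\<Sum>i<Suc n. (x i)\<^sup>2) < real (Suc n)} x) = (\<lambda>x. indicator {..<real (Suc n)} (\<Sum>i<Suc n. (x i)\<^sup>2) :: ennreal)"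
      by (auto simp: fun_eq_iff indicator_def)
    then show "(\<lambda>x. indicator {x. (\<Sum>i<Suc n. (x i)\<^sup>2) < real (Suc n)} x * F x) \<in> borel_measurable (lebesgue_vectors (Suc n))"
      by simp
    have "(\<Sum>i<Suc n. ((y(n := z)) i)\<^sup>2) = q y + z\<^sup>2" for y z by (simp add: q_def)
    then show "(\<integral>\<^sup>+y. (\<integral>\<^sup>+z. indicator {z. q y + z\<^sup>2 < N} z * F (y(n := z)) \<partial>lborel) \<partial>lebesgue_vectors n) =
      (\<integral>\<^sup>+y. (\<integral>\<^sup>+z. indicator {x. (\<Sum>i<Suc n. (x i)\<^sup>2) < real (Suc n)} (y(n := z)) * F (y(n := z)) \<partial>lborel) \<partial>lebesgue_vectors n)"
      by (simp add: indicator_def N_def del: sum.lessThan_Suc)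
  qed
  finally have "(\<integral>\<^sup>+s. indicator {0<..<1} s * (ennreal (s ^ n) * (\<integral>\<^sup>+\<sigma>. F (scale_vector (Suc n) s \<sigma>) \<partial>sphere_volume (Suc n))) \<partial>lborel)
      = ennreal (1 / sqrt N) * (\<integral>\<^sup>+x. indicator {x. (\<Sum>i<Suc n. (x i)\<^sup>2) < real (Suc n)} x * F x \<partial>lebesgue_vectors (Suc n))" .
  moreover have "ennreal (sqrt N) * (ennreal (1 / sqrt N) * X) = X" for X
    using N by (simp add: mult.assoc[symmetric] ennreal_mult[symmetric])
  ultimately show ?thesis by (simp add: N_def)
qed

subsection \<open>The norm of the disorder tensor\<close>

text \<open>\<open>a k\<close> is the vector in slot k. The Hamiltonian has equal slots, but its
  second differences are forms with mixed slots.\<close>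

definition multilinear_form :: "nat \<Rightarrow> nat \<Rightarrow> ((nat \<Rightarrow> nat) \<Rightarrow> real) \<Rightarrow> (nat \<Rightarrow> nat \<Rightarrow> real) \<Rightarrow> real" where
  "multilinear_form N p J a = (\<Sum>i\<in>spin_indices N p. J i * (\<Prod>k<p. a k (i k)))"

lemma finite_spin_indices [simp]: "finite (spin_indices N p)"
  by (intro finite_PiE) auto

lemma multilinear_form_cong:
  assumes "\<And>k j. k < p \<Longrightarrow> j < N \<Longrightarrow> a k j = b k j"
  shows "multilinear_form N p J a = multilinear_form N p J b"
  unfolding multilinear_form_def
proof (intro sum.cong refl arg_cong2[where f = "(*)"] prod.cong)
  fix i k assume "i \<in> spin_indices N p" "k \<in> {..<p}"
  then show "a k (i k) = b k (i k)" using assms by (auto simp: PiE_iff)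
qed

lemma multilinear_form_slot:
  assumes "m < p"
  shows "\<exists>c. \<forall>v. multilinear_form N p J (a(m := v)) = (\<Sum>j<N. c j * v j)"
proof (intro exI allI)
  let ?I = "spin_indices N p"
  let ?w = "\<lambda>i. J i * (\<Prod>k\<in>{..<p}-{m}. a k (i k))"
  fix v :: "nat \<Rightarrow> real"
  have "multilinear_form N p J (a(m := v)) = (\<Sum>i\<in>?I. ?w i * v (i m))"
    unfolding multilinear_form_def
  proof (rule sum.cong)
    fix i
    have "(\<Prod>k<p. (a(m := v)) k (i k)) = v (i m) * (\<Prod>k\<in>{..<p}-{m}. (a(m := v)) k (i k))"
      using assms by (subst prod.remove[of _ m]) auto
    also have "(\<Prod>k\<in>{..<p}-{m}. (a(m := v)) k (i k)) = (\<Prod>k\<in>{..<p}-{m}. a k (i k))"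
      by (intro prod.cong) auto
    finally show "J i * (\<Prod>k<p. (a(m := v)) k (i k)) = ?w i * v (i m)" by simp
  qed simp
  also have "\<dots> = (\<Sum>j<N. \<Sum>i\<in>{i\<in>?I. i m = j}. ?w i * v (i m))"
    using assms by (intro sum.group[symmetric]) (auto simp: PiE_iff)
  also have "\<dots> = (\<Sum>j<N. (\<Sum>i\<in>{i\<in>?I. i m = j}. ?w i) * v j)"
    by (simp add: sum_distrib_right)
  finally show "multilinear_form N p J (a(m := v)) = (\<Sum>j<N. (\<Sum>i\<in>{i\<in>?I. i m = j}. ?w i) * v j)" .
qed

lemma multilinear_form_slot_diff:
  assumes "m < p"
  shows "multilinear_form N p J (a(m := u)) - multilinear_form N p J (a(m := v))
    = multilinear_form N p J (a(m := (\<lambda>j. u j - v j)))"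
proof -
  obtain c where "\<And>v. multilinear_form N p J (a(m := v)) = (\<Sum>j<N. c j * v j)"
    using multilinear_form_slot[OF assms, of N J a] by blast
  then show ?thesis by (simp add: sum_subtractf[symmetric] algebra_simps)
qed

lemma multilinear_form_slot_scale:
  assumes "m < p"
  shows "multilinear_form N p J (a(m := (\<lambda>j. r * u j))) = r * multilinear_form N p J (a(m := u))"
proof -
  obtain c where "\<And>v. multilinear_form N p J (a(m := v)) = (\<Sum>j<N. c j * v j)"
    using multilinear_form_slot[OF assms, of N J a] by blast
  then show ?thesis by (simp add: sum_distrib_left mult_ac)
qed

text \<open>Rounding to this grid moves a unit vector by at most 1 (the diameter of a cell),
  so the unit ball lies in the convex hull of the grid.\<close>

definition integer_grid :: "nat \<Rightarrow> (nat \<Rightarrow> int) set" where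
  "integer_grid N = {z \<in> {..<N} \<rightarrow>\<^sub>E {- int (2 * N)..int (2 * N)}. (\<Sum>j<N. (z j)\<^sup>2) \<le> 4 * int N}"

definition grid_point :: "nat \<Rightarrow> (nat \<Rightarrow> int) \<Rightarrow> nat \<Rightarrow> real" where
  "grid_point N z j = real_of_int (z j) / sqrt (real N)"

lemma finite_integer_grid: "finite (integer_grid N)"
proof (rule finite_subset)
  show "integer_grid N \<subseteq> {..<N} \<rightarrow>\<^sub>E {- int (2 * N)..int (2 * N)}" by (auto simp: integer_grid_def)
qed (intro finite_PiE; simp)

text \<open>Each scaled coordinate is rounded in the direction favoured by the sign of
  \<open>c j\<close>, so the linear form does not decrease. It moves by at most 1, so the scaled
  norm is at most sqrt N + sqrt N, whence the bound 4 N in the grid. Unlike rounding to a nearest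
  net point, this loses no factor.\<close>

lemma linear_form_rounding:
  fixes c v :: "nat \<Rightarrow> real"
  assumes N: "0 < N" and v: "vnorm N v \<le> 1"
  shows "\<exists>z\<in>integer_grid N. (\<Sum>j<N. c j * v j) \<le> (\<Sum>j<N. c j * grid_point N z j)"
proof -
  let ?r = "sqrt (real N)"
  have r: "0 < ?r" using N by simp
  define z where "z = (\<lambda>j\<in>{..<N}. if 0 \<le> c j then \<lfloor>v j * ?r\<rfloor> + 1 else \<lfloor>v j * ?r\<rfloor>)"
  have z: "z j = (if 0 \<le> c j then \<lfloor>v j * ?r\<rfloor> + 1 else \<lfloor>v j * ?r\<rfloor>)" if "j < N" for j
    using that by (simp add: z_def)
  have close: "\<bar>real_of_int (z j) - v j * ?r\<bar> \<le> 1" if "j < N" for j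
    unfolding z[OF that] by (auto simp: abs_le_iff) linarith+
  have "vnorm N (\<lambda>j. real_of_int (z j)) \<le> vnorm N (\<lambda>j. ?r * v j) + vnorm N (\<lambda>j. real_of_int (z j) - ?r * v j)"
    using L2_set_triangle_ineq[of "\<lambda>j. ?r * v j" "\<lambda>j. real_of_int (z j) - ?r * v j" "{..<N}"] by simp
  also have "vnorm N (\<lambda>j. ?r * v j) = ?r * vnorm N v" by (rule L2_set_right_distrib[symmetric]) simp
  also have "\<dots> \<le> ?r" using v r by (simp add: mult_left_le)
  also have "vnorm N (\<lambda>j. real_of_int (z j) - ?r * v j) \<le> ?r"
  proof -
    have "(\<Sum>j<N. (real_of_int (z j) - ?r * v j)\<^sup>2) \<le> (\<Sum>j<N. 1)"
    proof (rule sum_mono)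
      fix j assume "j \<in> {..<N}"
      then have "\<bar>real_of_int (z j) - ?r * v j\<bar> \<le> 1" using close[of j] by (simp add: mult.commute)
      then show "(real_of_int (z j) - ?r * v j)\<^sup>2 \<le> 1" by (simp add: abs_square_le_1)
    qed
    then show ?thesis by (simp add: L2_set_def)
  qed
  finally have "vnorm N (\<lambda>j. real_of_int (z j)) \<le> 2 * ?r" by simp
  then have "(vnorm N (\<lambda>j. real_of_int (z j)))\<^sup>2 \<le> (2 * ?r)\<^sup>2" by (intro power_mono) auto
  then have "(\<Sum>j<N. (real_of_int (z j))\<^sup>2) \<le> (2 * ?r)\<^sup>2" unfolding vnorm_sq .
  also have "(2 * ?r)\<^sup>2 = 4 * real N" by (simp only: power_mult_distrib real_sqrt_pow2 of_nat_0_le_iff) simp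
  also have "\<dots> = real_of_int (4 * int N)" by simp
  also have "(\<Sum>j<N. (real_of_int (z j))\<^sup>2) = real_of_int (\<Sum>j<N. (z j)\<^sup>2)"
    by (simp only: of_int_sum of_int_power)
  finally have sq: "(\<Sum>j<N. (z j)\<^sup>2) \<le> 4 * int N" by (simp only: of_int_le_iff)
  have "z \<in> {..<N} \<rightarrow>\<^sub>E {- int (2 * N)..int (2 * N)}"
  proof (rule PiE_I)
    fix j assume j: "j \<in> {..<N}"
    have "(z j)\<^sup>2 \<le> (\<Sum>j<N. (z j)\<^sup>2)" using j by (intro member_le_sum) auto
    also have "\<dots> \<le> 4 * int N * 1" using sq by simp
    also have "\<dots> \<le> 4 * int N * int N" using N by (intro mult_left_mono) auto
    also have "\<dots> = (int (2 * N))\<^sup>2" by (simp add: power2_eq_square)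
    finally have "\<bar>z j\<bar> \<le> \<bar>int (2 * N)\<bar>" by (simp only: abs_le_square_iff)
    then have "\<bar>z j\<bar> \<le> int (2 * N)" by simp
    then show "z j \<in> {- int (2 * N)..int (2 * N)}" by auto
  next
    fix j assume "j \<notin> {..<N}" then show "z j = undefined" by (simp add: z_def)
  qed
  then have "z \<in> integer_grid N" using sq by (simp add: integer_grid_def)
  moreover have "(\<Sum>j<N. c j * v j) \<le> (\<Sum>j<N. c j * grid_point N z j)"
  proof (rule sum_mono)
    fix j assume "j \<in> {..<N}"
    then have zj: "z j = (if 0 \<le> c j then \<lfloor>v j * ?r\<rfloor> + 1 else \<lfloor>v j * ?r\<rfloor>)" by (intro z) simp
    show "c j * v j \<le> c j * grid_point N z j"
    proof (cases "0 \<le> c j")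
      case True
      have "v j * ?r \<le> real_of_int (z j)" unfolding zj using True by simp
      then have "v j \<le> grid_point N z j" using r by (simp add: grid_point_def field_simps)
      then show ?thesis using True by (rule mult_left_mono)
    next
      case False
      have "real_of_int (z j) \<le> v j * ?r" unfolding zj using False by simp
      then have "grid_point N z j \<le> v j" using r by (simp add: grid_point_def field_simps)
      then show ?thesis using False by (intro mult_left_mono_neg) auto
    qed
  qed
  ultimately show ?thesis by blast
qed

text \<open>The form is linear in each slot, so the slots are rounded one after the other while the
  remaining ones stay fixed.\<close>

lemma multilinear_form_rounding:
  assumes N: "0 < N" and a: "\<And>k. k < p \<Longrightarrow> vnorm N (a k) \<le> 1"
  shows "\<exists>z\<in>{..<p} \<rightarrow>\<^sub>E integer_grid N. multilinear_form N p J a \<le> multilinear_form N p J (\<lambda>k. grid_point N (z k))"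
proof -
  have "\<exists>z. (\<forall>k<m. z k \<in> integer_grid N) \<and>
     multilinear_form N p J a \<le> multilinear_form N p J (\<lambda>k. if k < m then grid_point N (z k) else a k)"
    if "m \<le> p" for m
    using that
  proof (induction m)
    case 0
    show ?case by simp
  next
    case (Suc m)
    then obtain z where z: "\<forall>k<m. z k \<in> integer_grid N"
      "multilinear_form N p J a \<le> multilinear_form N p J (\<lambda>k. if k < m then grid_point N (z k) else a k)" by auto
    let ?b = "\<lambda>k. if k < m then grid_point N (z k) else a k"
    have m: "m < p" using Suc by simp
    obtain c where c: "\<And>v. multilinear_form N p J (?b(m := v)) = (\<Sum>j<N. c j * v j)"
      using multilinear_form_slot[OF m, of N J ?b] by blast
    obtain y where y: "y \<in> integer_grid N" "(\<Sum>j<N. c j * a m j) \<le> (\<Sum>j<N. c j * grid_point N y j)"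
      using linear_form_rounding[OF N a[OF m], of c] by blast
    have "?b(m := a m) = ?b" by auto
    then have "multilinear_form N p J a \<le> multilinear_form N p J (?b(m := grid_point N y))"
      using z(2) y(2) c[of "a m"] c[of "grid_point N y"] by simp
    also have "?b(m := grid_point N y) = (\<lambda>k. if k < Suc m then grid_point N ((z(m := y)) k) else a k)"
      by (auto simp: fun_eq_iff less_Suc_eq)
    finally show ?case using z(1) y(1) by (intro exI[of _ "z(m := y)"]) (auto simp: less_Suc_eq)
  qed
  then obtain z where z: "\<forall>k<p. z k \<in> integer_grid N"
     "multilinear_form N p J a \<le> multilinear_form N p J (\<lambda>k. if k < p then grid_point N (z k) else a k)" by blast
  have "multilinear_form N p J (\<lambda>k. if k < p then grid_point N (z k) else a k)
      = multilinear_form N p J (\<lambda>k. grid_point N ((\<lambda>k\<in>{..<p}. z k) k))"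
    by (rule multilinear_form_cong) auto
  then show ?thesis using z by (intro bexI[of _ "\<lambda>k\<in>{..<p}. z k"]) auto
qed

text \<open>A lattice point count by the exponential Markov inequality.\<close>

lemma card_integer_grid: "real (card (integer_grid N)) \<le> exp (6 * real N)"
proof -
  let ?Z = "{- int (2 * N)..int (2 * N)}"
  \<comment> \<open>Dominates the sum of exp (- z^2) over integers by the series of 2^(- |z|), whose
    partial sums stay below 3 \<le> exp 2.\<close>
  have one_dim: "(\<Sum>z\<in>{- int m..int m}. (1/2::real) ^ nat \<bar>z\<bar>) = 3 - 2 * (1/2) ^ m" for m
  proof (induction m)
    case (Suc m)
    have "{- int (Suc m)..int (Suc m)} = insert (- int (Suc m)) (insert (int (Suc m)) {- int m..int m})" by auto
    then show ?case using Suc by (simp add: nat_add_distrib)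
  qed simp
  have "(\<Sum>z\<in>?Z. exp (- (real_of_int z)\<^sup>2)) \<le> (\<Sum>z\<in>?Z. (1/2) ^ nat \<bar>z\<bar>)"
  proof (rule sum_mono)
    fix z :: int
    have "real_of_int \<bar>z\<bar> \<le> (real_of_int z)\<^sup>2"
    proof -
      have "\<bar>z\<bar> * 1 \<le> \<bar>z\<bar> * \<bar>z\<bar>" by (cases "z = 0", simp, rule mult_left_mono) auto
      then have "\<bar>z\<bar> \<le> \<bar>z\<bar> * \<bar>z\<bar>" by (simp only: mult_1_right)
      then have "real_of_int \<bar>z\<bar> \<le> real_of_int (\<bar>z\<bar> * \<bar>z\<bar>)" by (simp only: of_int_le_iff)
      then show ?thesis by (simp add: power2_eq_square)
    qed
    then have "exp (- (real_of_int z)\<^sup>2) \<le> exp (- real (nat \<bar>z\<bar>))" by simp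
    also have "\<dots> = exp (-1) ^ nat \<bar>z\<bar>" by (simp add: exp_of_nat_mult[symmetric])
    also have "\<dots> \<le> (1/2) ^ nat \<bar>z\<bar>"
    proof (rule power_mono)
      have "2 \<le> exp (1::real)" using exp_ge_add_one_self[of 1] by simp
      then show "exp (-1) \<le> (1/2::real)" by (simp add: exp_minus field_simps)
    qed simp
    finally show "exp (- (real_of_int z)\<^sup>2) \<le> (1/2) ^ nat \<bar>z\<bar>" .
  qed
  also have "\<dots> \<le> 3" using one_dim[of "2 * N"] by simp
  also have "\<dots> \<le> exp 2" using exp_ge_add_one_self[of 2] by simp
  finally have Z: "(\<Sum>z\<in>?Z. exp (- (real_of_int z)\<^sup>2)) \<le> exp 2" .
  have "real (card (integer_grid N)) = (\<Sum>z\<in>integer_grid N. 1)" by simp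
  \<comment> \<open>The Markov weight exp (4 N - sum of z^2) is at least 1 on the grid and
    factorises over coordinates, so the exponents 4 and 2 add up to 6.\<close>
  also have "\<dots> \<le> (\<Sum>z\<in>integer_grid N. exp (4 * real N) * (\<Prod>j<N. exp (- (real_of_int (z j))\<^sup>2)))"
  proof (rule sum_mono)
    fix z assume "z \<in> integer_grid N"
    then have "(\<Sum>j<N. (z j)\<^sup>2) \<le> 4 * int N" by (simp add: integer_grid_def)
    then have "real_of_int (\<Sum>j<N. (z j)\<^sup>2) \<le> real_of_int (4 * int N)" by (simp only: of_int_le_iff)
    then have "0 \<le> 4 * real N - (\<Sum>j<N. (real_of_int (z j))\<^sup>2)" by simp
    then have "1 \<le> exp (4 * real N - (\<Sum>j<N. (real_of_int (z j))\<^sup>2))" by simp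
    also have "\<dots> = exp (4 * real N) * (\<Prod>j<N. exp (- (real_of_int (z j))\<^sup>2))"
      by (simp add: exp_sum[symmetric] sum_negf mult_exp_exp)
    finally show "1 \<le> exp (4 * real N) * (\<Prod>j<N. exp (- (real_of_int (z j))\<^sup>2))" .
  qed
  also have "\<dots> \<le> (\<Sum>z\<in>{..<N} \<rightarrow>\<^sub>E ?Z. exp (4 * real N) * (\<Prod>j<N. exp (- (real_of_int (z j))\<^sup>2)))"
    by (rule sum_mono2) (auto intro!: finite_PiE simp: integer_grid_def prod_nonneg)
  also have "\<dots> = exp (4 * real N) * (\<Prod>j<N. \<Sum>z\<in>?Z. exp (- (real_of_int z)\<^sup>2))"
    by (subst prod_sum_PiE) (auto simp: sum_distrib_left)
  also have "\<dots> = exp (4 * real N) * (\<Sum>z\<in>?Z. exp (- (real_of_int z)\<^sup>2)) ^ N" by simp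
  also have "\<dots> \<le> exp (4 * real N) * exp 2 ^ N"
    using Z by (intro mult_left_mono power_mono sum_nonneg) auto
  also have "\<dots> = exp (6 * real N)" by (simp add: exp_of_nat_mult[symmetric] mult_exp_exp)
  finally show ?thesis .
qed

section \<open>Gaussian tails and the union bound over the grid\<close>

lemma std_normal_mgf:
  "(\<integral>\<^sup>+x. ennreal (exp (a * x)) \<partial>density lborel std_normal_density) = ennreal (exp (a\<^sup>2 / 2))"
proof -
  have "(\<integral>\<^sup>+x. ennreal (exp (a * x)) \<partial>density lborel std_normal_density)
    = (\<integral>\<^sup>+x. ennreal (std_normal_density x) * ennreal (exp (a * x)) \<partial>lborel)"
    by (subst nn_integral_density) auto
  also have "\<dots> = (\<integral>\<^sup>+x. ennreal (exp (a\<^sup>2 / 2)) * ennreal (normal_density a 1 x) \<partial>lborel)"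
  proof (rule nn_integral_cong)
    fix x
    have "std_normal_density x * exp (a * x) = exp (a\<^sup>2 / 2) * normal_density a 1 x"
      unfolding normal_density_def by (simp add: mult_exp_exp power2_eq_square field_simps)
    then show "ennreal (std_normal_density x) * ennreal (exp (a * x)) = ennreal (exp (a\<^sup>2 / 2)) * ennreal (normal_density a 1 x)"
      by (simp add: ennreal_mult[symmetric])
  qed
  also have "\<dots> = ennreal (exp (a\<^sup>2 / 2)) * (\<integral>\<^sup>+x. ennreal (normal_density a 1 x) \<partial>lborel)"
    by (rule nn_integral_cmult) simp
  also have "(\<integral>\<^sup>+x. ennreal (normal_density a 1 x) \<partial>lborel) = 1"
    by (subst nn_integral_eq_integral) (auto simp: integrable_normal_density integral_normal_density)
  finally show ?thesis by simp
qed

lemma prob_space_disorder_law: "prob_space (disorder_law N p)"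
  unfolding disorder_law_def by (intro prob_space_PiM prob_space_normal_density) simp

lemma sets_disorder_law: "sets (disorder_law N p) = sets (\<Pi>\<^sub>M i\<in>spin_indices N p. borel)"
  unfolding disorder_law_def by (intro sets_PiM_cong) auto

lemma disorder_coordinate_measurable:
  assumes "i \<in> spin_indices N p"
  shows "(\<lambda>J. J i) \<in> borel_measurable (disorder_law N p)"
proof -
  have "(\<lambda>J. J i) \<in> disorder_law N p \<rightarrow>\<^sub>M density lborel std_normal_density"
    unfolding disorder_law_def by (rule measurable_component_singleton[OF assms])
  then show ?thesis by simp
qed

lemma multilinear_form_measurable:
  "(\<lambda>J. multilinear_form N p J a) \<in> borel_measurable (disorder_law N p)"
  unfolding multilinear_form_def
  by (intro borel_measurable_sum borel_measurable_times disorder_coordinate_measurable borel_measurable_const)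

text \<open>The form is a centred Gaussian whose variance is the sum in the assumption. Chernoff's
  bound with parameter sqrt N: the level contributes exp (- C N) and the moment generating function
  at most exp (N K / 2).\<close>

lemma multilinear_form_tail:
  assumes "(\<Sum>i\<in>spin_indices N p. (\<Prod>k<p. a k (i k))\<^sup>2) \<le> K"
  shows "emeasure (disorder_law N p) {J \<in> space (disorder_law N p). C * sqrt (real N) < multilinear_form N p J a}
    \<le> ennreal (exp (real N * K / 2 - C * real N))"
proof -
  let ?D = "disorder_law N p" and ?I = "spin_indices N p" and ?r = "sqrt (real N)"
  let ?w = "\<lambda>i. \<Prod>k<p. a k (i k)"
  note multilinear_form_measurable[of N p a, measurable]
  interpret G: prob_space "density lborel std_normal_density" by (rule prob_space_normal_density) simp
  interpret product_sigma_finite "\<lambda>i::nat \<Rightarrow> nat. density lborel std_normal_density" ..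
  have "emeasure ?D {J \<in> space ?D. C * ?r < multilinear_form N p J a} \<le>
     (\<integral>\<^sup>+J. ennreal (exp (- C * real N)) * ennreal (exp (?r * multilinear_form N p J a)) \<partial>?D)"
  proof -
    have "emeasure ?D {J \<in> space ?D. C * ?r < multilinear_form N p J a} = (\<integral>\<^sup>+J. indicator {J \<in> space ?D. C * ?r < multilinear_form N p J a} J \<partial>?D)"
      by (rule nn_integral_indicator[symmetric]) measurable
    also have "\<dots> \<le> (\<integral>\<^sup>+J. ennreal (exp (- C * real N)) * ennreal (exp (?r * multilinear_form N p J a)) \<partial>?D)"
    proof (rule nn_integral_mono)
      fix J
      have "1 \<le> exp (- C * real N + ?r * multilinear_form N p J a)" if "C * ?r < multilinear_form N p J a"
      proof -
        have "?r * (C * ?r) \<le> ?r * multilinear_form N p J a" using that by (intro mult_left_mono) auto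
        moreover have "?r * (C * ?r) = C * real N" by simp
        ultimately show ?thesis by simp
      qed
      then show "indicator {J \<in> space ?D. C * ?r < multilinear_form N p J a} J
          \<le> ennreal (exp (- C * real N)) * ennreal (exp (?r * multilinear_form N p J a))"
        by (auto simp: indicator_def ennreal_mult[symmetric] mult_exp_exp)
    qed
    finally show ?thesis .
  qed
  also have "\<dots> = ennreal (exp (- C * real N)) * (\<integral>\<^sup>+J. ennreal (exp (?r * multilinear_form N p J a)) \<partial>?D)"
    by (rule nn_integral_cmult) measurable
  also have "(\<integral>\<^sup>+J. ennreal (exp (?r * multilinear_form N p J a)) \<partial>?D)
      = (\<integral>\<^sup>+J. (\<Prod>i\<in>?I. ennreal (exp ((?r * ?w i) * J i))) \<partial>?D)"
    unfolding multilinear_form_def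
    by (intro nn_integral_cong) (simp add: prod_ennreal exp_sum[symmetric] sum_distrib_left mult_ac)
  also have "\<dots> = (\<Prod>i\<in>?I. \<integral>\<^sup>+x. ennreal (exp ((?r * ?w i) * x)) \<partial>density lborel std_normal_density)"
    unfolding disorder_law_def by (rule product_nn_integral_prod) auto
  also have "\<dots> = ennreal (exp (\<Sum>i\<in>?I. (?r * ?w i)\<^sup>2 / 2))"
    unfolding std_normal_mgf by (simp add: prod_ennreal exp_sum)
  also have "(\<Sum>i\<in>?I. (?r * ?w i)\<^sup>2 / 2) = real N * (\<Sum>i\<in>?I. (?w i)\<^sup>2) / 2"
    by (simp add: power_mult_distrib sum_distrib_left sum_divide_distrib)
  also have "ennreal (exp (- C * real N)) * ennreal (exp (real N * (\<Sum>i\<in>?I. (?w i)\<^sup>2) / 2)) \<le>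
      ennreal (exp (real N * K / 2 - C * real N))"
    using assms by (simp add: ennreal_mult[symmetric] mult_exp_exp mult_left_mono)
  finally show ?thesis .
qed

text \<open>Finitely many conditions, which makes the event measurable. They are one-sided because
  reversing the sign of one slot gives the opposite bound.\<close>

definition good_disorder :: "nat \<Rightarrow> nat \<Rightarrow> real \<Rightarrow> ((nat \<Rightarrow> nat) \<Rightarrow> real) set" where
  "good_disorder N p C = {J \<in> space (disorder_law N p).
     \<forall>z\<in>{..<p} \<rightarrow>\<^sub>E integer_grid N. multilinear_form N p J (\<lambda>k. grid_point N (z k)) \<le> C * sqrt (real N)}"

lemma good_disorder_measurable [measurable]: "good_disorder N p C \<in> sets (disorder_law N p)"
  unfolding good_disorder_def
proof (rule sets.sets_Collect_finite_All)
  fix z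
  note multilinear_form_measurable[of N p "\<lambda>k. grid_point N (z k)", measurable]
  show "{J \<in> space (disorder_law N p). multilinear_form N p J (\<lambda>k. grid_point N (z k)) \<le> C * sqrt (real N)}
    \<in> sets (disorder_law N p)" by measurable
qed (intro finite_PiE finite_integer_grid; simp)

text \<open>There are at most exp (6 p N) tuples of grid points and each form has variance at most
  4^p, so the union bound is exp (N * (6 p + 4^p / 2 - C)); the summand 1 in the bound on C leaves
  exp (- N).\<close>

lemma prob_good_disorder:
  assumes N: "0 < N" and C: "6 * real p + 4 ^ p / 2 + 1 \<le> C"
  shows "1 - measure (disorder_law N p) (good_disorder N p C) \<le> exp (- real N)"
proof -
  interpret D: prob_space "disorder_law N p" by (rule prob_space_disorder_law)
  let ?D = "disorder_law N p" and ?Z = "{..<p} \<rightarrow>\<^sub>E integer_grid N"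
  let ?E = "\<lambda>z. {J \<in> space ?D. C * sqrt (real N) < multilinear_form N p J (\<lambda>k. grid_point N (z k))}"
  let ?e = "exp (real N * 4 ^ p / 2 - C * real N)"
  have fin: "finite ?Z" by (intro finite_PiE finite_integer_grid) auto
  have single: "measure ?D (?E z) \<le> ?e" if z: "z \<in> ?Z" for z
  proof -
    have "(\<Sum>i\<in>spin_indices N p. (\<Prod>k<p. grid_point N (z k) (i k))\<^sup>2) = (\<Sum>i\<in>spin_indices N p. \<Prod>k<p. (grid_point N (z k) (i k))\<^sup>2)"
      by (simp add: prod_power_distrib)
    \<comment> \<open>The variance of the form on a tuple is the product of the squared norms of its
      vectors, each at most 4 on the grid.\<close>
    also have "\<dots> = (\<Prod>k<p. \<Sum>j<N. (grid_point N (z k) j)\<^sup>2)"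
      by (rule prod_sum_PiE[symmetric]) auto
    also have "\<dots> \<le> (\<Prod>k<p. 4)"
    proof (intro prod_mono conjI)
      fix k assume "k \<in> {..<p}"
      then have "(\<Sum>j<N. (z k j)\<^sup>2) \<le> 4 * int N" using z by (auto simp: PiE_iff integer_grid_def)
      then have "real_of_int (\<Sum>j<N. (z k j)\<^sup>2) \<le> real_of_int (4 * int N)" by (simp only: of_int_le_iff)
      then have "(\<Sum>j<N. (real_of_int (z k j))\<^sup>2) / real N \<le> 4" using N by (simp add: field_simps)
      then show "(\<Sum>j<N. (grid_point N (z k) j)\<^sup>2) \<le> 4"
        by (simp add: grid_point_def power_divide sum_divide_distrib)
    qed (simp add: sum_nonneg)
    finally have "emeasure ?D (?E z) \<le> ennreal ?e" by (intro multilinear_form_tail) simp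
    then show ?thesis by (simp add: D.emeasure_eq_measure)
  qed
  have "1 - measure ?D (good_disorder N p C) = measure ?D (space ?D - good_disorder N p C)"
    by (rule D.prob_compl[symmetric]) measurable
  also have "space ?D - good_disorder N p C = (\<Union>z\<in>?Z. ?E z)"
    by (auto simp: good_disorder_def not_le)
  also have "measure ?D (\<Union>z\<in>?Z. ?E z) \<le> (\<Sum>z\<in>?Z. measure ?D (?E z))"
  proof (rule measure_UNION_le[OF fin])
    fix z
    note multilinear_form_measurable[of N p "\<lambda>k. grid_point N (z k)", measurable]
    show "?E z \<in> sets ?D" by measurable
  qed
  also have "\<dots> \<le> (\<Sum>z\<in>?Z. ?e)" by (rule sum_mono) (rule single)
  also have "\<dots> = real (card (integer_grid N)) ^ p * ?e" by (simp add: card_PiE)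
  also have "\<dots> \<le> exp (6 * real N) ^ p * ?e"
    by (intro mult_right_mono power_mono card_integer_grid) auto
  also have "\<dots> = exp (real N * (6 * real p + 4 ^ p / 2 - C))"
    by (simp add: exp_of_nat_mult[symmetric] mult_exp_exp algebra_simps)
  also have "\<dots> \<le> exp (real N * (- 1))"
    using C by (simp only: exp_le_cancel_iff) (intro mult_left_mono; simp)
  finally show ?thesis by simp
qed

lemma multilinear_form_bound:
  assumes N: "0 < N" and p: "0 < p" and J: "J \<in> good_disorder N p C"
  shows "\<bar>multilinear_form N p J a\<bar> \<le> C * sqrt (real N) * (\<Prod>k<p. vnorm N (a k))"
proof -
  have upper: "multilinear_form N p J a \<le> C * sqrt (real N) * (\<Prod>k<p. vnorm N (a k))" for a
  proof -
    \<comment> \<open>Normalised slots. If \<open>a k\<close> has norm 0, then \<open>b k\<close> is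
      0 by the convention x / 0 = 0, and \<open>a k\<close> vanishes as well, so the factorisation
      still holds.\<close>
    define b where "b k j = a k j / vnorm N (a k)" for k j
    have "a k j = vnorm N (a k) * b k j" if "j < N" for k j
    proof (cases "vnorm N (a k) = 0")
      case True
      then have "a k j = 0" using that by (simp add: L2_set_eq_0_iff)
      then show ?thesis by (simp add: b_def)
    qed (simp add: b_def)
    then have "(\<Prod>k<p. a k (i k)) = (\<Prod>k<p. vnorm N (a k)) * (\<Prod>k<p. b k (i k))" if "i \<in> spin_indices N p" for i
      using that unfolding prod.distrib[symmetric] by (intro prod.cong refl) (auto simp: PiE_iff)
    then have eq: "multilinear_form N p J a = (\<Prod>k<p. vnorm N (a k)) * multilinear_form N p J b"
      unfolding multilinear_form_def sum_distrib_left by (intro sum.cong refl) (simp add: mult_ac)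
    have "vnorm N (b k) \<le> 1" for k
    proof -
      have "vnorm N (b k) = inverse (vnorm N (a k)) * vnorm N (a k)"
        unfolding b_def[abs_def] divide_inverse_commute by (rule L2_set_right_distrib[symmetric]) simp
      then show ?thesis by (cases "vnorm N (a k) = 0") simp_all
    qed
    then obtain z where z: "z \<in> {..<p} \<rightarrow>\<^sub>E integer_grid N"
        "multilinear_form N p J b \<le> multilinear_form N p J (\<lambda>k. grid_point N (z k))"
      using multilinear_form_rounding[OF N, of p b J] by blast
    then have "multilinear_form N p J b \<le> C * sqrt (real N)"
      using J by (auto simp: good_disorder_def)
    then have "(\<Prod>k<p. vnorm N (a k)) * multilinear_form N p J b \<le> (\<Prod>k<p. vnorm N (a k)) * (C * sqrt (real N))"
      by (intro mult_left_mono prod_nonneg) auto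
    then show ?thesis unfolding eq by (simp add: mult_ac)
  qed
  \<comment> \<open>The lower bound is the upper bound for the tuple with slot 0 negated; slot 0
    exists because p > 0.\<close>
  have "- multilinear_form N p J a = multilinear_form N p J (a(0 := (\<lambda>j. (-1) * a 0 j)))"
    using multilinear_form_slot_scale[OF p, of N J a "-1" "a 0"] by simp
  also have "\<dots> \<le> C * sqrt (real N) * (\<Prod>k<p. vnorm N ((a(0 := (\<lambda>j. (-1) * a 0 j))) k))"
    by (rule upper)
  also have "(\<Prod>k<p. vnorm N ((a(0 := (\<lambda>j. (-1) * a 0 j))) k)) = (\<Prod>k<p. vnorm N (a k))"
    by (intro prod.cong refl) (auto simp: L2_set_def)
  finally show ?thesis using upper[of a] by (simp add: abs_le_iff)
qed

section \<open>Size and second differences of the Hamiltonian on the ball\<close>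

text \<open>Replaces u by v one slot at a time from slot l on, with the slots below l held fixed.
  With l = 0 it gives first differences, with l = m + 1 the differences of those.\<close>

lemma multilinear_form_telescope:
  assumes "l \<le> p"
  shows "multilinear_form N p J (\<lambda>k. if k < l then c k else u)
     - multilinear_form N p J (\<lambda>k. if k < l then c k else v)
    = (\<Sum>m=l..<p. multilinear_form N p J (\<lambda>k. if k < l then c k else if k < m then v else if k = m then (\<lambda>j. u j - v j) else u))"
proof -
  define T where "T m = multilinear_form N p J (\<lambda>k. if k < l then c k else if k < m then v else u)" for m
  have step: "T m - T (Suc m) = multilinear_form N p J (\<lambda>k. if k < l then c k else if k < m then v else if k = m then (\<lambda>j. u j - v j) else u)"
    if m: "m \<in> {l..<p}" for m
  proof -
    let ?b = "\<lambda>k. if k < l then c k else if k < m then v else u"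
    have "?b(m := u) = ?b" "?b(m := v) = (\<lambda>k. if k < l then c k else if k < Suc m then v else u)"
      "?b(m := (\<lambda>j. u j - v j)) = (\<lambda>k. if k < l then c k else if k < m then v else if k = m then (\<lambda>j. u j - v j) else u)"
      using m by (auto simp: fun_eq_iff less_Suc_eq)
    then show ?thesis using multilinear_form_slot_diff[of m p N J ?b u v] m unfolding T_def by simp
  qed
  have "T l - T p = (\<Sum>m=l..<p. T m - T (Suc m))"
    using assms sum_Suc_diff'[of l p "\<lambda>m. - T m"] by simp
  also have "\<dots> = (\<Sum>m=l..<p. multilinear_form N p J (\<lambda>k. if k < l then c k else if k < m then v else if k = m then (\<lambda>j. u j - v j) else u))"
    by (rule sum.cong[OF refl step])
  moreover have "T l = multilinear_form N p J (\<lambda>k. if k < l then c k else u)"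
    unfolding T_def by (intro multilinear_form_cong) auto
  moreover have "T p = multilinear_form N p J (\<lambda>k. if k < l then c k else v)"
    unfolding T_def by (intro multilinear_form_cong) auto
  ultimately show ?thesis by simp
qed

lemma hamiltonian_multilinear_form:
  "hamiltonian N p J x = real N powr (- (real p - 1) / 2) * multilinear_form N p J (\<lambda>k. x)"
  by (simp add: hamiltonian_def multilinear_form_def)

text \<open>The scaling of the Hamiltonian against q slots of norm sqrt N: q = p gives N, the size
  of H, and q = p - 2 gives 1, for second differences.\<close>

lemma powr_sqrt_power:
  assumes "0 < N"
  shows "real N powr (- (real p - 1) / 2) * (sqrt (real N) * sqrt (real N) ^ q) = real N powr ((real q + 2 - real p) / 2)"
proof -
  have s: "sqrt (real N) = real N powr (1/2)" using assms by (simp add: powr_half_sqrt)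
  have "sqrt (real N) ^ q = real N powr (real q / 2)"
    unfolding s using assms by (simp add: powr_realpow[symmetric] powr_powr)
  then have "real N powr (- (real p - 1) / 2) * (sqrt (real N) * sqrt (real N) ^ q)
     = real N powr (- (real p - 1) / 2 + (1/2 + real q / 2))"
    unfolding s by (simp only: powr_add)
  also have "- (real p - 1) / 2 + (1/2 + real q / 2) = (real q + 2 - real p) / 2" by (simp add: field_simps)
  finally show ?thesis .
qed

lemma hamiltonian_bound:
  assumes N: "0 < N" and p: "0 < p" and C: "0 \<le> C" and J: "J \<in> good_disorder N p C"
    and x: "vnorm N x \<le> sqrt (real N)"
  shows "\<bar>hamiltonian N p J x\<bar> \<le> C * real N"
proof -
  have "\<bar>multilinear_form N p J (\<lambda>k. x)\<bar> \<le> C * sqrt (real N) * vnorm N x ^ p"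
    using multilinear_form_bound[OF N p J, of "\<lambda>k. x"] by simp
  also have "\<dots> \<le> C * sqrt (real N) * sqrt (real N) ^ p"
    using x C by (intro mult_left_mono power_mono) auto
  finally have "\<bar>hamiltonian N p J x\<bar> \<le> real N powr (- (real p - 1) / 2) * (C * sqrt (real N) * sqrt (real N) ^ p)"
    unfolding hamiltonian_multilinear_form abs_mult by (intro mult_mono) auto
  also have "\<dots> = C * (real N powr (- (real p - 1) / 2) * (sqrt (real N) * sqrt (real N) ^ p))" by simp
  also have "\<dots> = C * real N" unfolding powr_sqrt_power[OF N] using N by simp
  finally show ?thesis .
qed

lemma vnorm_convex_comb:
  assumes "0 \<le> t" "t \<le> 1" "vnorm N x \<le> R" "vnorm N y \<le> R"
  shows "vnorm N (convex_comb N t x y) \<le> R"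
proof -
  have "vnorm N (convex_comb N t x y) = vnorm N (\<lambda>i. t * x i + (1 - t) * y i)"
    by (intro L2_set_cong) (auto simp: convex_comb_def)
  also have "\<dots> \<le> vnorm N (\<lambda>i. t * x i) + vnorm N (\<lambda>i. (1 - t) * y i)" by (rule L2_set_triangle_ineq)
  also have "\<dots> = t * vnorm N x + (1 - t) * vnorm N y"
    using assms by (simp add: L2_set_right_distrib)
  also have "\<dots> \<le> t * R + (1 - t) * R" using assms by (intro add_mono mult_left_mono) auto
  finally show ?thesis by (simp add: algebra_simps)
qed

text \<open>With d = x - y one has x - z = (1 - t) d and y - z = - t d, so the two telescoped first
  differences combine to t (1 - t) times the sum over m of P x m - P y m. Telescoping again leaves
  at most p^2 forms with d in two slots and vectors of norm at most sqrt N elsewhere; the powers of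
  N cancel.\<close>

lemma hamiltonian_semiconvex:
  assumes N: "0 < N" and p: "2 \<le> p" and C: "0 \<le> C" and J: "J \<in> good_disorder N p C"
    and x: "vnorm N x \<le> sqrt (real N)" and y: "vnorm N y \<le> sqrt (real N)" and t: "0 \<le> t" "t \<le> 1"
  shows "\<bar>t * hamiltonian N p J x + (1 - t) * hamiltonian N p J y - hamiltonian N p J (convex_comb N t x y)\<bar>
    \<le> t * (1 - t) * ((real p)\<^sup>2 * C * (vdist N x y)\<^sup>2)"
proof -
  let ?A = "multilinear_form N p J" and ?r = "sqrt (real N)"
  define z where "z = convex_comb N t x y"
  define d where "d = (\<lambda>j. x j - y j)"
  have z: "vnorm N z \<le> ?r" unfolding z_def using vnorm_convex_comb[OF t x y] .
  have zj: "z j = t * x j + (1 - t) * y j" if "j < N" for j using that by (simp add: z_def convex_comb_def)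
  define P where "P u m = ?A (\<lambda>k. if k < m then z else if k = m then d else u)" for u m
  have expand: "?A (\<lambda>k. u) - ?A (\<lambda>k. z) = r * (\<Sum>m<p. P u m)" if u: "\<And>j. j < N \<Longrightarrow> u j - z j = r * d j" for u r
  proof -
    have "?A (\<lambda>k. u) - ?A (\<lambda>k. z) = (\<Sum>m=0..<p. ?A (\<lambda>k. if k < m then z else if k = m then (\<lambda>j. u j - z j) else u))"
      using multilinear_form_telescope[of 0 p N J _ u z] by simp
    also have "\<dots> = (\<Sum>m=0..<p. r * P u m)"
    proof (rule sum.cong[OF refl])
      fix m assume m: "m \<in> {0..<p}"
      let ?b = "\<lambda>k. if k < m then z else if k = m then d else u"
      have "?A (\<lambda>k. if k < m then z else if k = m then (\<lambda>j. u j - z j) else u) = ?A (?b(m := (\<lambda>j. r * d j)))"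
        by (intro multilinear_form_cong) (auto simp: u)
      also have "\<dots> = r * ?A (?b(m := d))" using m by (intro multilinear_form_slot_scale) simp
      also have "?b(m := d) = ?b" by auto
      finally show "?A (\<lambda>k. if k < m then z else if k = m then (\<lambda>j. u j - z j) else u) = r * P u m"
        by (simp add: P_def)
    qed
    finally show ?thesis by (simp add: sum_distrib_left lessThan_atLeast0)
  qed
  have ex: "?A (\<lambda>k. x) - ?A (\<lambda>k. z) = (1 - t) * (\<Sum>m<p. P x m)"
    by (rule expand) (simp add: zj d_def algebra_simps)
  have ey: "?A (\<lambda>k. y) - ?A (\<lambda>k. z) = (- t) * (\<Sum>m<p. P y m)"
    by (rule expand) (simp add: zj d_def algebra_simps)
  define K where "K = C * ?r * ((vnorm N d)\<^sup>2 * ?r ^ (p - 2))"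
  have K: "0 \<le> K" using C by (simp add: K_def)
  have diff: "\<bar>P x m - P y m\<bar> \<le> real p * K" if m: "m < p" for m
  proof -
    let ?c = "\<lambda>k. if k < m then z else d"
    \<comment> \<open>For i > m the vector d occupies the slots m and i; every other slot holds x,
      y, z or d, and those below p and different from m and i hold vectors of norm at most sqrt
      N.\<close>
    define Q where "Q i k = (if k < Suc m then ?c k else if k < i then y else if k = i then (\<lambda>j. x j - y j) else x)" for i k
    have P: "P u m = ?A (\<lambda>k. if k < Suc m then ?c k else u)" for u
      unfolding P_def by (intro multilinear_form_cong) (auto simp: less_Suc_eq)
    have "P x m - P y m = (\<Sum>i=Suc m..<p. ?A (Q i))"
      unfolding P Q_def[abs_def] using m by (intro multilinear_form_telescope) simp
    also have "\<bar>\<dots>\<bar> \<le> (\<Sum>i=Suc m..<p. \<bar>?A (Q i)\<bar>)" by (rule sum_abs)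
    also have "\<dots> \<le> (\<Sum>i=Suc m..<p. K)"
    proof (rule sum_mono)
      fix i assume i: "i \<in> {Suc m..<p}"
      have Q: "Q i m = d" "Q i i = d" using i by (auto simp: Q_def d_def)
      have Qr: "vnorm N (Q i k) \<le> ?r" if "k \<noteq> m" "k \<noteq> i" for k
        using that x y z by (auto simp: Q_def less_Suc_eq)
      have "(\<Prod>k<p. vnorm N (Q i k)) = vnorm N (Q i m) * (\<Prod>k\<in>{..<p}-{m}. vnorm N (Q i k))"
        using m by (intro prod.remove) auto
      also have "(\<Prod>k\<in>{..<p}-{m}. vnorm N (Q i k)) = vnorm N (Q i i) * (\<Prod>k\<in>{..<p}-{m}-{i}. vnorm N (Q i k))"
        using i by (intro prod.remove) auto
      also have "vnorm N (Q i m) * (vnorm N (Q i i) * (\<Prod>k\<in>{..<p}-{m}-{i}. vnorm N (Q i k)))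
          \<le> vnorm N d * (vnorm N d * (\<Prod>k\<in>{..<p}-{m}-{i}. ?r))"
        unfolding Q by (intro mult_left_mono prod_mono conjI Qr) auto
      also have "(\<Prod>k\<in>{..<p}-{m}-{i}. ?r) = ?r ^ (p - 2)"
        using i by (simp add: card_Diff_singleton numeral_2_eq_2)
      finally have "(\<Prod>k<p. vnorm N (Q i k)) \<le> (vnorm N d)\<^sup>2 * ?r ^ (p - 2)"
        by (simp add: power2_eq_square mult_ac)
      then have "C * ?r * (\<Prod>k<p. vnorm N (Q i k)) \<le> K"
        unfolding K_def using C by (intro mult_left_mono) auto
      then show "\<bar>?A (Q i)\<bar> \<le> K"
        using multilinear_form_bound[OF N _ J, of "Q i"] p by simp
    qed
    also have "\<dots> \<le> real p * K" using K by (simp add: mult_right_mono)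
    finally show ?thesis .
  qed
  have "t * ?A (\<lambda>k. x) + (1 - t) * ?A (\<lambda>k. y) - ?A (\<lambda>k. z)
     = t * (?A (\<lambda>k. x) - ?A (\<lambda>k. z)) + (1 - t) * (?A (\<lambda>k. y) - ?A (\<lambda>k. z))" by (simp add: algebra_simps)
  also have "\<dots> = t * (1 - t) * (\<Sum>m<p. P x m - P y m)"
    unfolding ex ey by (simp add: sum_subtractf algebra_simps)
  also have "\<bar>\<dots>\<bar> \<le> t * (1 - t) * (\<Sum>m<p. real p * K)"
  proof -
    have "\<bar>\<Sum>m<p. P x m - P y m\<bar> \<le> (\<Sum>m<p. \<bar>P x m - P y m\<bar>)" by (rule sum_abs)
    also have "\<dots> \<le> (\<Sum>m<p. real p * K)" using diff by (intro sum_mono) auto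
    finally show ?thesis using t by (simp add: abs_mult mult_left_mono)
  qed
  also have "(\<Sum>m<p. real p * K) = (real p)\<^sup>2 * K" by (simp add: power2_eq_square)
  finally have A: "\<bar>t * ?A (\<lambda>k. x) + (1 - t) * ?A (\<lambda>k. y) - ?A (\<lambda>k. z)\<bar> \<le> t * (1 - t) * ((real p)\<^sup>2 * K)" .
  let ?s = "real N powr (- (real p - 1) / 2)"
  have "t * hamiltonian N p J x + (1 - t) * hamiltonian N p J y - hamiltonian N p J z
     = ?s * (t * ?A (\<lambda>k. x) + (1 - t) * ?A (\<lambda>k. y) - ?A (\<lambda>k. z))"
    unfolding hamiltonian_multilinear_form by (simp add: algebra_simps)
  also have "\<bar>\<dots>\<bar> \<le> ?s * (t * (1 - t) * ((real p)\<^sup>2 * K))"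
    using A by (simp add: abs_mult mult_left_mono)
  also have "\<dots> = t * (1 - t) * ((real p)\<^sup>2 * C * (vnorm N d)\<^sup>2) * (?s * (?r * ?r ^ (p - 2)))"
    unfolding K_def by (simp add: mult_ac)
  also have "?s * (?r * ?r ^ (p - 2)) = 1"
    unfolding powr_sqrt_power[OF N] using p N by (simp add: of_nat_diff)
  finally show ?thesis by (simp add: z_def d_def)
qed

subsection \<open>Calculus on the sphere\<close>

lemma vnorm_zero [simp]: "vnorm n (\<lambda>i. 0) = 0"
  by (simp add: L2_set_def)

lemma continuous_on_coordinate: "continuous_on S (\<lambda>x::nat \<Rightarrow> real. x i)"
  by (rule continuous_on_subset[OF continuous_on_product_coordinates]) simp

lemma coordinate_le_vdist: "i < N \<Longrightarrow> \<bar>x i - y i\<bar> \<le> vdist N x y"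
proof -
  assume "i < N"
  then have "(x i - y i)\<^sup>2 \<le> (\<Sum>j<N. (x j - y j)\<^sup>2)" by (intro member_le_sum) auto
  then have "sqrt ((x i - y i)\<^sup>2) \<le> vdist N x y" unfolding L2_set_def by (rule real_sqrt_le_mono)
  then show ?thesis by simp
qed

lemma vdist_commute: "vdist N x y = vdist N y x"
  by (simp add: L2_set_def power2_commute)

lemma spin_sphere_vnorm: "\<sigma> \<in> spin_sphere N \<Longrightarrow> vnorm N \<sigma> = sqrt (real N)"
  by (simp add: spin_sphere_def L2_set_def)

lemma compact_spin_sphere: "compact (spin_sphere N)"
proof -
  \<comment> \<open>Coordinates from N on are confined to the point \<open>undefined\<close>, so
    this is a product of compact sets.\<close>
  let ?K = "\<Pi>\<^sub>E i\<in>UNIV. (if i < N then {- sqrt (real N)..sqrt (real N)} else {undefined})"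
  have "compactin (product_topology (\<lambda>i. euclidean) UNIV) ?K"
    by (subst compactin_PiE) auto
  then have K: "compact ?K" by (simp add: euclidean_product_topology)
  have "spin_sphere N = ?K \<inter> {\<sigma>. (\<Sum>i<N. (\<sigma> i)\<^sup>2) = real N}"
  proof (intro subset_antisym subsetI)
    fix \<sigma> assume \<sigma>: "\<sigma> \<in> spin_sphere N"
    have "\<bar>\<sigma> i\<bar> \<le> sqrt (real N)" if "i < N" for i
      using coordinate_le_vdist[OF that, of \<sigma> "\<lambda>_. 0"] spin_sphere_vnorm[OF \<sigma>] by simp
    then show "\<sigma> \<in> ?K \<inter> {\<sigma>. (\<Sum>i<N. (\<sigma> i)\<^sup>2) = real N}"
      using \<sigma> by (auto simp: spin_sphere_def PiE_iff extensional_def abs_le_iff minus_le_iff)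
  next
    fix \<sigma> assume "\<sigma> \<in> ?K \<inter> {\<sigma>. (\<Sum>i<N. (\<sigma> i)\<^sup>2) = real N}"
    then show "\<sigma> \<in> spin_sphere N"
      by (auto simp: spin_sphere_def PiE_iff extensional_def split: if_splits)
  qed
  moreover have "closed {\<sigma>::nat \<Rightarrow> real. (\<Sum>i<N. (\<sigma> i)\<^sup>2) = real N}"
    by (intro closed_Collect_eq continuous_intros continuous_on_coordinate)
  ultimately show ?thesis using K by (simp add: compact_Int_closed)
qed

definition sphere_sigma :: "nat \<Rightarrow> (nat \<Rightarrow> real) measure" where
  "sphere_sigma N = restrict_space (\<Pi>\<^sub>M i\<in>{..<N}. borel) (spin_sphere N)"

lemma continuous_on_sphere_measurable:
  fixes g :: "(nat \<Rightarrow> real) \<Rightarrow> real"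
  assumes "continuous_on (spin_sphere N) g"
  shows "g \<in> borel_measurable (sphere_sigma N)"
proof -
  have "(\<lambda>x. x) \<in> sphere_sigma N \<rightarrow>\<^sub>M restrict_space borel (spin_sphere N)"
    unfolding sphere_sigma_def
    by (rule measurable_restrict_space2, simp add: space_restrict_space, rule measurable_restrict_space1, rule measurable_vectors_borel)
  moreover have "g \<in> borel_measurable (restrict_space borel (spin_sphere N))"
    using assms by (rule borel_measurable_continuous_on_restrict)
  ultimately show ?thesis by (rule measurable_compose)
qed

text \<open>Vectors agree from coordinate N on, so a basic open set of the product topology
  constrains only N coordinates, and \<open>vdist\<close> dominates each of them.\<close>

lemma openin_vectors_ball:
  assumes "openin (top_of_set (euclidean_vectors N)) U" "\<sigma> \<in> U"
  shows "\<exists>r>0. \<forall>x\<in>euclidean_vectors N. vdist N x \<sigma> < r \<longrightarrow> x \<in> U"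
proof -
  obtain T where T: "open T" "U = euclidean_vectors N \<inter> T" using assms(1) by (auto simp: openin_open)
  have "openin (product_topology (\<lambda>i. euclidean) UNIV) T"
    using T(1) by (simp add: euclidean_product_topology)
  from product_topology_open_contains_basis[OF this, of \<sigma>] assms T
  obtain X where X: "\<sigma> \<in> (\<Pi>\<^sub>E i\<in>UNIV. X i)" "\<And>i. open (X i)" "(\<Pi>\<^sub>E i\<in>UNIV. X i) \<subseteq> T" by auto
  have "\<exists>e>0. \<forall>t. dist t (\<sigma> i) < e \<longrightarrow> t \<in> X i" for i
    using X(1,2) by (auto simp: open_dist)
  then obtain e where e: "\<And>i. 0 < e i" "\<And>i t. dist t (\<sigma> i) < e i \<Longrightarrow> t \<in> X i" by metis
  define r where "r = Min (insert 1 (e ` {..<N}))"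
  have r: "0 < r" unfolding r_def using e(1) by (subst Min_gr_iff) auto
  have re: "r \<le> e i" if "i < N" for i unfolding r_def using that by (intro Min_le) auto
  show ?thesis
  proof (intro exI[of _ r] conjI r ballI impI)
    fix x assume x: "x \<in> euclidean_vectors N" "vdist N x \<sigma> < r"
    have "x i \<in> X i" for i
    proof (cases "i < N")
      case True
      then show ?thesis using coordinate_le_vdist[OF True, of x \<sigma>] x(2) re[OF True] e(2)[of "x i" i] by (simp add: dist_real_def)
    next
      case False
      have "x i = \<sigma> i" using False x(1) assms(2) T(2) by (auto simp: PiE_iff extensional_def)
      then show ?thesis using e(2)[of "\<sigma> i" i] e(1) by simp
    qed
    then show "x \<in> U" using X(3) T(2) x(1) by auto
  qed
qed

lemma continuous_on_openin_ball:
  fixes g :: "(nat \<Rightarrow> real) \<Rightarrow> real"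
  assumes U: "openin (top_of_set (euclidean_vectors N)) U" "\<sigma> \<in> U" and g: "continuous_on U g" and e: "0 < e"
  shows "\<exists>r>0. \<forall>x\<in>euclidean_vectors N. vdist N x \<sigma> < r \<longrightarrow> x \<in> U \<and> \<bar>g x - g \<sigma>\<bar> < e"
proof -
  have "openin (top_of_set U) (U \<inter> g -` ball (g \<sigma>) e)" using g by (rule continuous_openin_preimage_gen) simp
  then have "openin (top_of_set (euclidean_vectors N)) (U \<inter> g -` ball (g \<sigma>) e)" using U(1) by (rule openin_trans)
  from openin_vectors_ball[OF this, of \<sigma>] U(2) e
  obtain r where "0 < r" "\<And>x. x \<in> euclidean_vectors N \<Longrightarrow> vdist N x \<sigma> < r \<Longrightarrow> x \<in> U \<inter> g -` ball (g \<sigma>) e" by auto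
  then show ?thesis by (intro exI[of _ r]) (auto simp: dist_real_def abs_minus_commute)
qed

section \<open>Gradients, local slopes and Lipschitz bounds from a smooth extension\<close>

locale sphere_extension =
  fixes N :: nat and f F :: "(nat \<Rightarrow> real) \<Rightarrow> real" and U :: "(nat \<Rightarrow> real) set"
  assumes N: "0 < N"
    and U: "openin (top_of_set (euclidean_vectors N)) U" and SU: "spin_sphere N \<subseteq> U"
    and smooth: "C_infinity_on N U F" and fF: "\<And>\<sigma>. \<sigma> \<in> spin_sphere N \<Longrightarrow> f \<sigma> = F \<sigma>"
begin

abbreviation dF :: "nat \<Rightarrow> (nat \<Rightarrow> real) \<Rightarrow> real" where
  "dF i \<equiv> partial_derivative i F"

lemma cont_F: "continuous_on U F"
  using smooth unfolding C_infinity_on_def by (elim allE[of _ "[]"]) simp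

lemma cont_dF: "i < N \<Longrightarrow> continuous_on U (dF i)"
  using smooth unfolding C_infinity_on_def by (elim allE[of _ "[i]"]) simp

lemma deriv_F:
  assumes "i < N" "x \<in> U"
  shows "((\<lambda>t. F (x(i := t))) has_real_derivative dF i x) (at (x i))"
proof -
  have "(\<lambda>t. F (x(i := t))) field_differentiable at (x i)"
    using smooth assms unfolding C_infinity_on_def by (elim allE[of _ "[]"]) simp
  then show ?thesis by (simp add: partial_derivative_def field_differentiable_derivI)
qed

lemma partial_derivatives_near:
  assumes \<sigma>: "\<sigma> \<in> U" and e: "0 < e"
  shows "\<exists>r>0. \<forall>x\<in>euclidean_vectors N. vdist N x \<sigma> < r \<longrightarrow> x \<in> U \<and> (\<forall>i<N. \<bar>dF i x - dF i \<sigma>\<bar> < e)"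
proof -
  define Q where "Q i r \<longleftrightarrow> (\<forall>x\<in>euclidean_vectors N. vdist N x \<sigma> < r \<longrightarrow> x \<in> U \<and> (i < N \<longrightarrow> \<bar>dF i x - dF i \<sigma>\<bar> < e))" for i r
  have "\<exists>r>0. Q i r" for i
  proof (cases "i < N")
    case True
    from continuous_on_openin_ball[OF U \<sigma> cont_dF[OF True] e] show ?thesis using True by (simp add: Q_def)
  next
    case False
    from openin_vectors_ball[OF U \<sigma>] show ?thesis using False by (simp add: Q_def)
  qed
  then obtain r where r0: "\<And>i. 0 < r i" "\<And>i. Q i (r i)" by metis
  then have r: "\<And>i. 0 < r i" "\<And>i x. x \<in> euclidean_vectors N \<Longrightarrow> vdist N x \<sigma> < r i \<Longrightarrow>
      x \<in> U \<and> (i < N \<longrightarrow> \<bar>dF i x - dF i \<sigma>\<bar> < e)" by (simp_all add: Q_def)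
  define s where "s = Min (r ` {..<N})"
  have ne: "{..<N} \<noteq> {}" using N by auto
  have s: "0 < s" unfolding s_def using r(1) ne by (subst Min_gr_iff) auto
  have sr: "s \<le> r i" if "i < N" for i unfolding s_def using that by (intro Min_le) auto
  show ?thesis
  proof (intro exI[of _ s] conjI s ballI impI)
    fix x assume x: "x \<in> euclidean_vectors N" "vdist N x \<sigma> < s"
    have *: "x \<in> U \<and> \<bar>dF i x - dF i \<sigma>\<bar> < e" if "i < N" for i
      using r(2)[OF x(1), of i] x(2) sr[OF that] that by linarith
    then show "x \<in> U" using N by blast
    show "\<forall>i<N. \<bar>dF i x - dF i \<sigma>\<bar> < e" using * by blast
  qed
qed

text \<open>Strict differentiability: both points vary near \<sigma>, as the Lipschitz bound on the
  sphere requires. The coordinates of x are changed to those of y one at a time, each change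
  controlled by the mean value theorem and the continuity of one partial derivative.\<close>

lemma linear_approximation:
  assumes \<sigma>: "\<sigma> \<in> U" and e: "0 < e"
  shows "\<exists>r>0. \<forall>x\<in>euclidean_vectors N. \<forall>y\<in>euclidean_vectors N. vdist N x \<sigma> < r \<longrightarrow> vdist N y \<sigma> < r \<longrightarrow>
    \<bar>F x - F y - (\<Sum>i<N. dF i \<sigma> * (x i - y i))\<bar> \<le> e * (\<Sum>i<N. \<bar>x i - y i\<bar>)"
proof -
  obtain r where r: "0 < r" "\<And>x. x \<in> euclidean_vectors N \<Longrightarrow> vdist N x \<sigma> < r \<Longrightarrow> x \<in> U \<and> (\<forall>i<N. \<bar>dF i x - dF i \<sigma>\<bar> < e)"
    using partial_derivatives_near[OF assms] by blast
  \<comment> \<open>The intermediate points mix coordinates of x and y; the box of half side r / N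
    around \<sigma> contains them and lies in the ball of radius r.\<close>
  define s where "s = r / (real N)"
  have s: "0 < s" using r N by (simp add: s_def)
  have box: "z \<in> U \<and> (\<forall>i<N. \<bar>dF i z - dF i \<sigma>\<bar> < e)"
    if "z \<in> euclidean_vectors N" "\<And>i. i < N \<Longrightarrow> \<bar>z i - \<sigma> i\<bar> < s" for z
  proof (rule r(2)[OF that(1)])
    have "vdist N z \<sigma> \<le> (\<Sum>i<N. \<bar>z i - \<sigma> i\<bar>)" by (rule L2_set_le_sum_abs)
    also have "\<dots> < (\<Sum>i<N. s)" using that(2) N by (intro sum_strict_mono) auto
    also have "\<dots> = r" using N by (simp add: s_def)
    finally show "vdist N z \<sigma> < r" .
  qed
  show ?thesis
  proof (intro exI[of _ s] conjI s ballI impI)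
    fix x y assume x: "x \<in> euclidean_vectors N" "vdist N x \<sigma> < s" and y: "y \<in> euclidean_vectors N" "vdist N y \<sigma> < s"
    have xs: "\<bar>x i - \<sigma> i\<bar> < s" if "i < N" for i using coordinate_le_vdist[OF that, of x \<sigma>] x(2) by linarith
    have ys: "\<bar>y i - \<sigma> i\<bar> < s" if "i < N" for i using coordinate_le_vdist[OF that, of y \<sigma>] y(2) by linarith
    define T where "T m i = (if i < m then y i else x i)" for m i
    have step: "\<bar>F (T m) - F (T (Suc m)) - dF m \<sigma> * (x m - y m)\<bar> \<le> e * \<bar>x m - y m\<bar>" if m: "m < N" for m
    proof -
      define g where "g t = F ((T m)(m := t))" for t
      have Tx: "(T m)(m := x m) = T m" and Ty: "(T m)(m := y m) = T (Suc m)"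
        by (auto simp: T_def fun_eq_iff less_Suc_eq)
      have near: "(T m)(m := t) \<in> U \<and> (\<forall>i<N. \<bar>dF i ((T m)(m := t)) - dF i \<sigma>\<bar> < e)" if "\<bar>t - \<sigma> m\<bar> < s" for t
      proof (rule box)
        show "(T m)(m := t) \<in> euclidean_vectors N"
          using x(1) y(1) m by (auto simp: T_def PiE_iff extensional_def)
        show "\<bar>((T m)(m := t)) i - \<sigma> i\<bar> < s" if "i < N" for i
          using xs[OF that] ys[OF that] \<open>\<bar>t - \<sigma> m\<bar> < s\<close> by (auto simp: T_def)
      qed
      have der: "(g has_real_derivative dF m ((T m)(m := t))) (at t)" if "\<bar>t - \<sigma> m\<bar> < s" for t
        using deriv_F[OF m conjunct1[OF near[OF that]]] by (simp add: g_def[abs_def])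
      have mvt: "\<exists>\<xi>. \<bar>\<xi> - \<sigma> m\<bar> < s \<and> g b - g a = (b - a) * dF m ((T m)(m := \<xi>))"
        if "a < b" "\<bar>a - \<sigma> m\<bar> < s" "\<bar>b - \<sigma> m\<bar> < s" for a b
      proof -
        have "\<exists>\<xi>. a < \<xi> \<and> \<xi> < b \<and> g b - g a = (b - a) * dF m ((T m)(m := \<xi>))"
          using that by (intro MVT2) (auto intro!: der)
        then obtain \<xi> where \<xi>: "a < \<xi>" "\<xi> < b" "g b - g a = (b - a) * dF m ((T m)(m := \<xi>))" by blast
        then show ?thesis using that by (intro exI[of _ \<xi>]) (auto simp: abs_less_iff)
      qed
      have "\<exists>\<xi>. \<bar>\<xi> - \<sigma> m\<bar> < s \<and> g (x m) - g (y m) = (x m - y m) * dF m ((T m)(m := \<xi>))"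
      proof (cases "x m" "y m" rule: linorder_cases)
        case less
        from mvt[OF less xs[OF m] ys[OF m]] show ?thesis by (metis minus_diff_eq mult_minus_left)
      next
        case equal
        then show ?thesis using xs[OF m] by (intro exI[of _ "x m"]) auto
      next
        case greater
        from mvt[OF greater ys[OF m] xs[OF m]] show ?thesis .
      qed
      then obtain \<xi> where \<xi>: "\<bar>\<xi> - \<sigma> m\<bar> < s" "g (x m) - g (y m) = (x m - y m) * dF m ((T m)(m := \<xi>))" by blast
      have "F (T m) - F (T (Suc m)) - dF m \<sigma> * (x m - y m) = (dF m ((T m)(m := \<xi>)) - dF m \<sigma>) * (x m - y m)"
        using \<xi>(2) unfolding g_def Tx Ty by (simp add: algebra_simps)
      also have "\<bar>\<dots>\<bar> \<le> e * \<bar>x m - y m\<bar>"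
        unfolding abs_mult using near[OF \<xi>(1)] m by (intro mult_right_mono) auto
      finally show ?thesis .
    qed
    have T0: "T 0 = x" by (simp add: T_def fun_eq_iff)
    have TN: "T N = y" using x(1) y(1) by (auto simp: T_def fun_eq_iff PiE_iff extensional_def)
    have "F x - F y = (\<Sum>m<N. F (T m) - F (T (Suc m)))"
      using sum_lessThan_telescope'[of "\<lambda>m. F (T m)" N] T0 TN by simp
    then have "F x - F y - (\<Sum>i<N. dF i \<sigma> * (x i - y i)) = (\<Sum>m<N. F (T m) - F (T (Suc m)) - dF m \<sigma> * (x m - y m))"
      by (simp add: sum_subtractf)
    also have "\<bar>\<dots>\<bar> \<le> (\<Sum>m<N. \<bar>F (T m) - F (T (Suc m)) - dF m \<sigma> * (x m - y m)\<bar>)" by (rule sum_abs)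
    also have "\<dots> \<le> (\<Sum>m<N. e * \<bar>x m - y m\<bar>)" using step by (intro sum_mono) auto
    finally show "\<bar>F x - F y - (\<Sum>i<N. dF i \<sigma> * (x i - y i))\<bar> \<le> e * (\<Sum>i<N. \<bar>x i - y i\<bar>)"
      by (simp add: sum_distrib_left)
  qed
qed

text \<open>The vector of partial derivatives of F minus its normal part; \<sigma> has squared
  length N, whence the division by N.\<close>

definition grad :: "(nat \<Rightarrow> real) \<Rightarrow> nat \<Rightarrow> real" where
  "grad \<sigma> = (\<lambda>i\<in>{..<N}. dF i \<sigma> - (\<Sum>j<N. dF j \<sigma> * \<sigma> j) / real N * \<sigma> i)"

lemma grad_tangent:
  assumes "\<sigma> \<in> spin_sphere N"
  shows "grad \<sigma> \<in> tangent_space N \<sigma>"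
proof -
  let ?c = "(\<Sum>j<N. dF j \<sigma> * \<sigma> j) / real N"
  have "(\<Sum>i<N. \<sigma> i * grad \<sigma> i) = (\<Sum>i<N. dF i \<sigma> * \<sigma> i - ?c * (\<sigma> i)\<^sup>2)"
    by (intro sum.cong) (auto simp: grad_def algebra_simps power2_eq_square)
  also have "\<dots> = (\<Sum>i<N. dF i \<sigma> * \<sigma> i) - ?c * (\<Sum>i<N. (\<sigma> i)\<^sup>2)"
    by (simp add: sum_subtractf sum_distrib_left)
  also have "\<dots> = 0" using assms N by (simp add: spin_sphere_def)
  finally show ?thesis by (auto simp: tangent_space_def grad_def)
qed

lemma grad_inner:
  shows "(\<Sum>i<N. dF i \<sigma> * w i) = induced_metric N (grad \<sigma>) w + (\<Sum>j<N. dF j \<sigma> * \<sigma> j) / real N * (\<Sum>i<N. \<sigma> i * w i)"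
proof -
  have "induced_metric N (grad \<sigma>) w = (\<Sum>i<N. dF i \<sigma> * w i - (\<Sum>j<N. dF j \<sigma> * \<sigma> j) / real N * (\<sigma> i * w i))"
    unfolding induced_metric_def by (intro sum.cong) (auto simp: grad_def algebra_simps)
  then show ?thesis by (simp add: sum_subtractf sum_distrib_left)
qed

lemma curve_derivative:
  assumes \<gamma>: "\<And>t. \<gamma> t \<in> spin_sphere N" "\<gamma> 0 = \<sigma>"
    and w: "\<And>i. i < N \<Longrightarrow> ((\<lambda>t. \<gamma> t i) has_real_derivative w i) (at 0)"
  shows "((\<lambda>t. f (\<gamma> t)) has_real_derivative induced_metric N (grad \<sigma>) w) (at 0)"
proof -
  have \<sigma>: "\<sigma> \<in> spin_sphere N" using \<gamma> by metis
  have "((\<lambda>t. \<Sum>i<N. (\<gamma> t i)\<^sup>2) has_real_derivative (\<Sum>i<N. 2 * (\<sigma> i * w i))) (at 0)"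
    by (rule DERIV_sum) (auto intro!: derivative_eq_intros w simp: \<gamma>(2))
  moreover have "(\<lambda>t. \<Sum>i<N. (\<gamma> t i)\<^sup>2) = (\<lambda>t. real N)" using \<gamma>(1) by (simp add: spin_sphere_def)
  ultimately have "(\<Sum>i<N. 2 * (\<sigma> i * w i)) = 0" by (metis DERIV_const DERIV_unique)
  then have tang: "(\<Sum>i<N. \<sigma> i * w i) = 0" by (simp add: sum_distrib_left[symmetric])
  let ?q = "\<lambda>t i. (\<gamma> t i - \<sigma> i) / t"
  have q: "((\<lambda>t. ?q t i) \<longlongrightarrow> w i) (at 0)" if "i < N" for i
    using w[OF that] \<gamma>(2) by (simp add: has_field_derivative_iff)
  have lin: "((\<lambda>t. \<Sum>i<N. dF i \<sigma> * ?q t i) \<longlongrightarrow> (\<Sum>i<N. dF i \<sigma> * w i)) (at 0)"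
    by (intro tendsto_intros q) auto
  have abs: "((\<lambda>t. \<Sum>i<N. \<bar>?q t i\<bar>) \<longlongrightarrow> (\<Sum>i<N. \<bar>w i\<bar>)) (at 0)"
    by (intro tendsto_intros q) auto
  \<comment> \<open>\<open>K\<close> bounds the sum of the absolute difference quotients of the
    curve near 0, so a linearisation error of e / K per unit length suffices.\<close>
  define K where "K = (\<Sum>i<N. \<bar>w i\<bar>) + 1"
  have K: "0 < K" unfolding K_def by (intro add_nonneg_pos sum_nonneg) auto
  have evK: "\<forall>\<^sub>F t in at 0. (\<Sum>i<N. \<bar>?q t i\<bar>) < K"
    using abs by (rule order_tendstoD) (simp add: K_def)
  have near: "((\<lambda>t. vdist N (\<gamma> t) \<sigma>) \<longlongrightarrow> 0) (at 0)"
  proof -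
    have c: "((\<lambda>t. \<gamma> t i) \<longlongrightarrow> \<sigma> i) (at 0)" if "i < N" for i
      using DERIV_isCont[OF w[OF that]] \<gamma>(2) by (simp add: isCont_def)
    have "((\<lambda>t. sqrt (\<Sum>i<N. (\<gamma> t i - \<sigma> i)\<^sup>2)) \<longlongrightarrow> sqrt (\<Sum>i<N. (\<sigma> i - \<sigma> i)\<^sup>2)) (at 0)"
      by (intro tendsto_intros c) auto
    then show ?thesis by (simp add: L2_set_def)
  qed
  have rem: "((\<lambda>t. (f (\<gamma> t) - f \<sigma>) / t - (\<Sum>i<N. dF i \<sigma> * ?q t i)) \<longlongrightarrow> 0) (at 0)"
  proof (rule tendstoI)
    fix e :: real assume e: "0 < e"
    obtain r where r: "0 < r" "\<And>x y. x \<in> euclidean_vectors N \<Longrightarrow> y \<in> euclidean_vectors N \<Longrightarrow> vdist N x \<sigma> < r \<Longrightarrow> vdist N y \<sigma> < r \<Longrightarrow>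
      \<bar>F x - F y - (\<Sum>i<N. dF i \<sigma> * (x i - y i))\<bar> \<le> e / K * (\<Sum>i<N. \<bar>x i - y i\<bar>)"
      using linear_approximation[OF subsetD[OF SU \<sigma>] divide_pos_pos[OF e K]] by auto
    have "\<forall>\<^sub>F t in at 0. vdist N (\<gamma> t) \<sigma> < r" using near r(1) by (rule order_tendstoD)
    moreover have "\<forall>\<^sub>F t in at (0::real). t \<noteq> 0" by (simp add: eventually_at_filter)
    ultimately show "\<forall>\<^sub>F t in at 0. dist ((f (\<gamma> t) - f \<sigma>) / t - (\<Sum>i<N. dF i \<sigma> * ?q t i)) 0 < e"
      using evK
    proof eventually_elim
      case (elim t)
      have E: "\<gamma> t \<in> euclidean_vectors N" "\<sigma> \<in> euclidean_vectors N" using \<gamma>(1)[of t] \<sigma> by (auto simp: spin_sphere_def)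
      have "(f (\<gamma> t) - f \<sigma>) / t - (\<Sum>i<N. dF i \<sigma> * ?q t i) = (F (\<gamma> t) - F \<sigma> - (\<Sum>i<N. dF i \<sigma> * (\<gamma> t i - \<sigma> i))) / t"
      proof -
        have "(\<Sum>i<N. dF i \<sigma> * (\<gamma> t i - \<sigma> i)) / t = (\<Sum>i<N. dF i \<sigma> * ?q t i)"
          unfolding sum_divide_distrib by (intro sum.cong refl) simp
        then show ?thesis using fF[OF \<gamma>(1)[of t]] fF[OF \<sigma>] by (simp only: diff_divide_distrib)
      qed
      also have "\<bar>\<dots>\<bar> \<le> e / K * (\<Sum>i<N. \<bar>\<gamma> t i - \<sigma> i\<bar>) / \<bar>t\<bar>"
        unfolding abs_divide using r(2)[OF E elim(1)] r(1) by (intro divide_right_mono) (auto simp: L2_set_def)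
      also have "\<dots> = e / K * (\<Sum>i<N. \<bar>?q t i\<bar>)"
        by (simp only: abs_divide sum_divide_distrib[symmetric] times_divide_eq_right)
      also have "\<dots> < e / K * K" using elim(3) e K by (intro mult_strict_left_mono) auto
      also have "\<dots> = e" using K by simp
      finally show ?case by (simp add: dist_real_def)
    qed
  qed
  have "((\<lambda>t. (f (\<gamma> t) - f \<sigma>) / t) \<longlongrightarrow> (\<Sum>i<N. dF i \<sigma> * w i)) (at 0)"
    using tendsto_add[OF rem lin] by simp
  then show ?thesis
    using grad_inner[of \<sigma> w] tang \<gamma>(2) by (simp add: has_field_derivative_iff)
qed

lemma sphere_gradient_eq:
  assumes \<sigma>: "\<sigma> \<in> spin_sphere N"
  shows "sphere_gradient N f \<sigma> = grad \<sigma>"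
  unfolding sphere_gradient_def
proof (rule the_equality)
  show "grad \<sigma> \<in> tangent_space N \<sigma> \<and> (\<forall>\<gamma> w. (\<forall>t. \<gamma> t \<in> spin_sphere N) \<and> \<gamma> 0 = \<sigma> \<and>
      (\<forall>i<N. ((\<lambda>t. \<gamma> t i) has_real_derivative w i) (at 0)) \<longrightarrow>
      ((\<lambda>t. f (\<gamma> t)) has_real_derivative induced_metric N (grad \<sigma>) w) (at 0))"
    using grad_tangent[OF \<sigma>] curve_derivative by blast
next
  fix v assume v: "v \<in> tangent_space N \<sigma> \<and> (\<forall>\<gamma> w. (\<forall>t. \<gamma> t \<in> spin_sphere N) \<and> \<gamma> 0 = \<sigma> \<and>
      (\<forall>i<N. ((\<lambda>t. \<gamma> t i) has_real_derivative w i) (at 0)) \<longrightarrow>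
      ((\<lambda>t. f (\<gamma> t)) has_real_derivative induced_metric N v w) (at 0))"
  \<comment> \<open>Uniqueness is tested on a curve with velocity w = v - grad, namely \<sigma> + t
    w rescaled to the sphere. As w is orthogonal to \<sigma>, the scaling factor sqrt (1 + t^2 q)
    has derivative 0 at t = 0. Both vectors yield the derivative of f along this curve, hence |w|^2
    = 0.\<close>
  define w where "w i = v i - grad \<sigma> i" for i
  have \<sigma>w: "(\<Sum>i<N. \<sigma> i * w i) = 0"
    using v grad_tangent[OF \<sigma>] by (simp add: w_def tangent_space_def right_diff_distrib sum_subtractf)
  have \<sigma>2: "(\<Sum>i<N. (\<sigma> i)\<^sup>2) = real N" using \<sigma> by (simp add: spin_sphere_def)
  define q where "q = (\<Sum>i<N. (w i)\<^sup>2) / real N"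
  have q0: "0 \<le> q" by (simp add: q_def sum_nonneg)
  define D where "D t = sqrt (1 + t\<^sup>2 * q)" for t
  have pos: "0 < 1 + t\<^sup>2 * q" for t using q0 by (simp add: add_pos_nonneg)
  define \<gamma> where "\<gamma> t = (\<lambda>i\<in>{..<N}. (\<sigma> i + t * w i) / D t)" for t
  have "\<gamma> t \<in> spin_sphere N" for t
  proof -
    have "(\<Sum>i<N. (\<gamma> t i)\<^sup>2) = (\<Sum>i<N. (\<sigma> i + t * w i)\<^sup>2) / (D t)\<^sup>2"
      by (simp add: \<gamma>_def power_divide sum_divide_distrib)
    also have "(\<Sum>i<N. (\<sigma> i + t * w i)\<^sup>2) = (\<Sum>i<N. (\<sigma> i)\<^sup>2 + 2 * t * (\<sigma> i * w i) + t\<^sup>2 * (w i)\<^sup>2)"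
      by (intro sum.cong refl) (simp add: power2_eq_square algebra_simps)
    also have "\<dots> = (\<Sum>i<N. (\<sigma> i)\<^sup>2) + 2 * t * (\<Sum>i<N. \<sigma> i * w i) + t\<^sup>2 * (\<Sum>i<N. (w i)\<^sup>2)"
      by (simp only: sum.distrib sum_distrib_left)
    also have "\<dots> = real N * (1 + t\<^sup>2 * q)"
      unfolding \<sigma>2 \<sigma>w using N by (simp add: q_def field_simps)
    also have "(D t)\<^sup>2 = 1 + t\<^sup>2 * q" unfolding D_def using pos[of t] by (intro real_sqrt_pow2) simp
    finally have "(\<Sum>i<N. (\<gamma> t i)\<^sup>2) = real N" using pos[of t] by simp
    then show ?thesis by (auto simp: spin_sphere_def \<gamma>_def)
  qed
  moreover have "\<gamma> 0 = \<sigma>"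
    using \<sigma> by (auto simp: \<gamma>_def D_def spin_sphere_def PiE_iff extensional_def fun_eq_iff)
  moreover have "((\<lambda>t. \<gamma> t i) has_real_derivative w i) (at 0)" if "i < N" for i
  proof -
    have "((\<lambda>t. (\<sigma> i + t * w i) / sqrt (1 + t\<^sup>2 * q)) has_real_derivative w i) (at 0)"
      by (auto intro!: derivative_eq_intros)
    then show ?thesis using that by (simp add: \<gamma>_def D_def)
  qed
  ultimately have "((\<lambda>t. f (\<gamma> t)) has_real_derivative induced_metric N v w) (at 0)"
    "((\<lambda>t. f (\<gamma> t)) has_real_derivative induced_metric N (grad \<sigma>) w) (at 0)"
    using v curve_derivative by blast+
  then have "induced_metric N v w = induced_metric N (grad \<sigma>) w" by (rule DERIV_unique)
  then have "(\<Sum>i<N. (w i)\<^sup>2) = 0"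
    by (simp add: induced_metric_def w_def power2_eq_square left_diff_distrib sum_subtractf)
  then have "w i = 0" if "i < N" for i using that by (simp add: sum_nonneg_eq_0_iff)
  then show "v = grad \<sigma>"
    using v by (auto simp: w_def fun_eq_iff grad_def tangent_space_def PiE_iff extensional_def)
qed

lemma continuous_on_f: "continuous_on (spin_sphere N) f"
  using continuous_on_subset[OF cont_F SU] fF by (simp cong: continuous_on_cong)

definition grad_sq :: "(nat \<Rightarrow> real) \<Rightarrow> real" where
  "grad_sq \<sigma> = induced_metric N (sphere_gradient N f \<sigma>) (sphere_gradient N f \<sigma>)"

lemma grad_sq_nonneg: "0 \<le> grad_sq \<sigma>"
  by (auto simp: grad_sq_def induced_metric_def intro!: sum_nonneg)

lemma continuous_on_grad_sq: "continuous_on (spin_sphere N) grad_sq"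
proof -
  have "continuous_on (spin_sphere N) (\<lambda>\<sigma>. \<Sum>i<N. (dF i \<sigma> - (\<Sum>j<N. dF j \<sigma> * \<sigma> j) / real N * \<sigma> i)\<^sup>2)"
    using N by (intro continuous_intros continuous_on_coordinate continuous_on_subset[OF cont_dF SU]) auto
  then show ?thesis
    by (rule continuous_on_eq) (simp add: grad_sq_def sphere_gradient_eq induced_metric_def grad_def power2_eq_square)
qed

lemma f_bounded: "\<exists>M. \<forall>\<sigma>\<in>spin_sphere N. \<bar>f \<sigma>\<bar> \<le> M"
  using compact_imp_bounded[OF compact_continuous_image[OF continuous_on_f compact_spin_sphere]]
  by (auto simp: bounded_iff)

lemma grad_sq_bounded: "\<exists>M. \<forall>\<sigma>\<in>spin_sphere N. grad_sq \<sigma> \<le> M"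
  using compact_imp_bounded[OF compact_continuous_image[OF continuous_on_grad_sq compact_spin_sphere]]
  by (auto simp: bounded_iff dest: abs_le_D1)

text \<open>A chord u = x - \<sigma> of the sphere satisfies <\<sigma>, u> = - |u|^2 / 2, so the
  normal part of the derivative of F contributes only to second order and is absorbed in \<eta>; the
  slope is that of the tangential gradient.\<close>

lemma local_slope:
  assumes \<sigma>: "\<sigma> \<in> spin_sphere N" and \<eta>: "0 < \<eta>"
  shows "\<exists>\<delta>>0. \<forall>x\<in>spin_sphere N. vdist N x \<sigma> < \<delta> \<longrightarrow> \<bar>f x - f \<sigma>\<bar> \<le> (sqrt (grad_sq \<sigma>) + \<eta>) * vdist N x \<sigma>"
proof -
  define e where "e = \<eta> / (2 * real N)"
  have e: "0 < e" using \<eta> N by (simp add: e_def)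
  define c where "c = (\<Sum>j<N. dF j \<sigma> * \<sigma> j) / real N"
  obtain r where r: "0 < r" "\<And>x y. x \<in> euclidean_vectors N \<Longrightarrow> y \<in> euclidean_vectors N \<Longrightarrow> vdist N x \<sigma> < r \<Longrightarrow> vdist N y \<sigma> < r \<Longrightarrow>
      \<bar>F x - F y - (\<Sum>i<N. dF i \<sigma> * (x i - y i))\<bar> \<le> e * (\<Sum>i<N. \<bar>x i - y i\<bar>)"
    using linear_approximation[OF subsetD[OF SU \<sigma>] e] by auto
  define \<delta> where "\<delta> = min r (\<eta> / (\<bar>c\<bar> + 1))"
  have \<delta>: "0 < \<delta>" using r \<eta> by (auto simp: \<delta>_def intro!: divide_pos_pos)
  show ?thesis
  proof (intro exI[of _ \<delta>] conjI \<delta> ballI impI)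
    fix x assume x: "x \<in> spin_sphere N" "vdist N x \<sigma> < \<delta>"
    let ?d = "vdist N x \<sigma>" and ?u = "\<lambda>i. x i - \<sigma> i"
    have E: "x \<in> euclidean_vectors N" "\<sigma> \<in> euclidean_vectors N" using x(1) \<sigma> by (auto simp: spin_sphere_def)
    have "\<bar>F x - F \<sigma> - (\<Sum>i<N. dF i \<sigma> * ?u i)\<bar> \<le> e * (\<Sum>i<N. \<bar>?u i\<bar>)"
      using r(2)[OF E] x(2) r(1) by (simp add: \<delta>_def)
    also have "\<dots> \<le> e * (\<Sum>i<N. ?d)"
      using e by (intro mult_left_mono sum_mono) (auto intro: coordinate_le_vdist)
    also have "\<dots> = \<eta> / 2 * ?d" using N by (simp add: e_def)
    finally have 1: "\<bar>F x - F \<sigma> - (\<Sum>i<N. dF i \<sigma> * ?u i)\<bar> \<le> \<eta> / 2 * ?d" .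
    have "(\<Sum>i<N. \<sigma> i * ?u i) = - (?d\<^sup>2 / 2)"
    proof -
      have "?d\<^sup>2 = (\<Sum>i<N. (x i)\<^sup>2 - (\<sigma> i)\<^sup>2 - 2 * (\<sigma> i * ?u i))"
        unfolding vnorm_sq by (intro sum.cong refl) (simp add: power2_eq_square algebra_simps)
      also have "\<dots> = - 2 * (\<Sum>i<N. \<sigma> i * ?u i)"
        using x(1) \<sigma> by (simp add: sum_subtractf sum_distrib_left[symmetric] spin_sphere_def)
      finally show ?thesis by simp
    qed
    then have split: "(\<Sum>i<N. dF i \<sigma> * ?u i) = induced_metric N (grad \<sigma>) ?u - c * (?d\<^sup>2 / 2)"
      unfolding grad_inner[of \<sigma> ?u] c_def by simp
    have "\<bar>induced_metric N (grad \<sigma>) ?u\<bar> \<le> (\<Sum>i<N. \<bar>grad \<sigma> i\<bar> * \<bar>?u i\<bar>)"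
      unfolding induced_metric_def abs_mult[symmetric] by (rule sum_abs)
    also have "\<dots> \<le> vnorm N (grad \<sigma>) * ?d" by (rule L2_set_mult_ineq)
    also have "vnorm N (grad \<sigma>) = sqrt (grad_sq \<sigma>)"
      by (simp add: grad_sq_def sphere_gradient_eq[OF \<sigma>] induced_metric_def L2_set_def power2_eq_square)
    finally have 2: "\<bar>induced_metric N (grad \<sigma>) ?u\<bar> \<le> sqrt (grad_sq \<sigma>) * ?d" .
    have "\<bar>c * (?d\<^sup>2 / 2)\<bar> = (\<bar>c\<bar> * ?d) * ?d / 2" by (simp add: abs_mult power2_eq_square)
    also have "\<dots> \<le> \<eta> * ?d / 2"
    proof -
      have "?d \<le> \<eta> / (\<bar>c\<bar> + 1)" using x(2) by (simp add: \<delta>_def)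
      then have "?d * (\<bar>c\<bar> + 1) \<le> \<eta>" by (simp add: pos_le_divide_eq)
      then have "?d + \<bar>c\<bar> * ?d \<le> \<eta>" by (simp add: algebra_simps)
      moreover have "0 \<le> ?d" by (rule L2_set_nonneg)
      ultimately have "\<bar>c\<bar> * ?d \<le> \<eta>" by linarith
      then show ?thesis by (intro divide_right_mono mult_right_mono) auto
    qed
    finally have 3: "\<bar>c * (?d\<^sup>2 / 2)\<bar> \<le> \<eta> * ?d / 2" .
    have "\<bar>f x - f \<sigma>\<bar> = \<bar>F x - F \<sigma>\<bar>" using fF x(1) \<sigma> by simp
    also have "\<dots> \<le> sqrt (grad_sq \<sigma>) * ?d + \<eta> * ?d / 2 + \<eta> / 2 * ?d"
    proof -
      have "F x - F \<sigma> = (F x - F \<sigma> - (\<Sum>i<N. dF i \<sigma> * ?u i)) + (induced_metric N (grad \<sigma>) ?u - c * (?d\<^sup>2 / 2))"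
        using split by simp
      then show ?thesis using 1 2 3 by arith
    qed
    finally show "\<bar>f x - f \<sigma>\<bar> \<le> (sqrt (grad_sq \<sigma>) + \<eta>) * ?d" by (simp add: algebra_simps)
  qed
qed

text \<open>Segments between points of the sphere may leave U, so compactness is used: if no
  constant works, boundedness of f forces the bad pairs together, a subsequence converges, and
  strict differentiability at the limit gives a contradiction.\<close>

lemma f_lipschitz: "\<exists>L\<ge>0. \<forall>x\<in>spin_sphere N. \<forall>y\<in>spin_sphere N. \<bar>f x - f y\<bar> \<le> L * vdist N x y"
proof (rule ccontr)
  assume "\<not> ?thesis"
  then have "\<exists>x\<in>spin_sphere N. \<exists>y\<in>spin_sphere N. real k * vdist N x y < \<bar>f x - f y\<bar>" for k
    by (meson not_le of_nat_0_le_iff)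
  then obtain X Y where XY: "\<And>k. X k \<in> spin_sphere N" "\<And>k. Y k \<in> spin_sphere N"
    "\<And>k. real k * vdist N (X k) (Y k) < \<bar>f (X k) - f (Y k)\<bar>" by metis
  obtain M where M: "\<And>\<sigma>. \<sigma> \<in> spin_sphere N \<Longrightarrow> \<bar>f \<sigma>\<bar> \<le> M" using f_bounded by blast
  have "seq_compact (spin_sphere N)" by (rule compact_imp_seq_compact[OF compact_spin_sphere])
  then obtain x \<rho> where x: "x \<in> spin_sphere N" "strict_mono \<rho>" "(X \<circ> \<rho>) \<longlonglongrightarrow> x"
    using XY(1) unfolding seq_compact_def by metis
  have "(\<lambda>k. X (\<rho> k) i) \<longlonglongrightarrow> x i" for i
  proof -
    have "isCont (\<lambda>x::nat \<Rightarrow> real. x i) x"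
      using continuous_on_coordinate[of UNIV i] unfolding continuous_on_eq_continuous_at[OF open_UNIV] by blast
    from isCont_tendsto_compose[OF this x(3)] show ?thesis by simp
  qed
  then have "(\<lambda>k. sqrt (\<Sum>i<N. (X (\<rho> k) i - x i)\<^sup>2)) \<longlonglongrightarrow> sqrt (\<Sum>i<N. (x i - x i)\<^sup>2)"
    by (intro tendsto_intros)
  then have Xx: "(\<lambda>k. vdist N (X (\<rho> k)) x) \<longlonglongrightarrow> 0" by (simp add: L2_set_def)
  have tri: "vdist N (Y k) x \<le> vdist N (X k) (Y k) + vdist N (X k) x" for k
    using L2_set_triangle_ineq[of "\<lambda>i. Y k i - X k i" "\<lambda>i. X k i - x i" "{..<N}"] vdist_commute[of "X k" "Y k" N] by simp
  have dk: "vdist N (X k) (Y k) \<le> 2 * M / real k" if "0 < k" for k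
  proof -
    have "\<bar>f (X k) - f (Y k)\<bar> \<le> 2 * M" using M[OF XY(1)[of k]] M[OF XY(2)[of k]] by linarith
    then show ?thesis using XY(3)[of k] that by (simp add: field_simps)
  qed
  obtain r where r: "0 < r" "\<And>z y. z \<in> euclidean_vectors N \<Longrightarrow> y \<in> euclidean_vectors N \<Longrightarrow> vdist N z x < r \<Longrightarrow> vdist N y x < r \<Longrightarrow>
      \<bar>F z - F y - (\<Sum>i<N. dF i x * (z i - y i))\<bar> \<le> 1 * (\<Sum>i<N. \<bar>z i - y i\<bar>)"
    using linear_approximation[OF subsetD[OF SU x(1)] zero_less_one] by auto
  define L where "L = (\<Sum>i<N. \<bar>dF i x\<bar> + 1)"
  have "(\<lambda>k. 2 * M / real (\<rho> k)) \<longlonglongrightarrow> 0"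
    by (intro tendsto_divide_0[OF tendsto_const] filterlim_at_top_imp_at_infinity
        filterlim_compose[OF filterlim_real_sequentially filterlim_subseq[OF x(2)]])
  then have "\<forall>\<^sub>F k in sequentially. 2 * M / real (\<rho> k) < r / 2" using r(1) by (intro order_tendstoD) auto
  moreover have "\<forall>\<^sub>F k in sequentially. vdist N (X (\<rho> k)) x < r / 2" using Xx r(1) by (intro order_tendstoD) auto
  moreover have "\<forall>\<^sub>F k in sequentially. L < real (\<rho> k)"
    using filterlim_compose[OF filterlim_real_sequentially filterlim_subseq[OF x(2)]]
    by (simp add: filterlim_at_top_dense)
  moreover have "\<forall>\<^sub>F k in sequentially. (0::nat) < k" by (rule eventually_gt_at_top)
  ultimately have "\<forall>\<^sub>F k in sequentially. False"
  proof eventually_elim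
    case (elim k)
    let ?x = "X (\<rho> k)" and ?y = "Y (\<rho> k)"
    have \<rho>: "0 < \<rho> k" using elim(4) seq_suble[OF x(2), of k] by linarith
    have near: "vdist N ?x x < r" "vdist N ?y x < r"
      using elim(1,2) dk[OF \<rho>] tri[of "\<rho> k"] r(1) by linarith+
    have E: "?x \<in> euclidean_vectors N" "?y \<in> euclidean_vectors N" using XY(1,2) by (auto simp: spin_sphere_def)
    have "\<bar>f ?x - f ?y\<bar> = \<bar>F ?x - F ?y\<bar>" using fF XY(1,2) by simp
    also have "\<dots> \<le> \<bar>\<Sum>i<N. dF i x * (?x i - ?y i)\<bar> + (\<Sum>i<N. \<bar>?x i - ?y i\<bar>)"
      using r(2)[OF E near] by linarith
    also have "\<dots> \<le> (\<Sum>i<N. \<bar>dF i x * (?x i - ?y i)\<bar>) + (\<Sum>i<N. \<bar>?x i - ?y i\<bar>)"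
      by (intro add_mono sum_abs) auto
    also have "\<dots> = (\<Sum>i<N. (\<bar>dF i x\<bar> + 1) * \<bar>?x i - ?y i\<bar>)"
      by (simp only: sum.distrib[symmetric] abs_mult distrib_right mult_1_left)
    also have "\<dots> \<le> (\<Sum>i<N. (\<bar>dF i x\<bar> + 1) * vdist N ?x ?y)"
      by (intro sum_mono mult_left_mono coordinate_le_vdist) auto
    also have "\<dots> = L * vdist N ?x ?y" by (simp add: L_def sum_distrib_right)
    also have "\<dots> \<le> real (\<rho> k) * vdist N ?x ?y" using elim(3) by (intro mult_right_mono) auto
    finally show False using XY(3)[of "\<rho> k"] by simp
  qed
  then show False by simp
qed

end

subsection \<open>Integrals with respect to the Gibbs measure\<close>

lemma sets_sphere_volume: "sets (sphere_volume N) = sets (sphere_sigma N)"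
  by (simp add: sphere_volume_def sphere_sigma_def)

lemma space_sphere_sigma: "space (sphere_sigma N) = spin_sphere N"
  by (auto simp: sphere_sigma_def space_restrict_space space_PiM spin_sphere_def)

lemma space_sphere_volume: "space (sphere_volume N) = spin_sphere N"
  using sets_eq_imp_space_eq[OF sets_sphere_volume] by (simp add: space_sphere_sigma)

lemma measurable_sphere_volume: "measurable (sphere_volume N) M = measurable (sphere_sigma N) M"
  by (rule measurable_cong_sets[OF sets_sphere_volume refl])

lemma ball_measurable [measurable]: "{x \<in> space (lebesgue_vectors N). (\<Sum>i<N. (x i)\<^sup>2) < r} \<in> sets (lebesgue_vectors N)"
  by measurable

lemma emeasure_ball_finite: "emeasure (lebesgue_vectors N) {x \<in> space (lebesgue_vectors N). (\<Sum>i<N. (x i)\<^sup>2) < r} < \<infinity>"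
proof -
  let ?K = "{..<N} \<rightarrow>\<^sub>E {- sqrt \<bar>r\<bar>..sqrt \<bar>r\<bar>}"
  have "emeasure (lebesgue_vectors N) {x \<in> space (lebesgue_vectors N). (\<Sum>i<N. (x i)\<^sup>2) < r} \<le> emeasure (lebesgue_vectors N) ?K"
  proof (rule emeasure_mono)
    show "?K \<in> sets (lebesgue_vectors N)" by (intro sets_PiM_I_finite) auto
    show "{x \<in> space (lebesgue_vectors N). (\<Sum>i<N. (x i)\<^sup>2) < r} \<subseteq> ?K"
    proof
      fix x assume x: "x \<in> {x \<in> space (lebesgue_vectors N). (\<Sum>i<N. (x i)\<^sup>2) < r}"
      have "x i \<in> {- sqrt \<bar>r\<bar>..sqrt \<bar>r\<bar>}" if "i < N" for i
      proof -
        have "(x i)\<^sup>2 \<le> (\<Sum>i<N. (x i)\<^sup>2)" using that by (intro member_le_sum) auto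
        then have "sqrt ((x i)\<^sup>2) \<le> sqrt \<bar>r\<bar>" using x by (intro real_sqrt_le_mono) auto
        then show ?thesis by auto
      qed
      then show "x \<in> ?K" using x by (auto simp: space_PiM PiE_iff)
    qed
  qed
  also have "\<dots> < \<infinity>"
    by (subst lborel_prod.emeasure_PiM) (auto simp: power_less_top_ennreal power_0_left)
  finally show ?thesis .
qed

lemma emeasure_ball_pos:
  assumes "0 < N"
  shows "0 < emeasure (lebesgue_vectors N) {x \<in> space (lebesgue_vectors N). (\<Sum>i<N. (x i)\<^sup>2) < real N}"
proof -
  let ?K = "{..<N} \<rightarrow>\<^sub>E {- (1/2)..1/2 :: real}"
  have "0 < emeasure (lebesgue_vectors N) ?K"
    by (subst lborel_prod.emeasure_PiM) auto
  also have "\<dots> \<le> emeasure (lebesgue_vectors N) {x \<in> space (lebesgue_vectors N). (\<Sum>i<N. (x i)\<^sup>2) < real N}"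
  proof (rule emeasure_mono)
    show "?K \<subseteq> {x \<in> space (lebesgue_vectors N). (\<Sum>i<N. (x i)\<^sup>2) < real N}"
    proof
      fix x assume x: "x \<in> ?K"
      have "(\<Sum>i<N. (x i)\<^sup>2) < (\<Sum>i<N. 1)"
      proof (rule sum_strict_mono)
        fix i assume "i \<in> {..<N}"
        then have "x i \<in> {- (1/2)..1/2}" using PiE_mem[OF x] by blast
        then have "\<bar>x i\<bar> < 1" by (simp only: atLeastAtMost_iff) linarith
        then show "(x i)\<^sup>2 < 1" by (simp add: abs_square_less_1)
      qed (use assms in auto)
      then show "x \<in> {x \<in> space (lebesgue_vectors N). (\<Sum>i<N. (x i)\<^sup>2) < real N}"
        using x by (auto simp: space_PiM PiE_iff)
    qed
  qed measurable
  finally show ?thesis .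
qed

lemma nn_integral_ball:
  assumes "0 < N" and F: "F \<in> borel_measurable (lebesgue_vectors N)"
  shows "(\<integral>\<^sup>+x. indicator {x \<in> space (lebesgue_vectors N). (\<Sum>i<N. (x i)\<^sup>2) < real N} x * F x \<partial>lebesgue_vectors N) =
    ennreal (sqrt (real N)) * (\<integral>\<^sup>+s. indicator {0<..<1} s * (ennreal (s ^ (N - 1)) *
       (\<integral>\<^sup>+\<sigma>. F (scale_vector N s \<sigma>) \<partial>sphere_volume N)) \<partial>lborel)"
proof -
  obtain n where n: "N = Suc n" using assms(1) by (cases N) auto
  have "(\<integral>\<^sup>+x. indicator {x \<in> space (lebesgue_vectors N). (\<Sum>i<N. (x i)\<^sup>2) < real N} x * F x \<partial>lebesgue_vectors N) =
    (\<integral>\<^sup>+x. indicator {x. (\<Sum>i<N. (x i)\<^sup>2) < real N} x * F x \<partial>lebesgue_vectors N)"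
    by (intro nn_integral_cong) (simp add: indicator_def)
  then show ?thesis using nn_integral_polar[of F n] F unfolding n diff_Suc_1 by (simp only:)
qed

text \<open>Polar coordinates for the function 1 express the volume of the ball, which is positive
  and finite, as a positive multiple of the sphere volume.\<close>

lemma sphere_volume_finite_pos:
  assumes "0 < N"
  shows "emeasure (sphere_volume N) (spin_sphere N) < \<infinity>" "0 < emeasure (sphere_volume N) (spin_sphere N)"
proof -
  let ?B = "{x \<in> space (lebesgue_vectors N). (\<Sum>i<N. (x i)\<^sup>2) < real N}"
  let ?v = "emeasure (sphere_volume N) (spin_sphere N)"
  define a where "a = (\<integral>\<^sup>+s. indicator {0<..<1::real} s * ennreal (s ^ (N - 1)) \<partial>lborel)"
  have "emeasure (lebesgue_vectors N) ?B = (\<integral>\<^sup>+x. indicator ?B x * 1 \<partial>lebesgue_vectors N)"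
    by (simp add: nn_integral_indicator ball_measurable)
  also have "\<dots> = ennreal (sqrt (real N)) * (\<integral>\<^sup>+s. indicator {0<..<1} s * (ennreal (s ^ (N - 1)) *
       (\<integral>\<^sup>+\<sigma>. 1 \<partial>sphere_volume N)) \<partial>lborel)"
    using assms by (rule nn_integral_ball) simp
  also have "(\<integral>\<^sup>+\<sigma>. 1 \<partial>sphere_volume N) = ?v" by (simp add: space_sphere_volume)
  also have "(\<integral>\<^sup>+s. indicator {0<..<1} s * (ennreal (s ^ (N - 1)) * ?v) \<partial>lborel) = a * ?v"
    unfolding a_def mult.assoc[symmetric] by (rule nn_integral_multc) measurable
  finally have eq: "emeasure (lebesgue_vectors N) ?B = ennreal (sqrt (real N)) * (a * ?v)" .
  have "emeasure lborel {1/2<..<1::real} = ennreal (1 - 1/2)" by (rule emeasure_lborel_Ioo) simp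
  then have "0 < ennreal ((1/2) ^ (N - 1)) * emeasure lborel {1/2<..<1::real}"
    by (simp only: ennreal_zero_less_mult_iff ennreal_less_zero_iff) simp
  also have "\<dots> = (\<integral>\<^sup>+s. ennreal ((1/2) ^ (N - 1)) * indicator {1/2<..<1::real} s \<partial>lborel)"
    by (simp add: nn_integral_cmult_indicator)
  also have "\<dots> \<le> a" unfolding a_def
    by (intro nn_integral_mono) (auto simp: indicator_def intro!: ennreal_leI power_mono)
  finally have a: "0 < a" .
  show "?v < \<infinity>"
  proof (rule ccontr)
    assume "\<not> ?v < \<infinity>"
    then have "?v = \<infinity>" by (simp add: less_top[symmetric])
    then have "emeasure (lebesgue_vectors N) ?B = \<infinity>"
      unfolding eq using a assms by (simp add: ennreal_mult_top ennreal_mult_eq_top_iff)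
    then show False using emeasure_ball_finite[of N "real N"] by simp
  qed
  show "0 < ?v"
  proof (rule ccontr)
    assume "\<not> 0 < ?v"
    then have "emeasure (lebesgue_vectors N) ?B = 0" unfolding eq by simp
    then show False using emeasure_ball_pos[OF assms] by simp
  qed
qed

lemma hamiltonian_continuous: "continuous_on S (hamiltonian N p J)"
  unfolding hamiltonian_def[abs_def] by (intro continuous_intros continuous_on_coordinate)

definition gibbs_weight :: "nat \<Rightarrow> nat \<Rightarrow> real \<Rightarrow> ((nat \<Rightarrow> nat) \<Rightarrow> real) \<Rightarrow> (nat \<Rightarrow> real) \<Rightarrow> real" where
  "gibbs_weight N p \<beta> J \<sigma> = exp (- \<beta> * hamiltonian N p J \<sigma>)"

lemma gibbs_weight_continuous: "continuous_on S (gibbs_weight N p \<beta> J)"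
  unfolding gibbs_weight_def[abs_def] by (intro continuous_intros hamiltonian_continuous)

lemma integrable_sphere_volume:
  fixes g :: "(nat \<Rightarrow> real) \<Rightarrow> real"
  assumes "0 < N" "g \<in> borel_measurable (sphere_sigma N)" "\<And>\<sigma>. \<sigma> \<in> spin_sphere N \<Longrightarrow> \<bar>g \<sigma>\<bar> \<le> M"
  shows "integrable (sphere_volume N) g"
proof -
  interpret finite_measure "sphere_volume N"
    by (rule finite_measureI) (use sphere_volume_finite_pos[OF assms(1)] in \<open>auto simp: space_sphere_volume\<close>)
  show ?thesis
    by (rule integrable_const_bound[of _ M]) (use assms in \<open>auto simp: space_sphere_volume measurable_sphere_volume\<close>)
qed

lemma continuous_bounded_on_sphere:
  fixes g :: "(nat \<Rightarrow> real) \<Rightarrow> real"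
  assumes "continuous_on (spin_sphere N) g"
  obtains M where "\<And>\<sigma>. \<sigma> \<in> spin_sphere N \<Longrightarrow> \<bar>g \<sigma>\<bar> \<le> M"
  using compact_imp_bounded[OF compact_continuous_image[OF assms compact_spin_sphere]]
  by (auto simp: bounded_iff)

lemma integral_uniform_sphere:
  fixes g :: "(nat \<Rightarrow> real) \<Rightarrow> real"
  assumes "0 < N" "g \<in> borel_measurable (sphere_sigma N)"
  shows "(\<integral>\<sigma>. g \<sigma> \<partial>uniform_sphere N) = (\<integral>\<sigma>. g \<sigma> \<partial>sphere_volume N) / measure (sphere_volume N) (spin_sphere N)"
proof -
  let ?v = "measure (sphere_volume N) (spin_sphere N)"
  have v: "0 < ?v" "emeasure (sphere_volume N) (spin_sphere N) = ennreal ?v"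
    using sphere_volume_finite_pos[OF assms(1)]
    by (auto simp: measure_def enn2real_positive_iff less_top)
  have "(\<integral>\<sigma>. g \<sigma> \<partial>uniform_sphere N) = (\<integral>\<sigma>. g \<sigma> \<partial>density (sphere_volume N) (\<lambda>\<sigma>. ennreal (indicator (spin_sphere N) \<sigma> / ?v)))"
    unfolding uniform_sphere_def uniform_measure_def v(2)
    by (intro arg_cong[where f = "\<lambda>h. \<integral>\<sigma>. g \<sigma> \<partial>density (sphere_volume N) h"])
       (use v in \<open>auto simp: fun_eq_iff indicator_def divide_ennreal[symmetric]\<close>)
  also have "\<dots> = (\<integral>\<sigma>. (indicator (spin_sphere N) \<sigma> / ?v) *\<^sub>R g \<sigma> \<partial>sphere_volume N)"
  proof (rule integral_density)
    have "spin_sphere N \<in> sets (sphere_volume N)" using sets.top[of "sphere_volume N"] by (simp add: space_sphere_volume)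
    then show "(\<lambda>\<sigma>. indicator (spin_sphere N) \<sigma> / ?v) \<in> borel_measurable (sphere_volume N)" by simp
  qed (use assms v in \<open>auto simp: measurable_sphere_volume\<close>)
  also have "\<dots> = (\<integral>\<sigma>. g \<sigma> / ?v \<partial>sphere_volume N)"
    by (intro Bochner_Integration.integral_cong) (auto simp: space_sphere_volume)
  finally show ?thesis by simp
qed

definition gibbs_mass :: "nat \<Rightarrow> nat \<Rightarrow> real \<Rightarrow> ((nat \<Rightarrow> nat) \<Rightarrow> real) \<Rightarrow> real" where
  "gibbs_mass N p \<beta> J = (\<integral>\<sigma>. gibbs_weight N p \<beta> J \<sigma> \<partial>sphere_volume N)"

lemma gibbs_weight_measurable: "gibbs_weight N p \<beta> J \<in> borel_measurable (sphere_sigma N)"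
  by (rule continuous_on_sphere_measurable[OF gibbs_weight_continuous])

lemma gibbs_mass_pos:
  assumes "0 < N"
  shows "0 < gibbs_mass N p \<beta> J"
proof -
  obtain M where M: "\<And>\<sigma>. \<sigma> \<in> spin_sphere N \<Longrightarrow> \<bar>gibbs_weight N p \<beta> J \<sigma>\<bar> \<le> M"
    using continuous_bounded_on_sphere[OF gibbs_weight_continuous[of "spin_sphere N" N p \<beta> J]] by blast
  have i: "integrable (sphere_volume N) (gibbs_weight N p \<beta> J)"
    using integrable_sphere_volume[OF assms gibbs_weight_measurable M] .
  have "gibbs_mass N p \<beta> J \<noteq> 0"
  proof
    assume "gibbs_mass N p \<beta> J = 0"
    then have "AE \<sigma> in sphere_volume N. gibbs_weight N p \<beta> J \<sigma> = 0"
      unfolding gibbs_mass_def by (subst (asm) integral_nonneg_eq_0_iff_AE[OF i]) (auto simp: gibbs_weight_def)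
    then have "AE \<sigma> in sphere_volume N. False" by (simp add: gibbs_weight_def)
    then have "emeasure (sphere_volume N) (space (sphere_volume N)) = 0" by (subst (asm) AE_iff_measurable[OF sets.top]) auto
    then show False using sphere_volume_finite_pos(2)[OF assms] by (simp add: space_sphere_volume)
  qed
  moreover have "0 \<le> gibbs_mass N p \<beta> J" unfolding gibbs_mass_def by (rule integral_nonneg_AE) (simp add: gibbs_weight_def)
  ultimately show ?thesis by simp
qed

lemma integral_gibbs_measure:
  fixes g :: "(nat \<Rightarrow> real) \<Rightarrow> real"
  assumes N: "0 < N" and g: "g \<in> borel_measurable (sphere_sigma N)"
  shows "(\<integral>\<sigma>. g \<sigma> \<partial>gibbs_measure N p \<beta> J) = (\<integral>\<sigma>. g \<sigma> * gibbs_weight N p \<beta> J \<sigma> \<partial>sphere_volume N) / gibbs_mass N p \<beta> J"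
proof -
  let ?v = "measure (sphere_volume N) (spin_sphere N)" and ?w = "gibbs_weight N p \<beta> J"
  have v: "0 < ?v" using sphere_volume_finite_pos[OF N] by (auto simp: measure_def enn2real_positive_iff less_top)
  have Z: "partition_function N p \<beta> J = gibbs_mass N p \<beta> J / ?v"
    unfolding partition_function_def gibbs_mass_def gibbs_weight_def[symmetric]
    by (rule integral_uniform_sphere[OF N gibbs_weight_measurable])
  have Z0: "0 < partition_function N p \<beta> J" unfolding Z using gibbs_mass_pos[OF N] v by simp
  have m: "measurable (uniform_sphere N) borel = measurable (sphere_sigma N) borel"
    by (intro measurable_cong_sets refl) (simp add: uniform_sphere_def sets_sphere_volume)
  have "(\<integral>\<sigma>. g \<sigma> \<partial>gibbs_measure N p \<beta> J) = (\<integral>\<sigma>. (?w \<sigma> / partition_function N p \<beta> J) *\<^sub>R g \<sigma> \<partial>uniform_sphere N)"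
    unfolding gibbs_measure_def gibbs_weight_def[symmetric]
  proof (rule integral_density)
    show "(\<lambda>\<sigma>. ?w \<sigma> / partition_function N p \<beta> J) \<in> borel_measurable (uniform_sphere N)"
      unfolding m by (intro borel_measurable_divide gibbs_weight_measurable borel_measurable_const)
    show "AE \<sigma> in uniform_sphere N. 0 \<le> ?w \<sigma> / partition_function N p \<beta> J"
      using Z0 by (intro AE_I2) (simp add: gibbs_weight_def)
  qed (use g in \<open>simp add: m\<close>)
  also have "\<dots> = (\<integral>\<sigma>. g \<sigma> * ?w \<sigma> / partition_function N p \<beta> J \<partial>uniform_sphere N)"
    by (intro Bochner_Integration.integral_cong) auto
  also have "\<dots> = (\<integral>\<sigma>. g \<sigma> * ?w \<sigma> \<partial>uniform_sphere N) / partition_function N p \<beta> J" by simp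
  also have "(\<integral>\<sigma>. g \<sigma> * ?w \<sigma> \<partial>uniform_sphere N) = (\<integral>\<sigma>. g \<sigma> * ?w \<sigma> \<partial>sphere_volume N) / ?v"
    by (rule integral_uniform_sphere[OF N]) (use g gibbs_weight_measurable in auto)
  finally show ?thesis using v by (simp add: Z)
qed

text \<open>The log-Sobolev inequality multiplied by \<open>gibbs_mass\<close>, with the entropy
  expanded. J enters only through the weight, which makes limits in J and in the regularisation
  direct.\<close>

definition unnormalized_lsi :: "nat \<Rightarrow> nat \<Rightarrow> real \<Rightarrow> real \<Rightarrow> ((nat \<Rightarrow> nat) \<Rightarrow> real) \<Rightarrow> ((nat \<Rightarrow> real) \<Rightarrow> real) \<Rightarrow> bool" where
  "unnormalized_lsi N p \<beta> c J f \<longleftrightarrow>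
     (\<integral>\<sigma>. (f \<sigma>)\<^sup>2 * ln ((f \<sigma>)\<^sup>2) * gibbs_weight N p \<beta> J \<sigma> \<partial>sphere_volume N) -
     (\<integral>\<sigma>. (f \<sigma>)\<^sup>2 * gibbs_weight N p \<beta> J \<sigma> \<partial>sphere_volume N) *
       ln ((\<integral>\<sigma>. (f \<sigma>)\<^sup>2 * gibbs_weight N p \<beta> J \<sigma> \<partial>sphere_volume N) / gibbs_mass N p \<beta> J)
     \<le> 2 * c * (\<integral>\<sigma>. induced_metric N (sphere_gradient N f \<sigma>) (sphere_gradient N f \<sigma>) * gibbs_weight N p \<beta> J \<sigma> \<partial>sphere_volume N)"

lemma smooth_sphere_extension:
  assumes "0 < N" "smooth_on_sphere N f"
  shows "\<exists>F U. sphere_extension N f F U"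
proof -
  obtain U F where "openin (top_of_set (euclidean_vectors N)) U" "spin_sphere N \<subseteq> U"
        "C_infinity_on N U F" "\<forall>\<sigma>\<in>spin_sphere N. f \<sigma> = F \<sigma>"
    using assms(2) by (auto simp: smooth_on_sphere_def)
  then have "sphere_extension N f F U" using assms(1) by unfold_locales auto
  then show ?thesis by blast
qed

lemma xlnx_bound:
  fixes y :: real
  assumes "0 \<le> y" "y \<le> M" "1 \<le> M"
  shows "\<bar>y * ln y\<bar> \<le> 1 + M * ln M"
proof (cases "y = 0")
  case False
  then have y: "0 < y" using assms by simp
  have "- ln y = ln (1 / y)" using y by (simp add: ln_div)
  also have "\<dots> \<le> 1 / y - 1" using y by (intro ln_le_minus_one) simp
  finally have "y * (- ln y) \<le> y * (1 / y - 1)" using y by (intro mult_left_mono) auto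
  then have "- (y * ln y) \<le> 1" using y by (simp add: right_diff_distrib)
  moreover have "y * ln y \<le> M * ln M"
  proof (cases "1 \<le> y")
    case True
    then show ?thesis using assms by (intro mult_mono) auto
  next
    case False
    then have "y * ln y \<le> 0" using y by (simp add: mult_nonneg_nonpos)
    moreover have "0 \<le> M * ln M" using assms by simp
    ultimately show ?thesis by linarith
  qed
  moreover have "0 \<le> M * ln M" using assms by simp
  ultimately show ?thesis by (simp add: abs_le_iff)
qed (use assms in simp)

lemma log_sobolev_gibbs_iff:
  assumes N: "0 < N" and c: "0 < c"
  shows "log_sobolev N (gibbs_measure N p \<beta> J) c \<longleftrightarrow> (\<forall>f. smooth_on_sphere N f \<longrightarrow> unnormalized_lsi N p \<beta> c J f)"
  unfolding log_sobolev_def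
proof (intro all_cong1 imp_cong refl)
  fix f assume f: "smooth_on_sphere N f"
  obtain F U where "sphere_extension N f F U" using smooth_sphere_extension[OF N f] by blast
  then interpret sphere_extension N f F U .
  let ?w = "gibbs_weight N p \<beta> J" and ?V = "sphere_volume N"
  define Z where "Z = gibbs_mass N p \<beta> J"
  have Z: "0 < Z" unfolding Z_def by (rule gibbs_mass_pos[OF N])
  have fm: "f \<in> borel_measurable (sphere_sigma N)" by (rule continuous_on_sphere_measurable[OF continuous_on_f])
  have gm: "grad_sq \<in> borel_measurable (sphere_sigma N)" by (rule continuous_on_sphere_measurable[OF continuous_on_grad_sq])
  note [measurable] = fm gm gibbs_weight_measurable
  define B where "B = (\<integral>\<sigma>. (f \<sigma>)\<^sup>2 * ?w \<sigma> \<partial>?V)"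
  define A where "A = (\<integral>\<sigma>. (f \<sigma>)\<^sup>2 * ln ((f \<sigma>)\<^sup>2) * ?w \<sigma> \<partial>?V)"
  define m where "m = B / Z"
  have mean: "(\<integral>\<tau>. (f \<tau>)\<^sup>2 \<partial>gibbs_measure N p \<beta> J) = m"
    unfolding m_def B_def Z_def by (rule integral_gibbs_measure[OF N]) measurable
  obtain M where M: "\<And>\<sigma>. \<sigma> \<in> spin_sphere N \<Longrightarrow> \<bar>f \<sigma>\<bar> \<le> M" using f_bounded by blast
  obtain W where W: "\<And>\<sigma>. \<sigma> \<in> spin_sphere N \<Longrightarrow> \<bar>?w \<sigma>\<bar> \<le> W"
    using continuous_bounded_on_sphere[OF gibbs_weight_continuous[of "spin_sphere N" N p \<beta> J]] by blast
  define M2 where "M2 = max 1 (M\<^sup>2)"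
  have f2: "(f \<sigma>)\<^sup>2 \<le> M2" if "\<sigma> \<in> spin_sphere N" for \<sigma>
  proof -
    have "(f \<sigma>)\<^sup>2 \<le> M\<^sup>2" using M[OF that] by (simp add: abs_le_square_iff[symmetric])
    then show ?thesis by (simp add: M2_def)
  qed
  have iB: "integrable ?V (\<lambda>\<sigma>. (f \<sigma>)\<^sup>2 * ?w \<sigma>)"
  proof (rule integrable_sphere_volume[OF N])
    fix \<sigma> assume s: "\<sigma> \<in> spin_sphere N"
    show "\<bar>(f \<sigma>)\<^sup>2 * ?w \<sigma>\<bar> \<le> M2 * W"
      unfolding abs_mult using f2[OF s] W[OF s] by (intro mult_mono) (auto simp: M2_def)
  qed measurable
  have iA: "integrable ?V (\<lambda>\<sigma>. (f \<sigma>)\<^sup>2 * ln ((f \<sigma>)\<^sup>2) * ?w \<sigma>)"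
  proof (rule integrable_sphere_volume[OF N])
    fix \<sigma> assume s: "\<sigma> \<in> spin_sphere N"
    have "\<bar>(f \<sigma>)\<^sup>2 * ln ((f \<sigma>)\<^sup>2)\<bar> \<le> 1 + M2 * ln M2"
      by (rule xlnx_bound) (use f2[OF s] in \<open>auto simp: M2_def\<close>)
    then show "\<bar>(f \<sigma>)\<^sup>2 * ln ((f \<sigma>)\<^sup>2) * ?w \<sigma>\<bar> \<le> (1 + M2 * ln M2) * W"
      unfolding abs_mult[of "_ * _" "?w \<sigma>"] using W[OF s] by (intro mult_mono) (auto simp: M2_def)
  qed measurable
  have w0: "0 < ?w \<sigma>" for \<sigma> by (simp add: gibbs_weight_def)
  have B0: "0 \<le> B" unfolding B_def by (rule integral_nonneg_AE) (use w0 in \<open>auto simp: less_imp_le\<close>)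
  have ent: "(\<integral>\<sigma>. (f \<sigma>)\<^sup>2 * ln ((f \<sigma>)\<^sup>2 / m) \<partial>gibbs_measure N p \<beta> J) = (A - B * ln (B / Z)) / Z"
  \<comment> \<open>If B = 0 then f vanishes almost everywhere, and division by m = 0 together with
    ln 0 = 0 makes both sides 0.\<close>
  proof (cases "B = 0")
    case True
    then have "AE \<sigma> in ?V. (f \<sigma>)\<^sup>2 * ?w \<sigma> = 0"
      unfolding B_def by (subst (asm) integral_nonneg_eq_0_iff_AE[OF iB]) (use w0 in \<open>auto simp: less_imp_le\<close>)
    then have "A = (\<integral>\<sigma>. 0 \<partial>?V)" unfolding A_def
      by (intro integral_cong_AE) (auto simp: measurable_sphere_volume)
    moreover have "m = 0" using True by (simp add: m_def)
    ultimately show ?thesis using True by simp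
  next
    case False
    then have m: "0 < m" using B0 Z by (simp add: m_def)
    have "(\<integral>\<sigma>. (f \<sigma>)\<^sup>2 * ln ((f \<sigma>)\<^sup>2 / m) \<partial>gibbs_measure N p \<beta> J) = (\<integral>\<sigma>. (f \<sigma>)\<^sup>2 * ln ((f \<sigma>)\<^sup>2 / m) * ?w \<sigma> \<partial>?V) / Z"
      unfolding Z_def by (rule integral_gibbs_measure[OF N]) measurable
    also have "(\<integral>\<sigma>. (f \<sigma>)\<^sup>2 * ln ((f \<sigma>)\<^sup>2 / m) * ?w \<sigma> \<partial>?V) = (\<integral>\<sigma>. (f \<sigma>)\<^sup>2 * ln ((f \<sigma>)\<^sup>2) * ?w \<sigma> - ln m * ((f \<sigma>)\<^sup>2 * ?w \<sigma>) \<partial>?V)"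
    proof (rule Bochner_Integration.integral_cong[OF refl])
      fix \<sigma>
      show "(f \<sigma>)\<^sup>2 * ln ((f \<sigma>)\<^sup>2 / m) * ?w \<sigma> = (f \<sigma>)\<^sup>2 * ln ((f \<sigma>)\<^sup>2) * ?w \<sigma> - ln m * ((f \<sigma>)\<^sup>2 * ?w \<sigma>)"
        using m by (cases "f \<sigma> = 0") (simp_all add: ln_div algebra_simps)
    qed
    also have "\<dots> = A - ln m * B" using iA iB by (simp add: A_def B_def)
    finally show ?thesis by (simp add: m_def mult.commute)
  qed
  have grad: "(\<integral>\<sigma>. induced_metric N (sphere_gradient N f \<sigma>) (sphere_gradient N f \<sigma>) \<partial>gibbs_measure N p \<beta> J)
     = (\<integral>\<sigma>. induced_metric N (sphere_gradient N f \<sigma>) (sphere_gradient N f \<sigma>) * ?w \<sigma> \<partial>?V) / Z"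
    unfolding Z_def grad_sq_def[symmetric] by (rule integral_gibbs_measure[OF N]) measurable
  show "((\<integral>\<sigma>. (f \<sigma>)\<^sup>2 * ln ((f \<sigma>)\<^sup>2 / (\<integral>\<tau>. (f \<tau>)\<^sup>2 \<partial>gibbs_measure N p \<beta> J)) \<partial>gibbs_measure N p \<beta> J)
      \<le> 2 * c * (\<integral>\<sigma>. induced_metric N (sphere_gradient N f \<sigma>) (sphere_gradient N f \<sigma>) \<partial>gibbs_measure N p \<beta> J))
     = unnormalized_lsi N p \<beta> c J f"
    unfolding mean ent grad unnormalized_lsi_def A_def[symmetric] B_def[symmetric] Z_def[symmetric]
    using Z by (simp add: divide_le_cancel)
qed

subsection \<open>Radial projection of the ball onto the sphere\<close>

text \<open>At the origin the value is an arbitrary point of the sphere, sqrt N times the unit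
  vector of index 0, so that the map takes values in the sphere everywhere.\<close>

definition radial_projection :: "nat \<Rightarrow> (nat \<Rightarrow> real) \<Rightarrow> nat \<Rightarrow> real" where
  "radial_projection N x = (\<lambda>i\<in>{..<N}. if vnorm N x = 0 then (if i = 0 then sqrt (real N) else 0)
     else sqrt (real N) / vnorm N x * x i)"

lemma radial_projection_in_sphere:
  assumes N: "0 < N"
  shows "radial_projection N x \<in> spin_sphere N"
proof (cases "vnorm N x = 0")
  case True
  have "(\<Sum>i<N. (radial_projection N x i)\<^sup>2) = (\<Sum>i<N. if i = 0 then real N else 0)"
    using True by (intro sum.cong) (auto simp: radial_projection_def)
  also have "\<dots> = real N" using N by simp
  finally show ?thesis by (auto simp: spin_sphere_def radial_projection_def)
next
  case False
  have "(\<Sum>i<N. (radial_projection N x i)\<^sup>2) = (\<Sum>i<N. real N / (vnorm N x)\<^sup>2 * (x i)\<^sup>2)"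
    using False by (intro sum.cong) (auto simp: radial_projection_def power_mult_distrib power_divide)
  also have "\<dots> = real N / (vnorm N x)\<^sup>2 * (vnorm N x)\<^sup>2" by (simp only: sum_distrib_left vnorm_sq)
  also have "\<dots> = real N" using False by simp
  finally show ?thesis by (auto simp: spin_sphere_def radial_projection_def)
qed

lemma radial_projection_measurable:
  assumes "0 < N"
  shows "radial_projection N \<in> lebesgue_vectors N \<rightarrow>\<^sub>M sphere_sigma N"
  unfolding sphere_sigma_def
proof (rule measurable_restrict_space2)
  show "radial_projection N \<in> lebesgue_vectors N \<rightarrow>\<^sub>M (\<Pi>\<^sub>M i\<in>{..<N}. borel)"
    unfolding radial_projection_def[abs_def] by (rule measurable_restrict) measurable
qed (use radial_projection_in_sphere[OF assms] in auto)

lemma vnorm_scale_vector: "0 \<le> s \<Longrightarrow> vnorm N (scale_vector N s x) = s * vnorm N x"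
proof -
  assume s: "0 \<le> s"
  have "vnorm N (scale_vector N s x) = vnorm N (\<lambda>i. s * x i)"
    by (intro L2_set_cong) (auto simp: scale_vector_def)
  then show ?thesis using s by (simp add: L2_set_right_distrib)
qed

lemma radial_projection_scale_vector:
  assumes "0 < N" "0 < s" "\<sigma> \<in> spin_sphere N"
  shows "radial_projection N (scale_vector N s \<sigma>) = \<sigma>"
proof -
  have n: "vnorm N (scale_vector N s \<sigma>) = s * sqrt (real N)"
    using assms by (simp add: vnorm_scale_vector spin_sphere_vnorm)
  show ?thesis
    using assms unfolding radial_projection_def n
    by (auto simp: fun_eq_iff scale_vector_def spin_sphere_def PiE_iff extensional_def)
qed

lemma vdist_triangle_norm: "vnorm N z - vnorm N x \<le> vdist N x z"
proof -
  have "vnorm N z \<le> vnorm N x + vnorm N (\<lambda>i. z i - x i)"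
    using L2_set_triangle_ineq[of x "\<lambda>i. z i - x i" "{..<N}"] by simp
  then show ?thesis using vdist_commute[of x z N] by simp
qed

text \<open>The squared distance of the unit directions is (2 |x| |z| - 2 <x, z>) / (|x| |z|), and 2
  |x| |z| \<le> |x|^2 + |z|^2. The factor tends to the slope sqrt N / |z| as x tends to z.\<close>

lemma vdist_radial_projection:
  assumes x: "0 < vnorm N x" and z: "0 < vnorm N z"
  shows "vdist N (radial_projection N x) (radial_projection N z)
    \<le> sqrt (real N) / sqrt (vnorm N x * vnorm N z) * vdist N x z"
proof -
  let ?a = "vnorm N x" and ?b = "vnorm N z"
  define P where "P = (\<Sum>i<N. x i * z i)"
  have "(vdist N (radial_projection N x) (radial_projection N z))\<^sup>2
      = (\<Sum>i<N. real N * ((x i)\<^sup>2 / ?a\<^sup>2 + (z i)\<^sup>2 / ?b\<^sup>2 - 2 * (x i * z i) / (?a * ?b)))"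
  proof (subst vnorm_sq, rule sum.cong[OF refl])
    fix i assume "i \<in> {..<N}"
    then have "radial_projection N x i - radial_projection N z i = sqrt (real N) * (x i / ?a - z i / ?b)"
      using x z by (simp add: radial_projection_def right_diff_distrib)
    then have "(radial_projection N x i - radial_projection N z i)\<^sup>2 = real N * (x i / ?a - z i / ?b)\<^sup>2"
      by (simp add: power_mult_distrib)
    also have "(x i / ?a - z i / ?b)\<^sup>2 = (x i)\<^sup>2 / ?a\<^sup>2 + (z i)\<^sup>2 / ?b\<^sup>2 - 2 * (x i * z i) / (?a * ?b)"
      by (simp add: power2_diff power_divide)
    finally show "(radial_projection N x i - radial_projection N z i)\<^sup>2 =
      real N * ((x i)\<^sup>2 / ?a\<^sup>2 + (z i)\<^sup>2 / ?b\<^sup>2 - 2 * (x i * z i) / (?a * ?b))" .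
  qed
  also have "\<dots> = real N * (?a\<^sup>2 / ?a\<^sup>2 + ?b\<^sup>2 / ?b\<^sup>2 - 2 * P / (?a * ?b))"
  proof -
    have "(\<Sum>i<N. (x i)\<^sup>2) = ?a\<^sup>2" "(\<Sum>i<N. (z i)\<^sup>2) = ?b\<^sup>2" by (simp_all only: vnorm_sq)
    then show ?thesis
      by (simp only: sum.distrib sum_subtractf sum_divide_distrib[symmetric] sum_distrib_left[symmetric] P_def)
  qed
  also have "\<dots> = real N * ((2 * (?a * ?b) - 2 * P) / (?a * ?b))"
    using x z by (simp add: field_simps)
  also have "\<dots> \<le> real N * ((vdist N x z)\<^sup>2 / (?a * ?b))"
  proof (intro mult_left_mono divide_right_mono)
    have "(vdist N x z)\<^sup>2 = (\<Sum>i<N. (x i)\<^sup>2 + (z i)\<^sup>2 - 2 * (x i * z i))"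
      unfolding vnorm_sq by (intro sum.cong refl) (simp add: power2_diff)
    also have "\<dots> = ?a\<^sup>2 + ?b\<^sup>2 - 2 * P"
      by (simp only: sum.distrib sum_subtractf sum_distrib_left[symmetric] vnorm_sq P_def)
    finally show "2 * (?a * ?b) - 2 * P \<le> (vdist N x z)\<^sup>2"
      using zero_le_power2[of "?a - ?b"] by (simp add: power2_diff)
  qed (use x z in auto)
  also have "\<dots> = (sqrt (real N) / sqrt (?a * ?b) * vdist N x z)\<^sup>2"
    using x z by (simp add: power_mult_distrib power_divide)
  finally show ?thesis
    by (rule power2_le_imp_le) (use x z in auto)
qed

text \<open>For |x| \<ge> |z| / 4 the previous estimate applies. Otherwise the distance is at least
  (3/4) |z| while the images are at most 2 sqrt N apart, and 2 \<le> 3 * 3/4.\<close>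

lemma vdist_radial_projection_global:
  assumes N: "0 < N" and z: "0 < vnorm N z"
  shows "vdist N (radial_projection N x) (radial_projection N z) \<le> 3 * sqrt (real N) / vnorm N z * vdist N x z"
proof (cases "vnorm N z / 4 \<le> vnorm N x")
  case True
  let ?a = "vnorm N x" and ?b = "vnorm N z"
  have a: "0 < ?a" using True z by linarith
  have "(?b / 2)\<^sup>2 \<le> ?a * ?b" using mult_right_mono[OF True, of ?b] z by (simp add: power2_eq_square)
  then have "?b / 2 \<le> sqrt (?a * ?b)" by (rule real_le_rsqrt)
  then have "sqrt (real N) / sqrt (?a * ?b) \<le> sqrt (real N) / (?b / 2)"
    using z a by (intro divide_left_mono) auto
  also have "\<dots> \<le> 3 * sqrt (real N) / ?b" using z by (simp add: field_simps)
  finally have "sqrt (real N) / sqrt (?a * ?b) * vdist N x z \<le> 3 * sqrt (real N) / ?b * vdist N x z"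
    by (intro mult_right_mono) auto
  then show ?thesis using vdist_radial_projection[OF a z] by linarith
next
  case False
  let ?u = "radial_projection N x" and ?v = "radial_projection N z"
  have "vdist N ?u ?v \<le> vnorm N ?u + vnorm N (\<lambda>i. - ?v i)"
    using L2_set_triangle_ineq[of ?u "\<lambda>i. - ?v i" "{..<N}"] by simp
  also have "vnorm N (\<lambda>i. - ?v i) = vnorm N ?v" by (simp add: L2_set_def)
  finally have "vdist N ?u ?v \<le> 2 * sqrt (real N)"
    by (simp add: spin_sphere_vnorm[OF radial_projection_in_sphere[OF N]])
  also have "\<dots> \<le> 3 * sqrt (real N) / vnorm N z * vdist N x z"
  proof -
    have "2 * vnorm N z \<le> 3 * vdist N x z" using vdist_triangle_norm[where N = N and z = z and x = x] False z by linarith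
    then have "sqrt (real N) * (2 * vnorm N z) \<le> sqrt (real N) * (3 * vdist N x z)" by (intro mult_left_mono) auto
    then show ?thesis using z by (simp add: field_simps)
  qed
  finally show ?thesis .
qed

text \<open>A is an upper bound for the local Lipschitz constant of \<phi> at z along S. General
  distances allow a chain rule through ball, sphere and line.\<close>

definition slope_bound :: "('a \<Rightarrow> 'a \<Rightarrow> real) \<Rightarrow> ('b \<Rightarrow> 'b \<Rightarrow> real) \<Rightarrow> ('a \<Rightarrow> 'b) \<Rightarrow> 'a set \<Rightarrow> 'a \<Rightarrow> real \<Rightarrow> bool" where
  "slope_bound d d' \<phi> S z A \<longleftrightarrow> (\<forall>\<eta>>0. \<exists>\<delta>>0. \<forall>x\<in>S. d x z < \<delta> \<longrightarrow> d' (\<phi> x) (\<phi> z) \<le> (A + \<eta>) * d x z)"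

lemma slope_bound_comp:
  assumes \<phi>: "slope_bound d d' \<phi> S z A" and \<psi>: "slope_bound d' d'' \<psi> T (\<phi> z) B"
    and sub: "\<And>x. x \<in> S \<Longrightarrow> \<phi> x \<in> T" and nn: "0 \<le> A" "0 \<le> B" "\<And>x y. 0 \<le> d x y" "\<And>x y. 0 \<le> d' x y"
  shows "slope_bound d d'' (\<lambda>x. \<psi> (\<phi> x)) S z (B * A)"
  unfolding slope_bound_def
proof (intro allI impI)
  fix \<eta> :: real assume \<eta>: "0 < \<eta>"
  \<comment> \<open>Small enough that (B + e) * (A + e) \<le> B * A + \<eta>.\<close>
  define e where "e = min 1 (\<eta> / (A + B + 1))"
  have e: "0 < e" "e \<le> 1" using \<eta> nn by (auto simp: e_def)
  have "(B + e) * (A + e) = B * A + e * (A + B + e)" by (simp add: algebra_simps)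
  also have "e * (A + B + e) \<le> e * (A + B + 1)" using e by (intro mult_left_mono) auto
  also have "\<dots> \<le> \<eta> / (A + B + 1) * (A + B + 1)" using nn by (intro mult_right_mono) (auto simp: e_def)
  also have "\<dots> = \<eta>" using nn by simp
  finally have e2: "(B + e) * (A + e) \<le> B * A + \<eta>" by simp
  obtain \<delta>1 where 1: "0 < \<delta>1" "\<And>x. x \<in> S \<Longrightarrow> d x z < \<delta>1 \<Longrightarrow> d' (\<phi> x) (\<phi> z) \<le> (A + e) * d x z"
    using \<phi> e(1) unfolding slope_bound_def by blast
  obtain \<delta>2 where 2: "0 < \<delta>2" "\<And>y. y \<in> T \<Longrightarrow> d' y (\<phi> z) < \<delta>2 \<Longrightarrow> d'' (\<psi> y) (\<psi> (\<phi> z)) \<le> (B + e) * d' y (\<phi> z)"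
    using \<psi> e(1) unfolding slope_bound_def by blast
  have Ae: "0 < A + e" using nn e by linarith
  show "\<exists>\<delta>>0. \<forall>x\<in>S. d x z < \<delta> \<longrightarrow> d'' (\<psi> (\<phi> x)) (\<psi> (\<phi> z)) \<le> (B * A + \<eta>) * d x z"
  proof (intro exI[of _ "min \<delta>1 (\<delta>2 / (A + e))"] conjI ballI impI)
    show "0 < min \<delta>1 (\<delta>2 / (A + e))" using 1 2 Ae by simp
    fix x assume x: "x \<in> S" "d x z < min \<delta>1 (\<delta>2 / (A + e))"
    have d1: "d' (\<phi> x) (\<phi> z) \<le> (A + e) * d x z" using 1(2)[OF x(1)] x(2) by simp
    also have "\<dots> < \<delta>2" using x(2) Ae by (simp add: pos_less_divide_eq mult.commute)
    finally have "d'' (\<psi> (\<phi> x)) (\<psi> (\<phi> z)) \<le> (B + e) * d' (\<phi> x) (\<phi> z)" using 2(2)[OF sub[OF x(1)]] by simp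
    also have "\<dots> \<le> (B + e) * ((A + e) * d x z)" using d1 nn e by (intro mult_left_mono) auto
    also have "\<dots> = ((B + e) * (A + e)) * d x z" by simp
    also have "\<dots> \<le> (B * A + \<eta>) * d x z" using e2 nn(3) by (intro mult_right_mono) auto
    finally show "d'' (\<psi> (\<phi> x)) (\<psi> (\<phi> z)) \<le> (B * A + \<eta>) * d x z" .
  qed
qed

lemma slope_bound_deriv:
  fixes \<psi> :: "real \<Rightarrow> real"
  assumes "(\<psi> has_real_derivative D) (at y)"
  shows "slope_bound (\<lambda>a b. \<bar>a - b\<bar>) (\<lambda>a b. \<bar>a - b\<bar>) \<psi> UNIV y \<bar>D\<bar>"
  unfolding slope_bound_def
proof (intro allI impI)
  fix \<eta> :: real assume \<eta>: "0 < \<eta>"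
  have "((\<lambda>t. (\<psi> t - \<psi> y) / (t - y)) \<longlongrightarrow> D) (at y)"
    using assms by (simp add: has_field_derivative_iff)
  then obtain \<delta> where \<delta>: "0 < \<delta>" "\<And>t. t \<noteq> y \<Longrightarrow> \<bar>t - y\<bar> < \<delta> \<Longrightarrow> \<bar>(\<psi> t - \<psi> y) / (t - y) - D\<bar> < \<eta>"
    using \<eta> unfolding LIM_eq by (metis real_norm_def)
  show "\<exists>\<delta>>0. \<forall>x\<in>UNIV. \<bar>x - y\<bar> < \<delta> \<longrightarrow> \<bar>\<psi> x - \<psi> y\<bar> \<le> (\<bar>D\<bar> + \<eta>) * \<bar>x - y\<bar>"
  proof (intro exI[of _ \<delta>] conjI \<delta>(1) ballI impI)
    fix t assume t: "\<bar>t - y\<bar> < \<delta>"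
    show "\<bar>\<psi> t - \<psi> y\<bar> \<le> (\<bar>D\<bar> + \<eta>) * \<bar>t - y\<bar>"
    proof (cases "t = y")
      case False
      have "\<bar>(\<psi> t - \<psi> y) / (t - y)\<bar> \<le> \<bar>D\<bar> + \<eta>" using \<delta>(2)[OF False t] by linarith
      then show ?thesis using False by (simp add: abs_divide pos_divide_le_eq)
    qed simp
  qed
qed

lemma slope_bound_radial_projection:
  assumes z: "0 < vnorm N z"
  shows "slope_bound (vdist N) (vdist N) (radial_projection N) S z (sqrt (real N) / vnorm N z)"
  unfolding slope_bound_def
proof (intro allI impI)
  fix \<eta> :: real assume \<eta>: "0 < \<eta>"
  let ?b = "vnorm N z"
  have "((\<lambda>r. sqrt (real N) / sqrt (r * ?b)) \<longlongrightarrow> sqrt (real N) / sqrt (?b * ?b)) (at ?b)"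
    using z by (intro tendsto_intros) auto
  then obtain \<delta> where \<delta>: "0 < \<delta>" "\<And>r. r \<noteq> ?b \<Longrightarrow> \<bar>r - ?b\<bar> < \<delta> \<Longrightarrow> \<bar>sqrt (real N) / sqrt (r * ?b) - sqrt (real N) / sqrt (?b * ?b)\<bar> < \<eta>"
    using \<eta> unfolding LIM_eq by (metis real_norm_def)
  show "\<exists>\<delta>>0. \<forall>x\<in>S. vdist N x z < \<delta> \<longrightarrow>
     vdist N (radial_projection N x) (radial_projection N z) \<le> (sqrt (real N) / ?b + \<eta>) * vdist N x z"
  proof (intro exI[of _ "min \<delta> ?b"] conjI ballI impI)
    show "0 < min \<delta> ?b" using \<delta> z by simp
    fix x assume "vdist N x z < min \<delta> ?b"
    then have d: "vdist N x z < \<delta>" "vdist N x z < ?b" by auto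
    let ?a = "vnorm N x"
    have a: "0 < ?a" using vdist_triangle_norm[where N = N and z = z and x = x] d by linarith
    have "\<bar>?a - ?b\<bar> \<le> vdist N x z"
      using vdist_triangle_norm[where N = N and z = z and x = x] vdist_triangle_norm[where N = N and z = x and x = z] vdist_commute[of x z N] by linarith
    then have ab: "\<bar>?a - ?b\<bar> < \<delta>" using d by linarith
    have "sqrt (real N) / sqrt (?a * ?b) \<le> sqrt (real N) / ?b + \<eta>"
    proof (cases "?a = ?b")
      case True
      then show ?thesis using z \<eta> by simp
    next
      case False
      then show ?thesis using \<delta>(2)[OF False ab] z by simp
    qed
    then have "sqrt (real N) / sqrt (?a * ?b) * vdist N x z \<le> (sqrt (real N) / ?b + \<eta>) * vdist N x z"
      by (intro mult_right_mono) auto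
    then show "vdist N (radial_projection N x) (radial_projection N z) \<le> (sqrt (real N) / ?b + \<eta>) * vdist N x z"
      using vdist_radial_projection[OF a z] by linarith
  qed
qed

section \<open>Radial integrals and the angular marginal\<close>

text \<open>The radial integral along the ray through a point of the sphere, where b is \<beta>
  times the energy of that point. By homogeneity of degree p, the factor exp (- \<beta> H) at s
  times the point is the Gibbs weight times exp (b (1 - s^p)). q is the power of 1 / norm x in the
  integrand: 0 for entropies, 2 for squared slopes.\<close>

definition radial_density :: "nat \<Rightarrow> nat \<Rightarrow> nat \<Rightarrow> real \<Rightarrow> ennreal" where
  "radial_density N p q b = (\<integral>\<^sup>+s. indicator {0<..<1} s *
     ennreal (s ^ (N - 1 - q) * exp (- real N * s\<^sup>2 / 4 + b * (1 - s ^ p))) \<partial>lborel)"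

lemma one_minus_power_bounds:
  fixes s :: real
  assumes "0 \<le> s" "s \<le> 1"
  shows "0 \<le> 1 - s ^ p" "1 - s ^ p \<le> real p * (1 - s)"
proof -
  show "0 \<le> 1 - s ^ p" using assms by (simp add: power_le_one)
  have "1 + real p * (s - 1) \<le> (1 + (s - 1)) ^ p" using assms by (intro Bernoulli_inequality) auto
  then show "1 - s ^ p \<le> real p * (1 - s)" by (simp add: algebra_simps)
qed

lemma radial_exponent_bound:
  assumes b: "\<bar>b\<bar> * real p \<le> real N / 8" and s: "0 \<le> s" "s \<le> 1"
  shows "\<bar>b * (1 - s ^ p)\<bar> \<le> real N / 8 * (1 - s)"
proof -
  have "\<bar>b * (1 - s ^ p)\<bar> = \<bar>b\<bar> * (1 - s ^ p)" using one_minus_power_bounds(1)[OF s, of p] by (simp add: abs_mult)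
  also have "\<dots> \<le> \<bar>b\<bar> * (real p * (1 - s))" using one_minus_power_bounds(2)[OF s, of p] by (intro mult_left_mono) auto
  also have "\<dots> = (\<bar>b\<bar> * real p) * (1 - s)" by simp
  also have "\<dots> \<le> real N / 8 * (1 - s)" using b s by (intro mult_right_mono) auto
  finally show ?thesis .
qed

text \<open>From s^m \<le> exp (- m (1 - s)) and 1 - s^2 \<le> 2 (1 - s) the exponent is at most -
  N/4 - (N - 3 - N/2 - N/8) (1 - s), and the bracket is at least N/8 exactly when N \<ge> 12.
  Integrating exp (- (N/8) (1 - s)) gives at most 8 / N.\<close>

lemma radial_density_le:
  assumes N: "12 \<le> N" and q: "q \<le> 2" and b: "\<bar>b\<bar> * real p \<le> real N / 8"
  shows "radial_density N p q b \<le> ennreal (8 / real N * exp (- real N / 4))"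
proof -
  let ?a = "real N / 8"
  have a: "0 < ?a" using N by simp
  have "radial_density N p q b \<le> (\<integral>\<^sup>+s. ennreal (exp (- real N / 4) * exp (- ?a * (1 - s))) * indicator {0..1} s \<partial>lborel)"
    unfolding radial_density_def
  proof (rule nn_integral_mono)
    fix s :: real
    show "indicator {0<..<1} s * ennreal (s ^ (N - 1 - q) * exp (- real N * s\<^sup>2 / 4 + b * (1 - s ^ p)))
      \<le> ennreal (exp (- real N / 4) * exp (- ?a * (1 - s))) * indicator {0..1} s"
    proof (cases "s \<in> {0<..<1}")
      case True
      then have s: "0 < s" "s < 1" by auto
      let ?m = "N - 1 - q"
      have "s \<le> exp (s - 1)" using exp_ge_add_one_self[of "s - 1"] by simp
      then have "s ^ ?m \<le> exp (s - 1) ^ ?m" using s by (intro power_mono) auto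
      also have "\<dots> = exp (real ?m * (s - 1))" by (rule exp_of_nat_mult[symmetric])
      finally have "s ^ ?m * exp (- real N * s\<^sup>2 / 4 + b * (1 - s ^ p)) \<le> exp (real ?m * (s - 1)) * exp (- real N * s\<^sup>2 / 4 + b * (1 - s ^ p))"
        by (intro mult_right_mono) auto
      also have "\<dots> = exp (real ?m * (s - 1) + (- real N * s\<^sup>2 / 4 + b * (1 - s ^ p)))" by (rule exp_add[symmetric])
      also have "\<dots> \<le> exp (- real N / 4 + (- ?a * (1 - s)))"
      proof (subst exp_le_cancel_iff)
        have m: "real N - 3 \<le> real ?m" using N q by linarith
        have "real N * (1 - s\<^sup>2) \<le> real N * (2 * (1 - s))"
          using zero_le_power2[of "1 - s"] by (intro mult_left_mono) (auto simp: power2_eq_square algebra_simps)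
        moreover have "b * (1 - s ^ p) \<le> ?a * (1 - s)" using radial_exponent_bound[OF b, of s] s by (simp add: abs_le_iff)
        moreover have "(real N - 3) * (1 - s) \<le> real ?m * (1 - s)" using m s by (intro mult_right_mono) auto
        moreover have "12 * (1 - s) \<le> real N * (1 - s)" using N s by (intro mult_right_mono) auto
        moreover have "m * (s - 1) + (- r * s\<^sup>2 / 4 + c) \<le> - r / 4 + (- (r / 8) * (1 - s))"
          if "r * (1 - s\<^sup>2) \<le> r * (2 * (1 - s))" "c \<le> r / 8 * (1 - s)" "(r - 3) * (1 - s) \<le> m * (1 - s)"
            "12 * (1 - s) \<le> r * (1 - s)" for m r c :: real
          using that by (simp add: algebra_simps diff_divide_distrib add_divide_distrib)
        ultimately show "real ?m * (s - 1) + (- real N * s\<^sup>2 / 4 + b * (1 - s ^ p)) \<le> - real N / 4 + (- ?a * (1 - s))"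
          by blast
      qed
      finally show ?thesis using True by (simp add: mult_exp_exp ennreal_leI)
    qed simp
  qed
  also have "\<dots> = ennreal (exp (- real N / 4) / ?a * exp (- ?a * (1 - 1)) - exp (- real N / 4) / ?a * exp (- ?a * (1 - 0)))"
    by (rule nn_integral_FTC_Icc) (use a in \<open>auto intro!: derivative_eq_intros simp: field_simps\<close>)
  also have "\<dots> \<le> ennreal (8 / real N * exp (- real N / 4))"
  proof (rule ennreal_leI)
    have "0 \<le> exp (- real N / 4) / ?a * exp (- ?a * (1 - 0))" using a by simp
    moreover have "exp (- real N / 4) / ?a * exp (- ?a * (1 - 1)) = 8 / real N * exp (- real N / 4)" by simp
    ultimately show "exp (- real N / 4) / ?a * exp (- ?a * (1 - 1)) - exp (- real N / 4) / ?a * exp (- ?a * (1 - 0))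
      \<le> 8 / real N * exp (- real N / 4)" by linarith
  qed
  finally show ?thesis .
qed

text \<open>Only the layer 1 - 1/N < s < 1 is kept: there s^(N-1) \<ge> exp (- 1) and the energy
  term is at least - 1/8, which together give 9/8.\<close>

lemma radial_density_ge:
  assumes N: "1 < N" and b: "\<bar>b\<bar> * real p \<le> real N / 8"
  shows "ennreal (1 / real N * exp (- real N / 4) * exp (- 9 / 8)) \<le> radial_density N p 0 b"
proof -
  let ?l = "1 - 1 / real N" and ?c = "exp (- real N / 4) * exp (- 9 / 8)"
  have l: "0 < ?l" "?l < 1" using N by auto
  have "ennreal (1 / real N * exp (- real N / 4) * exp (- 9 / 8)) = ennreal ?c * ennreal (1 - ?l)"
    using N by (simp add: ennreal_mult[symmetric])
  also have "\<dots> = ennreal ?c * emeasure lborel {?l<..<1}"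
    using l by (subst emeasure_lborel_Ioo) auto
  also have "\<dots> = (\<integral>\<^sup>+s. ennreal ?c * indicator {?l<..<1} s \<partial>lborel)"
    by (rule nn_integral_cmult_indicator[symmetric]) simp
  also have "\<dots> \<le> radial_density N p 0 b"
    unfolding radial_density_def
  proof (rule nn_integral_mono)
    fix s :: real
    show "ennreal ?c * indicator {?l<..<1} s \<le> indicator {0<..<1} s *
       ennreal (s ^ (N - 1 - 0) * exp (- real N * s\<^sup>2 / 4 + b * (1 - s ^ p)))"
    proof (cases "s \<in> {?l<..<1}")
      case True
      then have "s < 1" "?l < s" by simp_all
      then have s: "0 < s" "s < 1" "?l < s" using less_trans[OF l(1)] by blast+
      let ?n = "N - 1"
      have n: "0 < ?n" "real N = real ?n + 1" using N by auto
      have "exp (-1) \<le> s ^ ?n"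
      proof -
        have "0 < s * ?l" using s(1) l(1) by (rule mult_pos_pos)
        then have "1 / s \<le> 1 / ?l" using s(3) by (intro divide_left_mono) auto
        also have "\<dots> = 1 + 1 / real ?n" using n by (simp add: field_simps)
        also have "\<dots> \<le> exp (1 / real ?n)" by (rule exp_ge_add_one_self)
        finally have "(1 / s) ^ ?n \<le> exp (1 / real ?n) ^ ?n" using s by (intro power_mono) auto
        also have "\<dots> = exp 1" using n by (simp add: exp_of_nat_mult[symmetric])
        finally have "1 / s ^ ?n \<le> exp 1" by (simp add: power_one_over)
        then show ?thesis using s by (simp add: exp_minus field_simps)
      qed
      moreover have "exp (- real N / 4 - 1 / 8) \<le> exp (- real N * s\<^sup>2 / 4 + b * (1 - s ^ p))"
      proof (subst exp_le_cancel_iff)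
        have "real N * s\<^sup>2 \<le> real N * 1" using s by (intro mult_left_mono) (auto simp: power_le_one)
        moreover have "- (real N / 8 * (1 - s)) \<le> b * (1 - s ^ p)"
          using radial_exponent_bound[OF b, of s] s by (simp add: abs_le_iff)
        moreover have "real N * (1 - s) \<le> 1" using s(3) N by (simp add: field_simps)
        ultimately show "- real N / 4 - 1 / 8 \<le> - real N * s\<^sup>2 / 4 + b * (1 - s ^ p)" by simp
      qed
      ultimately have "exp (-1) * exp (- real N / 4 - 1 / 8) \<le> s ^ ?n * exp (- real N * s\<^sup>2 / 4 + b * (1 - s ^ p))"
        using s by (intro mult_mono) auto
      moreover have "exp (-1) * exp (- real N / 4 - 1 / 8) = ?c" by (simp add: mult_exp_exp)
      ultimately show ?thesis using True s by (simp add: ennreal_leI)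
    qed simp
  qed
  finally show ?thesis .
qed

lemma hamiltonian_scale_vector: "hamiltonian N p J (scale_vector N s \<sigma>) = s ^ p * hamiltonian N p J \<sigma>"
proof -
  have "(\<Prod>k<p. scale_vector N s \<sigma> (i k)) = s ^ p * (\<Prod>k<p. \<sigma> (i k))" if "i \<in> spin_indices N p" for i
  proof -
    have "(\<Prod>k<p. scale_vector N s \<sigma> (i k)) = (\<Prod>k<p. s * \<sigma> (i k))"
      using that by (intro prod.cong) (auto simp: scale_vector_def PiE_iff)
    then show ?thesis by (simp add: prod.distrib)
  qed
  then show ?thesis by (simp add: hamiltonian_def sum_distrib_left mult_ac)
qed

definition ball_potential :: "nat \<Rightarrow> nat \<Rightarrow> real \<Rightarrow> ((nat \<Rightarrow> nat) \<Rightarrow> real) \<Rightarrow> (nat \<Rightarrow> real) \<Rightarrow> real" where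
  "ball_potential N p \<beta> J x = (vnorm N x)\<^sup>2 / 4 + \<beta> * hamiltonian N p J x"

lemma hamiltonian_measurable [measurable]: "hamiltonian N p J \<in> borel_measurable (lebesgue_vectors N)"
  using measurable_compose[OF measurable_lebesgue_vectors_borel borel_measurable_continuous_onI[OF hamiltonian_continuous]] .

lemma ball_potential_measurable [measurable]: "ball_potential N p \<beta> J \<in> borel_measurable (lebesgue_vectors N)"
  unfolding ball_potential_def[abs_def] by measurable

lemma nn_integral_ball_radial:
  assumes N: "3 < N" and q: "q \<le> 2" and g: "g \<in> borel_measurable (sphere_sigma N)"
  shows "(\<integral>\<^sup>+x. indicator {x \<in> space (lebesgue_vectors N). (\<Sum>i<N. (x i)\<^sup>2) < real N} x *
      (ennreal ((sqrt (real N) / vnorm N x) ^ q * exp (- ball_potential N p \<beta> J x)) * g (radial_projection N x)) \<partial>lebesgue_vectors N)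
    = ennreal (sqrt (real N)) * (\<integral>\<^sup>+\<sigma>. g \<sigma> * ennreal (gibbs_weight N p \<beta> J \<sigma>) * radial_density N p q (\<beta> * hamiltonian N p J \<sigma>) \<partial>sphere_volume N)"
proof -
  have N0: "0 < N" using N by simp
  let ?V = "sphere_volume N"
  interpret V: finite_measure ?V
    by (rule finite_measureI) (use sphere_volume_finite_pos[OF N0] in \<open>auto simp: space_sphere_volume\<close>)
  interpret P: pair_sigma_finite lborel ?V ..
  let ?F = "\<lambda>x. ennreal ((sqrt (real N) / vnorm N x) ^ q * exp (- ball_potential N p \<beta> J x)) * g (radial_projection N x)"
  have gm[measurable]: "(\<lambda>x. g (radial_projection N x)) \<in> borel_measurable (lebesgue_vectors N)"
    by (rule measurable_compose[OF radial_projection_measurable[OF N0] g])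
  have Hs: "hamiltonian N p J \<in> borel_measurable ?V"
    unfolding measurable_sphere_volume by (rule continuous_on_sphere_measurable[OF hamiltonian_continuous])
  have gV: "g \<in> borel_measurable ?V" using g by (simp add: measurable_sphere_volume)
  have wV: "gibbs_weight N p \<beta> J \<in> borel_measurable ?V" using gibbs_weight_measurable by (simp add: measurable_sphere_volume)
  note [measurable] = Hs gV wV
  let ?b = "\<lambda>\<sigma>. \<beta> * hamiltonian N p J \<sigma>"
  let ?k = "\<lambda>s \<sigma>. g \<sigma> * ennreal (gibbs_weight N p \<beta> J \<sigma>) *
     (indicator {0<..<1} s * ennreal (s ^ (N - 1 - q) * exp (- real N * s\<^sup>2 / 4 + ?b \<sigma> * (1 - s ^ p))))"
  have "(\<integral>\<^sup>+x. indicator {x \<in> space (lebesgue_vectors N). (\<Sum>i<N. (x i)\<^sup>2) < real N} x * ?F x \<partial>lebesgue_vectors N)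
     = ennreal (sqrt (real N)) * (\<integral>\<^sup>+s. indicator {0<..<1} s * (ennreal (s ^ (N - 1)) *
       (\<integral>\<^sup>+\<sigma>. ?F (scale_vector N s \<sigma>) \<partial>?V)) \<partial>lborel)"
    by (rule nn_integral_ball[OF N0]) measurable
  also have "(\<integral>\<^sup>+s. indicator {0<..<1} s * (ennreal (s ^ (N - 1)) * (\<integral>\<^sup>+\<sigma>. ?F (scale_vector N s \<sigma>) \<partial>?V)) \<partial>lborel)
     = (\<integral>\<^sup>+s. (\<integral>\<^sup>+\<sigma>. ?k s \<sigma> \<partial>?V) \<partial>lborel)"
  proof (rule nn_integral_cong)
    fix s :: real
    show "indicator {0<..<1} s * (ennreal (s ^ (N - 1)) * (\<integral>\<^sup>+\<sigma>. ?F (scale_vector N s \<sigma>) \<partial>?V)) = (\<integral>\<^sup>+\<sigma>. ?k s \<sigma> \<partial>?V)"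
    proof (cases "s \<in> {0<..<1}")
      case True
      then have s: "0 < s" by simp
      have "ennreal (s ^ (N - 1)) * ?F (scale_vector N s \<sigma>) = ?k s \<sigma>" if \<sigma>: "\<sigma> \<in> spin_sphere N" for \<sigma>
      proof -
        have v: "vnorm N (scale_vector N s \<sigma>) = s * sqrt (real N)"
          using s \<sigma> by (simp add: vnorm_scale_vector spin_sphere_vnorm)
        have r: "sqrt (real N) / (s * sqrt (real N)) = 1 / s" using N0 by simp
        have e: "exp (- ball_potential N p \<beta> J (scale_vector N s \<sigma>)) = gibbs_weight N p \<beta> J \<sigma> * exp (- real N * s\<^sup>2 / 4 + ?b \<sigma> * (1 - s ^ p))"
          unfolding ball_potential_def v hamiltonian_scale_vector gibbs_weight_def
          by (simp add: mult_exp_exp power_mult_distrib algebra_simps)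
        \<comment> \<open>The Jacobian absorbs the singularity s^(- q) at the origin; the
          subtraction of naturals is exact because q \<le> 2 and N > 3.\<close>
        have pw: "s ^ (N - 1) * (1 / s) ^ q = s ^ (N - 1 - q)"
          using s q N by (simp add: power_diff power_one_over)
        have "ennreal (s ^ (N - 1)) * ennreal ((1 / s) ^ q * exp (- ball_potential N p \<beta> J (scale_vector N s \<sigma>)))
          = ennreal (s ^ (N - 1) * ((1 / s) ^ q * exp (- ball_potential N p \<beta> J (scale_vector N s \<sigma>))))"
          using s by (simp add: ennreal_mult[symmetric])
        also have "s ^ (N - 1) * ((1 / s) ^ q * exp (- ball_potential N p \<beta> J (scale_vector N s \<sigma>)))
           = gibbs_weight N p \<beta> J \<sigma> * (s ^ (N - 1 - q) * exp (- real N * s\<^sup>2 / 4 + ?b \<sigma> * (1 - s ^ p)))"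
          unfolding e pw[symmetric] by (simp add: mult_ac)
        also have "ennreal \<dots> = ennreal (gibbs_weight N p \<beta> J \<sigma>) * ennreal (s ^ (N - 1 - q) * exp (- real N * s\<^sup>2 / 4 + ?b \<sigma> * (1 - s ^ p)))"
          using s by (intro ennreal_mult) (auto simp: gibbs_weight_def)
        finally show ?thesis
          unfolding v r radial_projection_scale_vector[OF N0 s \<sigma>] mult.assoc[symmetric]
          using True by (simp add: mult_ac)
      qed
      moreover have "(\<lambda>\<sigma>. ?F (scale_vector N s \<sigma>)) \<in> borel_measurable ?V"
      proof -
        have "(\<lambda>\<sigma>. \<sigma>) \<in> sphere_sigma N \<rightarrow>\<^sub>M lebesgue_vectors N"
          unfolding sphere_sigma_def by (rule measurable_restrict_space1)
            (use measurable_cong_sets[OF refl sets_lebesgue_vectors] in \<open>blast intro: measurable_ident_sets\<close>)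
        from measurable_compose[OF this measurable_compose[OF scale_vector_measurable, of ?F]]
        show ?thesis unfolding measurable_sphere_volume by measurable
      qed
      ultimately show ?thesis using True
        by (subst nn_integral_cmult[symmetric]) (auto intro!: nn_integral_cong simp: space_sphere_volume)
    qed simp
  qed
  also have "\<dots> = (\<integral>\<^sup>+\<sigma>. (\<integral>\<^sup>+s. ?k s \<sigma> \<partial>lborel) \<partial>?V)"
  proof (rule P.Fubini'[symmetric])
    have "(\<lambda>x. ?k (fst x) (snd x)) \<in> borel_measurable (lborel \<Otimes>\<^sub>M ?V)" by measurable
    then show "(\<lambda>(s, \<sigma>). ?k s \<sigma>) \<in> borel_measurable (lborel \<Otimes>\<^sub>M ?V)" by (simp only: case_prod_unfold)
  qed
  also have "\<dots> = (\<integral>\<^sup>+\<sigma>. g \<sigma> * ennreal (gibbs_weight N p \<beta> J \<sigma>) * radial_density N p q (?b \<sigma>) \<partial>?V)"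
    unfolding radial_density_def by (intro nn_integral_cong nn_integral_cmult) measurable
  finally show ?thesis .
qed

section \<open>Strong convexity of the potential on the ball\<close>

definition origin_ball :: "nat \<Rightarrow> (nat \<Rightarrow> real) set" where
  "origin_ball N = {x \<in> space (lebesgue_vectors N). (\<Sum>i<N. (x i)\<^sup>2) < real N}"

lemma origin_ball_iff: "x \<in> origin_ball N \<longleftrightarrow> x \<in> euclidean_vectors N \<and> vnorm N x < sqrt (real N)"
  by (auto simp: origin_ball_def space_PiM L2_set_def)

lemma vnorm_convex_comb_sq:
  "(vnorm N (convex_comb N t x y))\<^sup>2 = t * (vnorm N x)\<^sup>2 + (1 - t) * (vnorm N y)\<^sup>2 - t * (1 - t) * (vdist N x y)\<^sup>2"
proof -
  have "(vnorm N (convex_comb N t x y))\<^sup>2 = (\<Sum>i<N. t * (x i)\<^sup>2 + (1 - t) * (y i)\<^sup>2 - t * (1 - t) * (x i - y i)\<^sup>2)"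
  proof (subst vnorm_sq, rule sum.cong[OF refl])
    fix i assume "i \<in> {..<N}"
    then show "(convex_comb N t x y i)\<^sup>2 = t * (x i)\<^sup>2 + (1 - t) * (y i)\<^sup>2 - t * (1 - t) * (x i - y i)\<^sup>2"
      by (simp add: convex_comb_def power2_eq_square algebra_simps)
  qed
  then show ?thesis by (simp only: sum.distrib sum_subtractf sum_distrib_left vnorm_sq)
qed

text \<open>(norm x)^2 / 4 has convexity modulus 1/2; by \<open>hamiltonian_semiconvex\<close> the
  energy takes away at most 2 * \<open>\<beta> * C * p^2\<close> \<le> 1/4 of it, and 1/4
  remains.\<close>

lemma strongly_log_concave_ball:
  assumes N: "0 < N" and p: "2 \<le> p" and C: "0 \<le> C" and J: "J \<in> good_disorder N p C"
    and \<beta>: "0 \<le> \<beta>" "\<beta> * C * (real p)\<^sup>2 \<le> 1 / 8"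
  shows "strongly_log_concave N (origin_ball N) (ball_potential N p \<beta> J) (1 / 4) (sqrt (real N)) (real N / 4 + \<beta> * (C * real N))"
proof
  show "origin_ball N \<subseteq> euclidean_vectors N" by (auto simp: origin_ball_iff)
  show "origin_ball N \<in> sets (lebesgue_vectors N)" unfolding origin_ball_def by (rule ball_measurable)
  show "0 < emeasure (lebesgue_vectors N) (origin_ball N)" unfolding origin_ball_def by (rule emeasure_ball_pos[OF N])
  show "ball_potential N p \<beta> J \<in> borel_measurable (lebesgue_vectors N)" by (rule ball_potential_measurable)
next
  fix x i assume "x \<in> origin_ball N" "i < N"
  then show "\<bar>x i\<bar> \<le> sqrt (real N)"
    using coordinate_le_vdist[of i N x "\<lambda>_. 0"] by (simp add: origin_ball_iff)
next
  fix x y and t :: real assume x: "x \<in> origin_ball N" and y: "y \<in> origin_ball N" and t: "0 < t" "t < 1"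
  let ?m = "max (vnorm N x) (vnorm N y)" and ?z = "convex_comb N t x y"
  have "vnorm N ?z \<le> ?m" using t by (intro vnorm_convex_comb) auto
  moreover have "?m < sqrt (real N)" using x y unfolding origin_ball_iff by simp
  ultimately have "vnorm N ?z < sqrt (real N)" by (rule order_le_less_trans)
  moreover have "?z \<in> euclidean_vectors N" unfolding convex_comb_def by (rule restrict_PiE_iff[THEN iffD2]) simp
  ultimately show "?z \<in> origin_ball N" unfolding origin_ball_iff by blast
  let ?H = "hamiltonian N p J" and ?d = "(vdist N x y)\<^sup>2"
  have "\<bar>t * ?H x + (1 - t) * ?H y - ?H ?z\<bar> \<le> t * (1 - t) * ((real p)\<^sup>2 * C * ?d)"
    using x y t unfolding origin_ball_iff by (intro hamiltonian_semiconvex[OF N p C J]) simp_all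
  then have "?H ?z \<le> t * ?H x + (1 - t) * ?H y + t * (1 - t) * ((real p)\<^sup>2 * C * ?d)" by linarith
  then have "\<beta> * ?H ?z \<le> \<beta> * (t * ?H x + (1 - t) * ?H y + t * (1 - t) * ((real p)\<^sup>2 * C * ?d))"
    using \<beta>(1) by (rule mult_left_mono)
  also have "\<dots> = t * (\<beta> * ?H x) + (1 - t) * (\<beta> * ?H y) + (\<beta> * C * (real p)\<^sup>2) * (t * (1 - t) * ?d)"
    by (simp add: algebra_simps)
  also have "(\<beta> * C * (real p)\<^sup>2) * (t * (1 - t) * ?d) \<le> 1 / 8 * (t * (1 - t) * ?d)"
    using \<beta>(2) t by (intro mult_right_mono) auto
  finally show "ball_potential N p \<beta> J ?z \<le> t * ball_potential N p \<beta> J x + (1 - t) * ball_potential N p \<beta> J y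
       - 1 / 4 * t * (1 - t) / 2 * ?d"
    unfolding ball_potential_def vnorm_convex_comb_sq
    by (simp add: algebra_simps add_divide_distrib diff_divide_distrib)
next
  fix x assume x: "x \<in> origin_ball N"
  have "\<bar>hamiltonian N p J x\<bar> \<le> C * real N"
    using x p unfolding origin_ball_iff by (intro hamiltonian_bound[OF N _ C J]) simp_all
  then have "\<bar>\<beta> * hamiltonian N p J x\<bar> \<le> \<beta> * (C * real N)" using \<beta>(1) by (simp add: abs_mult mult_left_mono)
  moreover have "(vnorm N x)\<^sup>2 \<le> real N" using x by (simp add: origin_ball_def vnorm_sq)
  ultimately show "\<bar>ball_potential N p \<beta> J x\<bar> \<le> real N / 4 + \<beta> * (C * real N)"
    using zero_le_power2[of "vnorm N x"] unfolding ball_potential_def by arith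
qed simp

lemma AE_vnorm_pos:
  assumes "0 < N"
  shows "AE x in lebesgue_vectors N. 0 < vnorm N x"
proof (rule AE_I)
  show "{x \<in> space (lebesgue_vectors N). \<not> 0 < vnorm N x} \<subseteq> {..<N} \<rightarrow>\<^sub>E {0}"
  proof
    fix x assume "x \<in> {x \<in> space (lebesgue_vectors N). \<not> 0 < vnorm N x}"
    then have "x \<in> euclidean_vectors N" "vnorm N x = 0" by (auto simp: space_PiM less_le)
    then show "x \<in> {..<N} \<rightarrow>\<^sub>E {0}"
      by (intro PiE_I) (auto simp: L2_set_eq_0_iff PiE_iff extensional_def)
  qed
  show "emeasure (lebesgue_vectors N) ({..<N} \<rightarrow>\<^sub>E {0}) = 0"
    using assms by (subst lborel_prod.emeasure_PiM) (auto simp: power_0_left)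
  show "({..<N} \<rightarrow>\<^sub>E {0}) \<in> sets (lebesgue_vectors N)" by (intro sets_PiM_I_finite) auto
qed

text \<open>The global constant 1 / sqrt e blows up as e tends to 0, but it enters dominating
  functions only; the derivative 2 y / (y^2 + e) is what reaches the final estimate.\<close>

lemma log_regularized_lipschitz:
  fixes e :: real
  assumes e: "0 < e"
  shows "\<bar>ln (a\<^sup>2 + e) - ln (b\<^sup>2 + e)\<bar> \<le> 1 / sqrt e * \<bar>a - b\<bar>"
    and "((\<lambda>y. ln (y\<^sup>2 + e)) has_real_derivative 2 * y / (y\<^sup>2 + e)) (at y)"
    and "\<bar>2 * y / (y\<^sup>2 + e)\<bar> \<le> 1 / sqrt e"
proof -
  have pos: "0 < y\<^sup>2 + e" for y using e by (simp add: add_nonneg_pos)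
  show der: "((\<lambda>y. ln (y\<^sup>2 + e)) has_real_derivative 2 * y / (y\<^sup>2 + e)) (at y)" for y
    using pos[of y] by (auto intro!: derivative_eq_intros)
  show bound: "\<bar>2 * y / (y\<^sup>2 + e)\<bar> \<le> 1 / sqrt e" for y
  proof -
    have "0 \<le> (\<bar>y\<bar> - sqrt e)\<^sup>2" by simp
    also have "\<dots> = y\<^sup>2 + e - 2 * \<bar>y\<bar> * sqrt e" using e by (simp add: power2_diff)
    finally have "2 * \<bar>y\<bar> * sqrt e \<le> y\<^sup>2 + e" by simp
    then show ?thesis using pos[of y] e by (simp add: abs_mult abs_divide field_simps)
  qed
  have "norm (ln (a\<^sup>2 + e) - ln (b\<^sup>2 + e)) \<le> 1 / sqrt e * norm (a - b)"
    by (rule field_differentiable_bound[of UNIV "\<lambda>y. ln (y\<^sup>2 + e)" "\<lambda>y. 2 * y / (y\<^sup>2 + e)"]) (use der bound in auto)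
  then show "\<bar>ln (a\<^sup>2 + e) - ln (b\<^sup>2 + e)\<bar> \<le> 1 / sqrt e * \<bar>a - b\<bar>" by simp
qed

section \<open>Transfer of integrals between the ball and the sphere\<close>

locale sphere_extension_good = sphere_extension N f F U for N f F U +
  fixes p :: nat and C \<beta> :: real and J :: "(nat \<Rightarrow> nat) \<Rightarrow> real"
  assumes N12: "12 \<le> N" and p2: "2 \<le> p" and C0: "0 \<le> C" and J: "J \<in> good_disorder N p C"
    and \<beta>: "0 \<le> \<beta>" "\<beta> * C * (real p)\<^sup>2 \<le> 1 / 8"

sublocale sphere_extension_good \<subseteq> L: strongly_log_concave N "origin_ball N" "ball_potential N p \<beta> J" "1 / 4" "sqrt (real N)" "real N / 4 + \<beta> * (C * real N)"
  using strongly_log_concave_ball[OF N p2 C0 J \<beta>] .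

context sphere_extension_good
begin

abbreviation weight :: "(nat \<Rightarrow> real) \<Rightarrow> real" where
  "weight \<equiv> gibbs_weight N p \<beta> J"

abbreviation proj :: "(nat \<Rightarrow> real) \<Rightarrow> nat \<Rightarrow> real" where
  "proj \<equiv> radial_projection N"

lemma weight_pos: "0 < weight \<sigma>"
  by (simp add: gibbs_weight_def)

lemma proj_sphere [simp]: "proj x \<in> spin_sphere N"
  by (rule radial_projection_in_sphere[OF N])

lemma proj_measurable: "proj \<in> lebesgue_vectors N \<rightarrow>\<^sub>M sphere_sigma N"
  by (rule radial_projection_measurable[OF N])

lemma nn_integral_\<nu>:
  fixes G :: "(nat \<Rightarrow> real) \<Rightarrow> ennreal"
  assumes [measurable]: "G \<in> borel_measurable (lebesgue_vectors N)"
  shows "(\<integral>\<^sup>+x. G x \<partial>L.\<nu>) = (\<integral>\<^sup>+x. indicator (origin_ball N) x * (ennreal (exp (- ball_potential N p \<beta> J x)) * G x) \<partial>lebesgue_vectors N)"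
proof -
  have "(\<integral>\<^sup>+x. G x \<partial>L.\<nu>) = (\<integral>\<^sup>+x. ennreal (indicator (origin_ball N) x * exp (- ball_potential N p \<beta> J x)) * G x \<partial>lebesgue_vectors N)"
    unfolding L.\<nu>_def by (rule nn_integral_density) measurable
  then show ?thesis by (auto intro!: nn_integral_cong split: split_indicator)
qed

text \<open>Since p \<le> p^2, the smallness condition made for convexity also yields the hypothesis
  of the radial estimates.\<close>

lemma energy_bound:
  assumes "\<sigma> \<in> spin_sphere N"
  shows "\<bar>\<beta> * hamiltonian N p J \<sigma>\<bar> * real p \<le> real N / 8"
proof -
  have "\<bar>hamiltonian N p J \<sigma>\<bar> \<le> C * real N"
    using p2 assms by (intro hamiltonian_bound[OF N _ C0 J]) (auto simp: spin_sphere_vnorm)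
  then have "\<bar>\<beta> * hamiltonian N p J \<sigma>\<bar> * real p \<le> (\<beta> * (C * real N)) * real p"
    using \<beta>(1) by (intro mult_right_mono) (auto simp: abs_mult mult_left_mono)
  also have "\<dots> = (\<beta> * C * real p) * real N" by simp
  also have "\<dots> \<le> (\<beta> * C * (real p)\<^sup>2) * real N"
    using \<beta>(1) C0 p2 by (intro mult_right_mono mult_left_mono) (auto simp: power2_eq_square)
  also have "\<dots> \<le> 1 / 8 * real N" using \<beta>(2) by (rule mult_right_mono) simp
  finally show ?thesis by simp
qed

text \<open>Both radial bounds carry the factor exp (- N/4) / N; only their ratio 8 * exp (9/8)
  survives in the end, and it is free of N.\<close>

definition \<rho>_lower :: real where "\<rho>_lower = 1 / real N * exp (- real N / 4) * exp (- 9 / 8)"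
definition \<rho>_upper :: real where "\<rho>_upper = 8 / real N * exp (- real N / 4)"

lemma nn_integral_proj_ge:
  assumes k: "k \<in> borel_measurable (sphere_sigma N)"
  shows "ennreal (sqrt (real N) * \<rho>_lower) * (\<integral>\<^sup>+\<sigma>. k \<sigma> * ennreal (weight \<sigma>) \<partial>sphere_volume N) \<le> (\<integral>\<^sup>+x. k (proj x) \<partial>L.\<nu>)"
proof -
  have km[measurable]: "k \<in> borel_measurable (sphere_volume N)" "weight \<in> borel_measurable (sphere_volume N)"
    using k gibbs_weight_measurable by (simp_all add: measurable_sphere_volume)
  have "(\<integral>\<^sup>+x. k (proj x) \<partial>L.\<nu>) = (\<integral>\<^sup>+x. indicator (origin_ball N) x *
      (ennreal ((sqrt (real N) / vnorm N x) ^ 0 * exp (- ball_potential N p \<beta> J x)) * k (proj x)) \<partial>lebesgue_vectors N)"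
    using nn_integral_\<nu>[OF measurable_compose[OF proj_measurable k]] by simp
  also have "\<dots> = ennreal (sqrt (real N)) * (\<integral>\<^sup>+\<sigma>. k \<sigma> * ennreal (weight \<sigma>) * radial_density N p 0 (\<beta> * hamiltonian N p J \<sigma>) \<partial>sphere_volume N)"
    unfolding origin_ball_def using N12 by (intro nn_integral_ball_radial k) auto
  also have "\<dots> \<ge> ennreal (sqrt (real N)) * (\<integral>\<^sup>+\<sigma>. k \<sigma> * ennreal (weight \<sigma>) * ennreal \<rho>_lower \<partial>sphere_volume N)"
    using N12 radial_density_ge[OF _ energy_bound]
    by (intro mult_left_mono nn_integral_mono) (auto simp: space_sphere_volume \<rho>_lower_def)
  also have "(\<integral>\<^sup>+\<sigma>. k \<sigma> * ennreal (weight \<sigma>) * ennreal \<rho>_lower \<partial>sphere_volume N) =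
      (\<integral>\<^sup>+\<sigma>. k \<sigma> * ennreal (weight \<sigma>) \<partial>sphere_volume N) * ennreal \<rho>_lower"
    by (rule nn_integral_multc) measurable
  finally show ?thesis
    by (subst ennreal_mult) (auto simp: \<rho>_lower_def mult_ac)
qed

lemma nn_integral_proj_le:
  assumes k: "k \<in> borel_measurable (sphere_sigma N)"
  shows "(\<integral>\<^sup>+x. ennreal ((sqrt (real N) / vnorm N x)\<^sup>2) * k (proj x) \<partial>L.\<nu>)
    \<le> ennreal (sqrt (real N) * \<rho>_upper) * (\<integral>\<^sup>+\<sigma>. k \<sigma> * ennreal (weight \<sigma>) \<partial>sphere_volume N)"
proof -
  have km[measurable]: "k \<in> borel_measurable (sphere_volume N)" "weight \<in> borel_measurable (sphere_volume N)"
    using k gibbs_weight_measurable by (simp_all add: measurable_sphere_volume)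
  have [measurable]: "(\<lambda>x. k (proj x)) \<in> borel_measurable (lebesgue_vectors N)"
    by (rule measurable_compose[OF proj_measurable k])
  have "(\<integral>\<^sup>+x. ennreal ((sqrt (real N) / vnorm N x)\<^sup>2) * k (proj x) \<partial>L.\<nu>) = (\<integral>\<^sup>+x. indicator (origin_ball N) x *
      (ennreal ((sqrt (real N) / vnorm N x)\<^sup>2 * exp (- ball_potential N p \<beta> J x)) * k (proj x)) \<partial>lebesgue_vectors N)"
    by (subst nn_integral_\<nu>) (auto intro!: nn_integral_cong simp: ennreal_mult mult_ac)
  also have "\<dots> = ennreal (sqrt (real N)) * (\<integral>\<^sup>+\<sigma>. k \<sigma> * ennreal (weight \<sigma>) * radial_density N p 2 (\<beta> * hamiltonian N p J \<sigma>) \<partial>sphere_volume N)"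
    unfolding origin_ball_def using N12 by (intro nn_integral_ball_radial k) auto
  also have "\<dots> \<le> ennreal (sqrt (real N)) * (\<integral>\<^sup>+\<sigma>. k \<sigma> * ennreal (weight \<sigma>) * ennreal \<rho>_upper \<partial>sphere_volume N)"
    using radial_density_le[OF N12 _ energy_bound]
    by (intro mult_left_mono nn_integral_mono) (auto simp: space_sphere_volume \<rho>_upper_def)
  also have "(\<integral>\<^sup>+\<sigma>. k \<sigma> * ennreal (weight \<sigma>) * ennreal \<rho>_upper \<partial>sphere_volume N) =
      (\<integral>\<^sup>+\<sigma>. k \<sigma> * ennreal (weight \<sigma>) \<partial>sphere_volume N) * ennreal \<rho>_upper"
    by (rule nn_integral_multc) measurable
  finally show ?thesis
    by (subst ennreal_mult) (auto simp: \<rho>_upper_def mult_ac)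
qed

lemma integrable_weighted:
  fixes k :: "(nat \<Rightarrow> real) \<Rightarrow> real"
  assumes k: "k \<in> borel_measurable (sphere_sigma N)" "\<And>\<sigma>. \<sigma> \<in> spin_sphere N \<Longrightarrow> \<bar>k \<sigma>\<bar> \<le> M"
  shows "integrable (sphere_volume N) (\<lambda>\<sigma>. k \<sigma> * weight \<sigma>)"
proof -
  obtain W where W: "\<And>\<sigma>. \<sigma> \<in> spin_sphere N \<Longrightarrow> \<bar>weight \<sigma>\<bar> \<le> W"
    using continuous_bounded_on_sphere[OF gibbs_weight_continuous[of "spin_sphere N" N p \<beta> J]] by blast
  show ?thesis
  proof (rule integrable_sphere_volume[OF N, of _ "\<bar>M\<bar> * W"])
    show "(\<lambda>\<sigma>. k \<sigma> * weight \<sigma>) \<in> borel_measurable (sphere_sigma N)"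
      by (intro borel_measurable_times k gibbs_weight_measurable)
    fix \<sigma> assume s: "\<sigma> \<in> spin_sphere N"
    show "\<bar>k \<sigma> * weight \<sigma>\<bar> \<le> \<bar>M\<bar> * W"
      unfolding abs_mult using k(2)[OF s] W[OF s] by (intro mult_mono) auto
  qed
qed

lemma integral_proj_ge:
  fixes k :: "(nat \<Rightarrow> real) \<Rightarrow> real"
  assumes k: "k \<in> borel_measurable (sphere_sigma N)" "\<And>\<sigma>. \<sigma> \<in> spin_sphere N \<Longrightarrow> 0 \<le> k \<sigma>" "\<And>\<sigma>. \<sigma> \<in> spin_sphere N \<Longrightarrow> k \<sigma> \<le> M"
  shows "sqrt (real N) * \<rho>_lower * (\<integral>\<sigma>. k \<sigma> * weight \<sigma> \<partial>sphere_volume N) \<le> (\<integral>x. k (proj x) \<partial>L.\<nu>)"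
proof -
  have i1: "integrable (sphere_volume N) (\<lambda>\<sigma>. k \<sigma> * weight \<sigma>)"
    by (rule integrable_weighted[of _ M]) (use k in \<open>auto simp: abs_of_nonneg\<close>)
  have i2: "integrable L.\<nu> (\<lambda>x. k (proj x))"
    by (rule L.integrable_bounded[of _ M]) (use k measurable_compose[OF proj_measurable k(1)] in \<open>auto simp: abs_of_nonneg\<close>)
  have \<rho>0: "0 \<le> sqrt (real N) * \<rho>_lower" by (simp add: \<rho>_lower_def)
  have I0: "0 \<le> (\<integral>\<sigma>. k \<sigma> * weight \<sigma> \<partial>sphere_volume N)"
    by (rule integral_nonneg_AE) (use k weight_pos in \<open>auto simp: space_sphere_volume less_imp_le\<close>)
  have "ennreal (sqrt (real N) * \<rho>_lower * (\<integral>\<sigma>. k \<sigma> * weight \<sigma> \<partial>sphere_volume N))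
     = ennreal (sqrt (real N) * \<rho>_lower) * (\<integral>\<^sup>+\<sigma>. ennreal (k \<sigma> * weight \<sigma>) \<partial>sphere_volume N)"
    using \<rho>0 I0 by (subst nn_integral_eq_integral[OF i1]) (use k weight_pos in \<open>auto simp: ennreal_mult space_sphere_volume less_imp_le\<close>)
  also have "(\<integral>\<^sup>+\<sigma>. ennreal (k \<sigma> * weight \<sigma>) \<partial>sphere_volume N) = (\<integral>\<^sup>+\<sigma>. ennreal (k \<sigma>) * ennreal (weight \<sigma>) \<partial>sphere_volume N)"
    using k weight_pos by (intro nn_integral_cong ennreal_mult) (auto simp: space_sphere_volume less_imp_le)
  also have "ennreal (sqrt (real N) * \<rho>_lower) * \<dots> \<le> (\<integral>\<^sup>+x. ennreal (k (proj x)) \<partial>L.\<nu>)"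
    by (rule nn_integral_proj_ge) (rule measurable_compose[OF k(1) measurable_ennreal])
  also have "\<dots> = ennreal (\<integral>x. k (proj x) \<partial>L.\<nu>)"
    using k by (intro nn_integral_eq_integral i2) auto
  finally show ?thesis using k by (subst (asm) ennreal_le_iff) (auto intro!: integral_nonneg_AE)
qed

lemma integral_proj_le:
  fixes k :: "(nat \<Rightarrow> real) \<Rightarrow> real"
  assumes k: "k \<in> borel_measurable (sphere_sigma N)" "\<And>\<sigma>. \<sigma> \<in> spin_sphere N \<Longrightarrow> 0 \<le> k \<sigma>" "\<And>\<sigma>. \<sigma> \<in> spin_sphere N \<Longrightarrow> k \<sigma> \<le> M"
  shows "integrable L.\<nu> (\<lambda>x. (sqrt (real N) / vnorm N x)\<^sup>2 * k (proj x))"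
    and "(\<integral>x. (sqrt (real N) / vnorm N x)\<^sup>2 * k (proj x) \<partial>L.\<nu>) \<le> sqrt (real N) * \<rho>_upper * (\<integral>\<sigma>. k \<sigma> * weight \<sigma> \<partial>sphere_volume N)"
proof -
  have i1: "integrable (sphere_volume N) (\<lambda>\<sigma>. k \<sigma> * weight \<sigma>)"
    by (rule integrable_weighted[of _ M]) (use k in \<open>auto simp: abs_of_nonneg\<close>)
  have \<rho>0: "0 \<le> sqrt (real N) * \<rho>_upper" by (simp add: \<rho>_upper_def)
  have I0: "0 \<le> (\<integral>\<sigma>. k \<sigma> * weight \<sigma> \<partial>sphere_volume N)"
    by (rule integral_nonneg_AE) (use k weight_pos in \<open>auto simp: space_sphere_volume less_imp_le\<close>)
  note [measurable] = measurable_compose[OF proj_measurable k(1)]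
  have "(\<integral>\<^sup>+x. ennreal ((sqrt (real N) / vnorm N x)\<^sup>2 * k (proj x)) \<partial>L.\<nu>)
     = (\<integral>\<^sup>+x. ennreal ((sqrt (real N) / vnorm N x)\<^sup>2) * ennreal (k (proj x)) \<partial>L.\<nu>)"
    using k by (intro nn_integral_cong ennreal_mult) auto
  also have "\<dots> \<le> ennreal (sqrt (real N) * \<rho>_upper) * (\<integral>\<^sup>+\<sigma>. ennreal (k \<sigma>) * ennreal (weight \<sigma>) \<partial>sphere_volume N)"
    by (rule nn_integral_proj_le) (rule measurable_compose[OF k(1) measurable_ennreal])
  also have "(\<integral>\<^sup>+\<sigma>. ennreal (k \<sigma>) * ennreal (weight \<sigma>) \<partial>sphere_volume N) = (\<integral>\<^sup>+\<sigma>. ennreal (k \<sigma> * weight \<sigma>) \<partial>sphere_volume N)"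
    using k weight_pos by (intro nn_integral_cong ennreal_mult[symmetric]) (auto simp: space_sphere_volume less_imp_le)
  also have "\<dots> = ennreal (\<integral>\<sigma>. k \<sigma> * weight \<sigma> \<partial>sphere_volume N)"
    by (rule nn_integral_eq_integral[OF i1]) (use k weight_pos in \<open>auto simp: space_sphere_volume less_imp_le\<close>)
  also have "ennreal (sqrt (real N) * \<rho>_upper) * \<dots> = ennreal (sqrt (real N) * \<rho>_upper * (\<integral>\<sigma>. k \<sigma> * weight \<sigma> \<partial>sphere_volume N))"
    using \<rho>0 I0 by (rule ennreal_mult[symmetric])
  finally have *: "(\<integral>\<^sup>+x. ennreal ((sqrt (real N) / vnorm N x)\<^sup>2 * k (proj x)) \<partial>L.\<nu>)
     \<le> ennreal (sqrt (real N) * \<rho>_upper * (\<integral>\<sigma>. k \<sigma> * weight \<sigma> \<partial>sphere_volume N))" .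
  show i: "integrable L.\<nu> (\<lambda>x. (sqrt (real N) / vnorm N x)\<^sup>2 * k (proj x))"
  proof (rule integrableI_nonneg)
    show "AE x in L.\<nu>. 0 \<le> (sqrt (real N) / vnorm N x)\<^sup>2 * k (proj x)" using k by auto
    show "(\<integral>\<^sup>+x. ennreal ((sqrt (real N) / vnorm N x)\<^sup>2 * k (proj x)) \<partial>L.\<nu>) < \<infinity>"
      using * by (rule order_le_less_trans) simp
  qed measurable
  have "ennreal (\<integral>x. (sqrt (real N) / vnorm N x)\<^sup>2 * k (proj x) \<partial>L.\<nu>) \<le> ennreal (sqrt (real N) * \<rho>_upper * (\<integral>\<sigma>. k \<sigma> * weight \<sigma> \<partial>sphere_volume N))"
    using * by (subst nn_integral_eq_integral[OF i, symmetric]) (use k in auto)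
  then show "(\<integral>x. (sqrt (real N) / vnorm N x)\<^sup>2 * k (proj x) \<partial>L.\<nu>) \<le> sqrt (real N) * \<rho>_upper * (\<integral>\<sigma>. k \<sigma> * weight \<sigma> \<partial>sphere_volume N)"
    using \<rho>0 I0 by (subst (asm) ennreal_le_iff) auto
qed

end

subsection \<open>The log-Sobolev inequality for good disorder\<close>

text \<open>The right side is the integral of h ln h - h ln m - h + m, which is minimal in m at the
  mean B / Z. This integrand is pointwise nonnegative, so it can be compared under two measures with
  comparable densities, as in the Holley-Stroock perturbation argument.\<close>

lemma entropy_variational:
  fixes Z B m A :: real
  assumes "0 < Z" "0 < B" "0 < m"
  shows "A - B * ln (B / Z) \<le> A - ln m * B - B + m * Z"
proof -
  define r where "r = B / Z"
  have r: "0 < r" using assms by (simp add: r_def)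
  have "ln (m / r) \<le> m / r - 1" using assms r by (intro ln_le_minus_one) simp
  then have "B * ln (m / r) \<le> B * (m / r - 1)" using assms by (intro mult_left_mono) auto
  also have "B * (m / r - 1) = m * Z - B" using assms by (simp add: r_def field_simps)
  also have "ln (m / r) = ln m - ln r" using assms r by (simp add: ln_div)
  finally show ?thesis by (simp add: r_def algebra_simps)
qed

text \<open>Includes the limit 0, where x ln x extends continuously by 0 and the convention ln 0 = 0
  gives that value.\<close>

lemma tendsto_xlnx:
  fixes h :: "nat \<Rightarrow> real"
  assumes h: "h \<longlonglongrightarrow> y" and nn: "\<And>k. 0 \<le> h k"
  shows "(\<lambda>k. h k * ln (h k)) \<longlonglongrightarrow> y * ln y"
proof (cases "y = 0")
  case True
  have "((\<lambda>x::real. x * ln x) \<longlongrightarrow> 0) (at_right 0)" by real_asymp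
  moreover have "at 0 within {0::real..} = at_right 0"
  proof -
    have "{0::real..} - {0} = {0<..} - {0}" by auto
    then show ?thesis unfolding at_within_def by simp
  qed
  ultimately have "continuous (at y within {0..}) (\<lambda>x::real. x * ln x)"
    using True by (simp add: continuous_within)
  from continuous_within_tendsto_compose'[OF this _ h] nn show ?thesis by simp
next
  case False
  then show ?thesis using h by (intro tendsto_mult tendsto_ln)
qed

context sphere_extension_good
begin

text \<open>The inequality on the ball is applied to g = ln (f^2 + e) composed with the projection;
  e > 0 keeps g bounded where f vanishes.\<close>

lemma entropy_regularized:
  assumes e: "0 < e"
  shows "(\<integral>\<sigma>. ((f \<sigma>)\<^sup>2 + e) * ln ((f \<sigma>)\<^sup>2 + e) * weight \<sigma> \<partial>sphere_volume N) -
     (\<integral>\<sigma>. ((f \<sigma>)\<^sup>2 + e) * weight \<sigma> \<partial>sphere_volume N) *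
       ln ((\<integral>\<sigma>. ((f \<sigma>)\<^sup>2 + e) * weight \<sigma> \<partial>sphere_volume N) / gibbs_mass N p \<beta> J)
     \<le> 64 * exp (9 / 8) * (\<integral>\<sigma>. grad_sq \<sigma> * weight \<sigma> \<partial>sphere_volume N)"
proof -
  let ?V = "sphere_volume N"
  obtain Mf where Mf: "\<And>\<sigma>. \<sigma> \<in> spin_sphere N \<Longrightarrow> \<bar>f \<sigma>\<bar> \<le> Mf" using f_bounded by blast
  obtain Gm where Gm: "\<And>\<sigma>. \<sigma> \<in> spin_sphere N \<Longrightarrow> grad_sq \<sigma> \<le> Gm" using grad_sq_bounded by blast
  have Gm0: "0 \<le> Gm" using Gm[OF proj_sphere] grad_sq_nonneg order_trans by blast
  obtain Lf where Lf: "0 \<le> Lf" "\<And>x y. x \<in> spin_sphere N \<Longrightarrow> y \<in> spin_sphere N \<Longrightarrow> \<bar>f x - f y\<bar> \<le> Lf * vdist N x y"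
    using f_lipschitz by blast
  define le where "le = 1 / sqrt e"
  have le: "0 < le" using e by (simp add: le_def)
  define h where "h \<sigma> = (f \<sigma>)\<^sup>2 + e" for \<sigma>
  define H1 where "H1 = Mf\<^sup>2 + e"
  have h: "e \<le> h \<sigma>" "0 < h \<sigma>" for \<sigma> using e by (auto simp: h_def add_nonneg_pos)
  have hH: "h \<sigma> \<le> H1" if "\<sigma> \<in> spin_sphere N" for \<sigma>
    using Mf[OF that] by (simp add: h_def H1_def abs_le_square_iff[symmetric])
  have H1: "0 < H1" using h(2) hH[OF proj_sphere] by (rule less_le_trans)
  have fm: "f \<in> borel_measurable (sphere_sigma N)" by (rule continuous_on_sphere_measurable[OF continuous_on_f])
  have grm: "grad_sq \<in> borel_measurable (sphere_sigma N)" by (rule continuous_on_sphere_measurable[OF continuous_on_grad_sq])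
  note [measurable] = fm grm
  have hm[measurable]: "h \<in> borel_measurable (sphere_sigma N)" unfolding h_def[abs_def] by measurable
  note [measurable] = proj_measurable
  define g where "g x = ln (h (proj x))" for x
  define Cb where "Cb = \<bar>ln e\<bar> + \<bar>ln H1\<bar>"
  have lnh: "\<bar>ln (h \<sigma>)\<bar> \<le> Cb" if "\<sigma> \<in> spin_sphere N" for \<sigma>
  proof -
    have "ln e \<le> ln (h \<sigma>)" "ln (h \<sigma>) \<le> ln H1" using h[of \<sigma>] hH[OF that] e by (auto intro: ln_mono)
    then show ?thesis unfolding Cb_def by arith
  qed
  have gm[measurable]: "g \<in> borel_measurable (lebesgue_vectors N)" unfolding g_def[abs_def] by measurable
  \<comment> \<open>Chain rule for slopes: the derivative of the logarithm, the length of the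
    tangential gradient of f, and the slope sqrt N / |x| of the projection.\<close>
  define D where "D x = \<bar>2 * f (proj x) / h (proj x)\<bar> * (sqrt (grad_sq (proj x)) * (sqrt (real N) / vnorm N x))" for x
  \<comment> \<open>The first summand bounds all increments of g through the global projection
    estimate, the second ensures D \<le> K.\<close>
  define K0 where "K0 = 3 * le * Lf + le * sqrt Gm"
  define K where "K x = K0 * (sqrt (real N) / vnorm N x)" for x
  have Dm[measurable]: "D \<in> borel_measurable (lebesgue_vectors N)" unfolding D_def[abs_def] by measurable
  have Km[measurable]: "K \<in> borel_measurable (lebesgue_vectors N)" unfolding K_def[abs_def] by measurable
  \<comment> \<open>The origin, a null set, is removed: the slope bound for the projection requires
    a nonzero base point.\<close>
  define B' where "B' = {x \<in> origin_ball N. 0 < vnorm N x}"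
  have psi: "\<bar>2 * f \<sigma> / h \<sigma>\<bar> \<le> le" for \<sigma>
    using log_regularized_lipschitz(3)[OF e, of "f \<sigma>"] by (simp add: h_def le_def)
  have main: "(\<integral>x. g x * exp (g x) \<partial>L.\<nu>) - (\<integral>x. exp (g x) \<partial>L.\<nu>) * ln ((\<integral>x. exp (g x) \<partial>L.\<nu>) / (\<integral>x. 1 \<partial>L.\<nu>))
    \<le> (\<integral>x. (D x)\<^sup>2 * exp (g x) \<partial>L.\<nu>) / (2 * (1 / 4))"
  proof (rule L.entropy_le_local_slope[OF gm Dm Km, where C = Cb and B' = B'])
    show "\<bar>g x\<bar> \<le> Cb" for x unfolding g_def by (rule lnh[OF proj_sphere])
    show "B' \<subseteq> origin_ball N" by (auto simp: B'_def)
    show "AE x in L.\<nu>. x \<in> B'"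
      unfolding L.\<nu>_def
    proof (subst AE_density)
      show "AE x in lebesgue_vectors N. 0 < ennreal (indicator (origin_ball N) x * exp (- ball_potential N p \<beta> J x)) \<longrightarrow> x \<in> B'"
        using AE_vnorm_pos[OF N] by eventually_elim (auto simp: B'_def indicator_def split: if_splits)
    qed measurable
    fix z assume z: "z \<in> B'"
    then have z0: "0 < vnorm N z" by (simp add: B'_def)
    have r0: "0 \<le> sqrt (real N) / vnorm N z" using z0 by simp
    show "0 \<le> D z" unfolding D_def using z0 grad_sq_nonneg by (intro mult_nonneg_nonneg) auto
    show "D z \<le> K z"
    proof -
      have "D z \<le> le * (sqrt Gm * (sqrt (real N) / vnorm N z))"
        unfolding D_def using psi[of "proj z"] Gm[OF proj_sphere[of z]] z0 le grad_sq_nonneg[of "proj z"]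
        by (intro mult_mono) auto
      also have "\<dots> = (le * sqrt Gm) * (sqrt (real N) / vnorm N z)" by simp
      also have "\<dots> \<le> K z" unfolding K_def
        by (rule mult_right_mono[OF _ r0]) (use le Lf(1) in \<open>simp add: K0_def\<close>)
      finally show ?thesis .
    qed
    have s2: "slope_bound (vdist N) (\<lambda>a b. \<bar>a - b\<bar>) f (spin_sphere N) (proj z) (sqrt (grad_sq (proj z)))"
      unfolding slope_bound_def using local_slope[OF proj_sphere[of z]] by blast
    have s12: "slope_bound (vdist N) (\<lambda>a b. \<bar>a - b\<bar>) (\<lambda>x. f (proj x)) (origin_ball N) z (sqrt (grad_sq (proj z)) * (sqrt (real N) / vnorm N z))"
      by (rule slope_bound_comp[where \<phi> = proj and \<psi> = f and z = z, OF slope_bound_radial_projection[OF z0] s2]) (use r0 grad_sq_nonneg in auto)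
    have "slope_bound (vdist N) (\<lambda>a b. \<bar>a - b\<bar>) (\<lambda>x. ln ((f (proj x))\<^sup>2 + e)) (origin_ball N) z (D z)"
      unfolding D_def h_def
      by (rule slope_bound_comp[where \<phi> = "\<lambda>x. f (proj x)" and \<psi> = "\<lambda>y. ln (y\<^sup>2 + e)" and z = z, OF s12 slope_bound_deriv[OF log_regularized_lipschitz(2)[OF e]]])
         (use r0 grad_sq_nonneg in auto)
    then have sb: "\<exists>\<delta>>0. \<forall>x\<in>origin_ball N. vdist N x z < \<delta> \<longrightarrow> \<bar>g x - g z\<bar> \<le> (D z + \<eta>) * vdist N x z" if "0 < \<eta>" for \<eta>
      using that unfolding slope_bound_def g_def h_def by blast
    show "\<exists>\<delta>>0. \<forall>x\<in>origin_ball N. vdist N x z < \<delta> \<longrightarrow> g x - g z \<le> (D z + \<eta>) * vdist N x z" if \<eta>: "0 < \<eta>" for \<eta>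
    proof -
      obtain \<delta> where "0 < \<delta>" "\<And>x. x \<in> origin_ball N \<Longrightarrow> vdist N x z < \<delta> \<Longrightarrow> \<bar>g x - g z\<bar> \<le> (D z + \<eta>) * vdist N x z"
        using sb[OF \<eta>] by blast
      then show ?thesis by (intro exI[of _ \<delta>]) (auto dest: abs_le_D1)
    qed
    fix x assume "x \<in> origin_ball N"
    have "g x - g z \<le> \<bar>ln ((f (proj x))\<^sup>2 + e) - ln ((f (proj z))\<^sup>2 + e)\<bar>" by (simp add: g_def h_def)
    also have "\<dots> \<le> le * \<bar>f (proj x) - f (proj z)\<bar>" unfolding le_def by (rule log_regularized_lipschitz(1)[OF e])
    also have "\<dots> \<le> le * (Lf * vdist N (proj x) (proj z))" using le Lf(2)[OF proj_sphere proj_sphere] by (intro mult_left_mono) auto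
    also have "\<dots> \<le> le * (Lf * (3 * sqrt (real N) / vnorm N z * vdist N x z))"
      using le Lf(1) vdist_radial_projection_global[OF N z0, of x] by (intro mult_left_mono) auto
    also have "\<dots> = (3 * le * Lf) * (sqrt (real N) / vnorm N z) * vdist N x z" by simp
    also have "\<dots> \<le> K z * vdist N x z"
      unfolding K_def K0_def using le Gm0 r0 by (intro mult_right_mono) auto
    finally show "g x - g z \<le> K z * vdist N x z" .
  next
    have "integrable L.\<nu> (\<lambda>x. (sqrt (real N) / vnorm N x)\<^sup>2 * (\<lambda>_. K0\<^sup>2) (proj x))"
      by (rule integral_proj_le(1)[of _ "K0\<^sup>2"]) auto
    then show "integrable L.\<nu> (\<lambda>z. (K z)\<^sup>2)"
      unfolding K_def power_mult_distrib by (simp only: mult.commute)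
  qed
  \<comment> \<open>The squared slope times exp g without the factor of the projection; since 4 f^2
    / h \<le> 4, it is at most 4 times the squared gradient, uniformly in e.\<close>
  define k1 where "k1 \<sigma> = (2 * f \<sigma> / h \<sigma>)\<^sup>2 * grad_sq \<sigma> * h \<sigma>" for \<sigma>
  have k1m[measurable]: "k1 \<in> borel_measurable (sphere_sigma N)" unfolding k1_def[abs_def] by measurable
  have k1: "0 \<le> k1 \<sigma>" "k1 \<sigma> \<le> 4 * grad_sq \<sigma>" for \<sigma>
  proof -
    show "0 \<le> k1 \<sigma>" unfolding k1_def using h(2)[of \<sigma>] grad_sq_nonneg[of \<sigma>] by simp
    have "(2 * f \<sigma> / h \<sigma>)\<^sup>2 * h \<sigma> = 4 * ((f \<sigma>)\<^sup>2 / h \<sigma>)"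
      using h(2)[of \<sigma>] by (simp add: power2_eq_square)
    also have "\<dots> \<le> 4 * 1" using h(2)[of \<sigma>] e by (intro mult_left_mono) (auto simp: h_def)
    finally have "((2 * f \<sigma> / h \<sigma>)\<^sup>2 * h \<sigma>) * grad_sq \<sigma> \<le> (4 * 1) * grad_sq \<sigma>"
      using grad_sq_nonneg by (rule mult_right_mono)
    then show "k1 \<sigma> \<le> 4 * grad_sq \<sigma>" by (simp add: k1_def mult_ac)
  qed
  have "(\<integral>x. (D x)\<^sup>2 * exp (g x) \<partial>L.\<nu>) = (\<integral>x. (sqrt (real N) / vnorm N x)\<^sup>2 * k1 (proj x) \<partial>L.\<nu>)"
  proof (rule Bochner_Integration.integral_cong[OF refl])
    fix x
    have "exp (g x) = h (proj x)" using h(2) by (simp add: g_def)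
    then show "(D x)\<^sup>2 * exp (g x) = (sqrt (real N) / vnorm N x)\<^sup>2 * k1 (proj x)"
      using grad_sq_nonneg[of "proj x"]
      by (simp only: D_def k1_def power_mult_distrib power2_abs real_sqrt_pow2 mult_ac)
  qed
  also have "\<dots> \<le> sqrt (real N) * \<rho>_upper * (\<integral>\<sigma>. k1 \<sigma> * weight \<sigma> \<partial>?V)"
  proof (rule integral_proj_le(2)[of _ "4 * Gm", OF k1m])
    show "k1 \<sigma> \<le> 4 * Gm" if "\<sigma> \<in> spin_sphere N" for \<sigma>
      using k1(2)[of \<sigma>] Gm[OF that] by linarith
  qed (rule k1)
  also have "\<dots> \<le> sqrt (real N) * \<rho>_upper * (4 * (\<integral>\<sigma>. grad_sq \<sigma> * weight \<sigma> \<partial>?V))"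
  proof (rule mult_left_mono)
    have ig: "integrable ?V (\<lambda>\<sigma>. grad_sq \<sigma> * weight \<sigma>)"
      by (rule integrable_weighted[OF grm, of Gm]) (use Gm grad_sq_nonneg in auto)
    have "(\<integral>\<sigma>. k1 \<sigma> * weight \<sigma> \<partial>?V) \<le> (\<integral>\<sigma>. 4 * (grad_sq \<sigma> * weight \<sigma>) \<partial>?V)"
    proof (rule integral_mono)
      show "integrable ?V (\<lambda>\<sigma>. k1 \<sigma> * weight \<sigma>)"
      proof (rule integrable_weighted[OF k1m, of "4 * Gm"])
        show "\<bar>k1 \<sigma>\<bar> \<le> 4 * Gm" if "\<sigma> \<in> spin_sphere N" for \<sigma>
          using k1[of \<sigma>] Gm[OF that] by linarith
      qed
      show "k1 \<sigma> * weight \<sigma> \<le> 4 * (grad_sq \<sigma> * weight \<sigma>)" for \<sigma>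
        using mult_right_mono[OF k1(2), of "weight \<sigma>" \<sigma>] weight_pos[of \<sigma>] by simp
    qed (use ig in auto)
    then show "(\<integral>\<sigma>. k1 \<sigma> * weight \<sigma> \<partial>?V) \<le> 4 * (\<integral>\<sigma>. grad_sq \<sigma> * weight \<sigma> \<partial>?V)" by simp
  qed (simp add: \<rho>_upper_def)
  finally have upper: "(\<integral>x. (D x)\<^sup>2 * exp (g x) \<partial>L.\<nu>) \<le> sqrt (real N) * \<rho>_upper * (4 * (\<integral>\<sigma>. grad_sq \<sigma> * weight \<sigma> \<partial>?V))" .
  define a where "a = (\<integral>x. exp (g x) \<partial>L.\<nu>)"
  define Z\<nu> where "Z\<nu> = (\<integral>x. (1::real) \<partial>L.\<nu>)"
  have Z\<nu>: "0 < Z\<nu>" unfolding Z\<nu>_def by (rule L.mass_pos)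
  have eg: "exp (g x) = h (proj x)" for x using h(2) by (simp add: g_def)
  have i1: "integrable L.\<nu> (\<lambda>x. 1 :: real)" by (rule L.integrable_bounded[of _ 1]) auto
  have ih: "integrable L.\<nu> (\<lambda>x. h (proj x))"
  proof (rule L.integrable_bounded[of _ H1])
    show "\<bar>h (proj x)\<bar> \<le> H1" for x using h(2)[of "proj x"] hH[OF proj_sphere[of x]] by simp
  qed measurable
  have hlnh: "\<bar>h \<sigma> * ln (h \<sigma>)\<bar> \<le> H1 * Cb" if "\<sigma> \<in> spin_sphere N" for \<sigma>
    unfolding abs_mult using h(2)[of \<sigma>] hH[OF that] lnh[OF that] H1 by (intro mult_mono) auto
  have ihl: "integrable L.\<nu> (\<lambda>x. h (proj x) * ln (h (proj x)))"
    by (rule L.integrable_bounded[of _ "H1 * Cb"]) (auto intro: hlnh)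
  have "(\<integral>x. e * 1 \<partial>L.\<nu>) \<le> a"
    unfolding a_def eg by (rule integral_mono[OF integrable_mult_right[OF i1] ih]) (use h in auto)
  then have "e * Z\<nu> \<le> a" unfolding Z\<nu>_def by (simp only: integral_mult_right_zero)
  then have a: "0 < a" using mult_pos_pos[OF e Z\<nu>] by linarith
  \<comment> \<open>The mean of h under the ball measure, so k composed with the projection
    integrates exactly to the entropy there. On the sphere the same m is admissible in
    \<open>entropy_variational\<close> and bounds the entropy from above.\<close>
  define m where "m = a / Z\<nu>"
  have m: "0 < m" using a Z\<nu> by (simp add: m_def)
  define k where "k \<sigma> = h \<sigma> * ln (h \<sigma>) - ln m * h \<sigma> - h \<sigma> + m" for \<sigma>
  have km[measurable]: "k \<in> borel_measurable (sphere_sigma N)" unfolding k_def[abs_def] by measurable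
  have k0: "0 \<le> k \<sigma>" for \<sigma>
  proof -
    have "ln (m / h \<sigma>) \<le> m / h \<sigma> - 1" using m h(2)[of \<sigma>] by (intro ln_le_minus_one) simp
    then have "h \<sigma> * ln (m / h \<sigma>) \<le> h \<sigma> * (m / h \<sigma> - 1)" using h(2)[of \<sigma>] by (intro mult_left_mono) auto
    also have "\<dots> = m - h \<sigma>" using h(2)[of \<sigma>] by (simp add: right_diff_distrib)
    also have "ln (m / h \<sigma>) = ln m - ln (h \<sigma>)" using m h(2)[of \<sigma>] by (simp add: ln_div)
    finally show ?thesis by (simp add: k_def algebra_simps)
  qed
  have kM: "k \<sigma> \<le> H1 * Cb + \<bar>ln m\<bar> * H1 + m" if "\<sigma> \<in> spin_sphere N" for \<sigma>
  proof -
    have "h \<sigma> * ln (h \<sigma>) \<le> H1 * Cb" using hlnh[OF that] by simp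
    moreover have "- (ln m * h \<sigma>) \<le> \<bar>ln m\<bar> * H1"
    proof -
      have "- (ln m * h \<sigma>) \<le> \<bar>ln m\<bar> * h \<sigma>" using mult_right_mono[of "- ln m" "\<bar>ln m\<bar>" "h \<sigma>"] h(2)[of \<sigma>] by simp
      also have "\<dots> \<le> \<bar>ln m\<bar> * H1" using hH[OF that] by (intro mult_left_mono) auto
      finally show ?thesis .
    qed
    ultimately show ?thesis using h(2)[of \<sigma>] unfolding k_def by linarith
  qed
  have "sqrt (real N) * \<rho>_lower * (\<integral>\<sigma>. k \<sigma> * weight \<sigma> \<partial>?V) \<le> (\<integral>x. k (proj x) \<partial>L.\<nu>)"
    by (rule integral_proj_ge[OF km k0 kM])
  also have "(\<integral>x. k (proj x) \<partial>L.\<nu>) = (\<integral>x. h (proj x) * ln (h (proj x)) \<partial>L.\<nu>) - ln m * a - a + m * Z\<nu>"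
  proof -
    have "integrable L.\<nu> (\<lambda>x. m)" by (rule L.integrable_bounded[of _ m]) (use m in auto)
    then show ?thesis unfolding k_def a_def eg Z\<nu>_def using ih ihl by simp
  qed
  also have "\<dots> = (\<integral>x. g x * exp (g x) \<partial>L.\<nu>) - a * ln (a / Z\<nu>)"
  proof -
    have "g x * exp (g x) = h (proj x) * ln (h (proj x))" for x unfolding eg by (simp add: g_def)
    then show ?thesis using Z\<nu> by (simp add: m_def)
  qed
  also have "\<dots> \<le> (\<integral>x. (D x)\<^sup>2 * exp (g x) \<partial>L.\<nu>) / (2 * (1 / 4))"
    using main unfolding a_def Z\<nu>_def .
  also have "\<dots> \<le> sqrt (real N) * \<rho>_upper * (8 * (\<integral>\<sigma>. grad_sq \<sigma> * weight \<sigma> \<partial>?V))"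
    using upper by (simp add: mult_ac)
  also have "\<rho>_upper = \<rho>_lower * (8 * exp (9 / 8))"
    by (simp add: \<rho>_upper_def \<rho>_lower_def mult_exp_exp)
  finally have "(sqrt (real N) * \<rho>_lower) * (\<integral>\<sigma>. k \<sigma> * weight \<sigma> \<partial>?V)
     \<le> (sqrt (real N) * \<rho>_lower) * (64 * exp (9 / 8) * (\<integral>\<sigma>. grad_sq \<sigma> * weight \<sigma> \<partial>?V))"
    by (simp add: mult_ac)
  moreover have "0 < sqrt (real N) * \<rho>_lower" using N by (simp add: \<rho>_lower_def)
  ultimately have kG: "(\<integral>\<sigma>. k \<sigma> * weight \<sigma> \<partial>?V) \<le> 64 * exp (9 / 8) * (\<integral>\<sigma>. grad_sq \<sigma> * weight \<sigma> \<partial>?V)"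
    by (rule mult_left_le_imp_le)
  define A where "A = (\<integral>\<sigma>. h \<sigma> * ln (h \<sigma>) * weight \<sigma> \<partial>?V)"
  define B where "B = (\<integral>\<sigma>. h \<sigma> * weight \<sigma> \<partial>?V)"
  have iA: "integrable ?V (\<lambda>\<sigma>. h \<sigma> * ln (h \<sigma>) * weight \<sigma>)"
    by (rule integrable_weighted[of _ "H1 * Cb"]) (auto intro: hlnh)
  have iB: "integrable ?V (\<lambda>\<sigma>. h \<sigma> * weight \<sigma>)"
    by (rule integrable_weighted[of _ H1]) (use h hH in \<open>auto simp: abs_of_pos\<close>)
  have iw: "integrable ?V (\<lambda>\<sigma>. weight \<sigma>)" using integrable_weighted[of "\<lambda>_. 1" 1] by simp
  have "(\<integral>\<sigma>. k \<sigma> * weight \<sigma> \<partial>?V) = (\<integral>\<sigma>. h \<sigma> * ln (h \<sigma>) * weight \<sigma> - ln m * (h \<sigma> * weight \<sigma>) - h \<sigma> * weight \<sigma> + m * weight \<sigma> \<partial>?V)"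
    by (intro Bochner_Integration.integral_cong) (auto simp: k_def algebra_simps)
  also have "\<dots> = A - ln m * B - B + m * gibbs_mass N p \<beta> J"
    unfolding A_def B_def gibbs_mass_def using iA iB iw by simp
  finally have kAB: "(\<integral>\<sigma>. k \<sigma> * weight \<sigma> \<partial>?V) = A - ln m * B - B + m * gibbs_mass N p \<beta> J" .
  have B0: "0 < B"
  proof -
    have "(\<integral>\<sigma>. e * weight \<sigma> \<partial>?V) \<le> B" unfolding B_def
      by (rule integral_mono[OF integrable_mult_right[OF iw] iB]) (use h weight_pos in \<open>auto intro!: mult_right_mono simp: less_imp_le\<close>)
    then have "e * gibbs_mass N p \<beta> J \<le> B" unfolding gibbs_mass_def by (simp only: integral_mult_right_zero)
    then show ?thesis using mult_pos_pos[OF e gibbs_mass_pos[OF N, of p \<beta> J]] by linarith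
  qed
  have "A - B * ln (B / gibbs_mass N p \<beta> J) \<le> A - ln m * B - B + m * gibbs_mass N p \<beta> J"
    by (rule entropy_variational[OF gibbs_mass_pos[OF N] B0 m])
  then show ?thesis using kG unfolding kAB A_def B_def h_def by linarith
qed

text \<open>The regularisation tends to 0 by dominated convergence, while the gradient side does not
  depend on it; 32 is half of 64 because the inequality is stated with 2 * c.\<close>

lemma unnormalized_lsi_good: "unnormalized_lsi N p \<beta> (32 * exp (9 / 8)) J f"
proof -
  let ?V = "sphere_volume N" and ?Z = "gibbs_mass N p \<beta> J"
  have Z: "0 < ?Z" by (rule gibbs_mass_pos[OF N])
  obtain Mf where Mf: "\<And>\<sigma>. \<sigma> \<in> spin_sphere N \<Longrightarrow> \<bar>f \<sigma>\<bar> \<le> Mf" using f_bounded by blast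
  define e where "e j = 1 / (real j + 1)" for j
  have e: "0 < e j" "e j \<le> 1" for j by (auto simp: e_def)
  have e0: "e \<longlonglongrightarrow> 0" unfolding e_def by real_asymp
  define h where "h j \<sigma> = (f \<sigma>)\<^sup>2 + e j" for j \<sigma>
  have h0: "0 < h j \<sigma>" for j \<sigma> using e(1)[of j] by (simp add: h_def add_nonneg_pos)
  define M2 where "M2 = Mf\<^sup>2 + 1"
  have M2: "1 \<le> M2" by (simp add: M2_def)
  have hM: "h j \<sigma> \<le> M2" if "\<sigma> \<in> spin_sphere N" for j \<sigma>
  proof -
    have "(f \<sigma>)\<^sup>2 \<le> Mf\<^sup>2" using Mf[OF that] by (simp add: abs_le_square_iff[symmetric])
    then show ?thesis using e(2)[of j] by (simp add: h_def M2_def)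
  qed
  have hlim: "(\<lambda>j. h j \<sigma>) \<longlonglongrightarrow> (f \<sigma>)\<^sup>2" for \<sigma>
    unfolding h_def using tendsto_add[OF tendsto_const e0, of "(f \<sigma>)\<^sup>2"] by simp
  have fm[measurable]: "f \<in> borel_measurable (sphere_sigma N)" by (rule continuous_on_sphere_measurable[OF continuous_on_f])
  have hm[measurable]: "h j \<in> borel_measurable (sphere_sigma N)" for j unfolding h_def[abs_def] by measurable
  note [measurable] = gibbs_weight_measurable[of N p \<beta> J]
  define A where "A j = (\<integral>\<sigma>. h j \<sigma> * ln (h j \<sigma>) * weight \<sigma> \<partial>?V)" for j
  define B where "B j = (\<integral>\<sigma>. h j \<sigma> * weight \<sigma> \<partial>?V)" for j
  define A0 where "A0 = (\<integral>\<sigma>. (f \<sigma>)\<^sup>2 * ln ((f \<sigma>)\<^sup>2) * weight \<sigma> \<partial>?V)"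
  define B0 where "B0 = (\<integral>\<sigma>. (f \<sigma>)\<^sup>2 * weight \<sigma> \<partial>?V)"
  have iw: "integrable ?V (\<lambda>\<sigma>. c * weight \<sigma>)" for c using integrable_weighted[of "\<lambda>_. c" "\<bar>c\<bar>"] by simp
  have Alim: "A \<longlonglongrightarrow> A0" unfolding A_def A0_def
  proof (rule integral_dominated_convergence[OF _ _ iw[of "1 + M2 * ln M2"]])
    show "AE \<sigma> in ?V. (\<lambda>j. h j \<sigma> * ln (h j \<sigma>) * weight \<sigma>) \<longlonglongrightarrow> (f \<sigma>)\<^sup>2 * ln ((f \<sigma>)\<^sup>2) * weight \<sigma>"
      by (intro AE_I2 tendsto_mult tendsto_const tendsto_xlnx hlim less_imp_le[OF h0])
    show "AE \<sigma> in ?V. norm (h j \<sigma> * ln (h j \<sigma>) * weight \<sigma>) \<le> (1 + M2 * ln M2) * weight \<sigma>" for j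
    proof (rule AE_I2)
      fix \<sigma> assume "\<sigma> \<in> space ?V"
      then have "\<bar>h j \<sigma> * ln (h j \<sigma>)\<bar> \<le> 1 + M2 * ln M2"
        using h0[of j \<sigma>] hM M2 by (intro xlnx_bound) (auto simp: space_sphere_volume)
      then show "norm (h j \<sigma> * ln (h j \<sigma>) * weight \<sigma>) \<le> (1 + M2 * ln M2) * weight \<sigma>"
        using weight_pos[of \<sigma>] by (simp add: abs_mult[of "_ * _" "weight \<sigma>"] mult_right_mono)
    qed
  qed (simp_all add: measurable_sphere_volume)
  have Blim: "B \<longlonglongrightarrow> B0" unfolding B_def B0_def
  proof (rule integral_dominated_convergence[OF _ _ iw[of M2]])
    show "AE \<sigma> in ?V. (\<lambda>j. h j \<sigma> * weight \<sigma>) \<longlonglongrightarrow> (f \<sigma>)\<^sup>2 * weight \<sigma>"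
      by (intro AE_I2 tendsto_mult tendsto_const hlim)
    show "AE \<sigma> in ?V. norm (h j \<sigma> * weight \<sigma>) \<le> M2 * weight \<sigma>" for j
    proof (rule AE_I2)
      fix \<sigma> assume "\<sigma> \<in> space ?V"
      then show "norm (h j \<sigma> * weight \<sigma>) \<le> M2 * weight \<sigma>"
        using h0[of j \<sigma>] hM[of \<sigma> j] weight_pos[of \<sigma>] by (simp add: abs_mult mult_right_mono space_sphere_volume)
    qed
  qed (simp_all add: measurable_sphere_volume)
  have Bpos: "0 < B j" for j
  proof -
    have "(\<integral>\<sigma>. e j * weight \<sigma> \<partial>?V) \<le> B j" unfolding B_def
    proof (rule integral_mono[OF iw])
      show "integrable ?V (\<lambda>\<sigma>. h j \<sigma> * weight \<sigma>)"
        by (rule integrable_weighted[of _ M2]) (use h0 hM in \<open>auto simp: abs_of_pos\<close>)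
      show "e j * weight \<sigma> \<le> h j \<sigma> * weight \<sigma>" for \<sigma>
        using weight_pos[of \<sigma>] by (intro mult_right_mono) (auto simp: h_def)
    qed
    then have "e j * ?Z \<le> B j" unfolding gibbs_mass_def by (simp only: integral_mult_right_zero)
    then show ?thesis using mult_pos_pos[OF e(1) Z, of j] by linarith
  qed
  \<comment> \<open>The product term is written as Z times x ln x at x = B / Z, a form that is
    continuous also when \<open>B0\<close> is 0.\<close>
  have "(\<lambda>j. B j / ?Z) \<longlonglongrightarrow> B0 / ?Z" using Z by (intro tendsto_intros Blim) auto
  then have "(\<lambda>j. B j / ?Z * ln (B j / ?Z)) \<longlonglongrightarrow> B0 / ?Z * ln (B0 / ?Z)"
    by (rule tendsto_xlnx) (use Bpos Z in \<open>auto simp: less_imp_le\<close>)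
  then have "(\<lambda>j. A j - ?Z * (B j / ?Z * ln (B j / ?Z))) \<longlonglongrightarrow> A0 - ?Z * (B0 / ?Z * ln (B0 / ?Z))"
    by (intro tendsto_diff[OF Alim] tendsto_mult[OF tendsto_const])
  then have "(\<lambda>j. A j - B j * ln (B j / ?Z)) \<longlonglongrightarrow> A0 - B0 * ln (B0 / ?Z)"
    using Z by simp
  moreover have "A j - B j * ln (B j / ?Z) \<le> 64 * exp (9 / 8) * (\<integral>\<sigma>. grad_sq \<sigma> * weight \<sigma> \<partial>?V)" for j
    using entropy_regularized[OF e(1)[of j]] unfolding A_def B_def h_def .
  ultimately have "A0 - B0 * ln (B0 / ?Z) \<le> 64 * exp (9 / 8) * (\<integral>\<sigma>. grad_sq \<sigma> * weight \<sigma> \<partial>?V)"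
    by (intro LIMSEQ_le_const2) auto
  then show ?thesis unfolding unnormalized_lsi_def A0_def B0_def grad_sq_def by simp
qed

end

theorem log_sobolev_good_disorder:
  assumes "12 \<le> N" "2 \<le> p" "0 \<le> C" "J \<in> good_disorder N p C" "0 \<le> \<beta>" "\<beta> * C * (real p)\<^sup>2 \<le> 1 / 8"
  shows "log_sobolev N (gibbs_measure N p \<beta> J) (32 * exp (9 / 8))"
proof -
  have N: "0 < N" using assms(1) by simp
  have "unnormalized_lsi N p \<beta> (32 * exp (9 / 8)) J f" if f: "smooth_on_sphere N f" for f
  proof -
    obtain F U where "sphere_extension N f F U" using smooth_sphere_extension[OF N f] by blast
    then interpret sphere_extension N f F U .
    interpret sphere_extension_good N f F U p C \<beta> J by unfold_locales (use assms in auto)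
    show ?thesis by (rule unnormalized_lsi_good)
  qed
  then show ?thesis by (subst log_sobolev_gibbs_iff[OF N]) auto
qed

subsection \<open>Measurability of the log-Sobolev event\<close>

text \<open>C is closed in a separable space, hence a countable intersection of countable unions of
  boxes: at scale 1 / (n + 1), those with rational centre that meet C.\<close>

lemma sequentially_closed_in_sets_PiM:
  fixes C :: "('i \<Rightarrow> real) set"
  assumes I: "finite I" and sub: "C \<subseteq> I \<rightarrow>\<^sub>E UNIV"
    and closed: "\<And>X x. (\<And>n. X n \<in> C) \<Longrightarrow> x \<in> I \<rightarrow>\<^sub>E UNIV \<Longrightarrow> (\<And>i. i \<in> I \<Longrightarrow> (\<lambda>n. X n i) \<longlonglongrightarrow> x i) \<Longrightarrow> x \<in> C"
  shows "C \<in> sets (\<Pi>\<^sub>M i\<in>I. borel)"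
proof -
  let ?M = "\<Pi>\<^sub>M i\<in>I. (borel :: real measure)"
  define Q where "Q = I \<rightarrow>\<^sub>E (\<rat> :: real set)"
  define B where "B n q = {x \<in> space ?M. \<forall>i\<in>I. \<bar>x i - q i\<bar> < inverse (real (Suc n))}" for n q
  have B: "B n q \<in> sets ?M" for n q
    unfolding B_def using I by (intro sets.sets_Collect_finite_All) measurable
  have Q: "countable Q" unfolding Q_def using I by (intro countable_PiE countable_rat)
  have "C = (\<Inter>n. \<Union>q\<in>{q \<in> Q. B n q \<inter> C \<noteq> {}}. B n q)"
  proof (intro subset_antisym subsetI)
    fix x assume x: "x \<in> C"
    show "x \<in> (\<Inter>n. \<Union>q\<in>{q \<in> Q. B n q \<inter> C \<noteq> {}}. B n q)"
    proof
      fix n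
      have "\<exists>r\<in>\<rat>. \<bar>x i - r\<bar> < inverse (real (Suc n))" for i
      proof -
        obtain r where "r \<in> \<rat>" "x i < r" "r < x i + inverse (real (Suc n))"
          using Rats_dense_in_real[of "x i" "x i + inverse (real (Suc n))"] by auto
        then show ?thesis by (intro bexI[of _ r]) auto
      qed
      then obtain q where q: "\<And>i. q i \<in> \<rat>" "\<And>i. \<bar>x i - q i\<bar> < inverse (real (Suc n))" by metis
      have "x \<in> B n (restrict q I)" using x sub q by (auto simp: B_def space_PiM)
      moreover have "restrict q I \<in> Q" using q by (auto simp: Q_def)
      ultimately show "x \<in> (\<Union>q\<in>{q \<in> Q. B n q \<inter> C \<noteq> {}}. B n q)" using x by blast
    qed
  next
    fix x assume x: "x \<in> (\<Inter>n. \<Union>q\<in>{q \<in> Q. B n q \<inter> C \<noteq> {}}. B n q)"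
    define P where "P n c \<longleftrightarrow> c \<in> C \<and> (\<forall>i\<in>I. \<bar>c i - x i\<bar> \<le> 2 * inverse (real (Suc n)))" for n c
    have "\<exists>c. P n c" for n
    proof -
      from x have "x \<in> (\<Union>q\<in>{q \<in> Q. B n q \<inter> C \<noteq> {}}. B n q)" by (rule INT_D) simp
      then obtain q c where q: "x \<in> B n q" "c \<in> B n q" "c \<in> C" by auto
      have "\<bar>c i - x i\<bar> \<le> 2 * inverse (real (Suc n))" if "i \<in> I" for i
      proof -
        have "\<bar>c i - q i\<bar> < inverse (real (Suc n))" "\<bar>x i - q i\<bar> < inverse (real (Suc n))"
          using q(1,2) that unfolding B_def by blast+
        then show ?thesis by arith
      qed
      then show ?thesis using q(3) unfolding P_def by blast
    qed
    then obtain c where "\<And>n. P n (c n)" by metis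
    then have c: "\<And>n. c n \<in> C" "\<And>n i. i \<in> I \<Longrightarrow> \<bar>c n i - x i\<bar> \<le> 2 * inverse (real (Suc n))"
      unfolding P_def by blast+
    from x have "x \<in> (\<Union>q\<in>{q \<in> Q. B 0 q \<inter> C \<noteq> {}}. B 0 q)" by (rule INT_D) simp
    then have xs: "x \<in> space ?M" unfolding B_def by blast
    show "x \<in> C"
    proof (rule closed[OF c(1)])
      show "x \<in> I \<rightarrow>\<^sub>E UNIV" using xs by (simp add: space_PiM)
      fix i assume i: "i \<in> I"
      have le: "norm (c n i - x i) \<le> 2 * inverse (real (Suc n))" for n
        unfolding real_norm_def by (rule c(2)[OF i])
      have "(\<lambda>n. 2 * inverse (real (Suc n))) \<longlonglongrightarrow> 2 * 0"
        by (intro tendsto_mult tendsto_const LIMSEQ_inverse_real_of_nat)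
      then have "(\<lambda>n. 2 * inverse (real (Suc n))) \<longlonglongrightarrow> 0" by (simp only: mult_zero_right)
      from Lim_null_comparison[OF always_eventually[OF allI[OF le]] this]
      have "(\<lambda>n. c n i - x i) \<longlonglongrightarrow> 0" .
      then show "(\<lambda>n. c n i) \<longlonglongrightarrow> x i" by (rule LIM_zero_cancel)
    qed
  qed
  also have "\<dots> \<in> sets ?M"
  proof (intro sets.countable_INT image_subsetI sets.countable_UN')
    show "countable {q \<in> Q. B n q \<inter> C \<noteq> {}}" for n by (rule countable_subset[OF _ Q]) blast
  qed (rule B, simp)
  finally show ?thesis .
qed

text \<open>A crude bound for arbitrary J. Along a convergent sequence of couplings its right side
  stays bounded and gives the dominating function; membership in \<open>good_disorder\<close> is not
  assumed there.\<close>

lemma hamiltonian_le_sum: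
  assumes "\<sigma> \<in> spin_sphere N"
  shows "\<bar>hamiltonian N p J \<sigma>\<bar> \<le> real N powr (- (real p - 1) / 2) * ((\<Sum>i\<in>spin_indices N p. \<bar>J i\<bar>) * sqrt (real N) ^ p)"
proof -
  have "\<bar>\<Sum>i\<in>spin_indices N p. J i * (\<Prod>k<p. \<sigma> (i k))\<bar> \<le> (\<Sum>i\<in>spin_indices N p. \<bar>J i * (\<Prod>k<p. \<sigma> (i k))\<bar>)"
    by (rule sum_abs)
  also have "\<dots> \<le> (\<Sum>i\<in>spin_indices N p. \<bar>J i\<bar> * sqrt (real N) ^ p)"
  proof (rule sum_mono)
    fix i assume i: "i \<in> spin_indices N p"
    have "\<bar>\<Prod>k<p. \<sigma> (i k)\<bar> = (\<Prod>k<p. \<bar>\<sigma> (i k)\<bar>)" by (rule abs_prod)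
    also have "\<dots> \<le> (\<Prod>k<p. sqrt (real N))"
    proof (intro prod_mono conjI)
      fix k assume "k \<in> {..<p}"
      then have "i k < N" using i by (auto simp: PiE_iff)
      then show "\<bar>\<sigma> (i k)\<bar> \<le> sqrt (real N)"
        using coordinate_le_vdist[of "i k" N \<sigma> "\<lambda>_. 0"] spin_sphere_vnorm[OF assms] by simp
    qed simp
    finally show "\<bar>J i * (\<Prod>k<p. \<sigma> (i k))\<bar> \<le> \<bar>J i\<bar> * sqrt (real N) ^ p"
      unfolding abs_mult by (intro mult_left_mono) auto
  qed
  finally show ?thesis
    unfolding hamiltonian_def abs_mult by (intro mult_mono) (auto simp: sum_distrib_right)
qed

lemma tendsto_integral_gibbs_weight:
  fixes F :: "(nat \<Rightarrow> real) \<Rightarrow> real"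
  assumes N: "0 < N" and F: "F \<in> borel_measurable (sphere_sigma N)" "\<And>\<sigma>. \<sigma> \<in> spin_sphere N \<Longrightarrow> \<bar>F \<sigma>\<bar> \<le> M"
    and X: "\<And>i. i \<in> spin_indices N p \<Longrightarrow> (\<lambda>n. X n i) \<longlonglongrightarrow> J i"
  shows "(\<lambda>n. \<integral>\<sigma>. F \<sigma> * gibbs_weight N p \<beta> (X n) \<sigma> \<partial>sphere_volume N)
    \<longlonglongrightarrow> (\<integral>\<sigma>. F \<sigma> * gibbs_weight N p \<beta> J \<sigma> \<partial>sphere_volume N)"
proof -
  let ?T = "\<lambda>J. \<Sum>i\<in>spin_indices N p. \<bar>J i\<bar>"
  have "(\<lambda>n. ?T (X n)) \<longlonglongrightarrow> ?T J" by (intro tendsto_intros X)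
  then have "Bseq (\<lambda>n. ?T (X n))" by (rule convergent_imp_Bseq[OF convergentI])
  then obtain T where T: "\<And>n. ?T (X n) \<le> T" by (auto simp: Bseq_def abs_le_iff dest: abs_le_D1)
  define K where "K = real N powr (- (real p - 1) / 2) * (T * sqrt (real N) ^ p)"
  have HK: "\<bar>hamiltonian N p (X n) \<sigma>\<bar> \<le> K" if "\<sigma> \<in> spin_sphere N" for n \<sigma>
    using hamiltonian_le_sum[OF that, of p "X n"] T[of n] unfolding K_def
    by (elim order_trans) (intro mult_left_mono mult_right_mono; simp)
  define W where "W = exp (\<bar>\<beta>\<bar> * K)"
  have wW: "gibbs_weight N p \<beta> (X n) \<sigma> \<le> W" if "\<sigma> \<in> spin_sphere N" for n \<sigma>
  proof -
    have "- \<beta> * hamiltonian N p (X n) \<sigma> \<le> \<bar>\<beta>\<bar> * \<bar>hamiltonian N p (X n) \<sigma>\<bar>"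
      unfolding abs_mult[symmetric] by linarith
    also have "\<dots> \<le> \<bar>\<beta>\<bar> * K" using HK[OF that] by (intro mult_left_mono) auto
    finally show ?thesis by (simp add: gibbs_weight_def W_def)
  qed
  have lim: "(\<lambda>n. gibbs_weight N p \<beta> (X n) \<sigma>) \<longlonglongrightarrow> gibbs_weight N p \<beta> J \<sigma>" for \<sigma>
    unfolding gibbs_weight_def hamiltonian_def by (intro tendsto_intros X)
  show ?thesis
  proof (rule integral_dominated_convergence)
    show "integrable (sphere_volume N) (\<lambda>_. \<bar>M\<bar> * W)"
      by (rule integrable_sphere_volume[OF N, of _ "\<bar>M\<bar> * W"]) (auto simp: W_def)
    show "AE \<sigma> in sphere_volume N. norm (F \<sigma> * gibbs_weight N p \<beta> (X n) \<sigma>) \<le> \<bar>M\<bar> * W" for n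
    proof (rule AE_I2)
      fix \<sigma> assume "\<sigma> \<in> space (sphere_volume N)"
      then have s: "\<sigma> \<in> spin_sphere N" by (simp add: space_sphere_volume)
      show "norm (F \<sigma> * gibbs_weight N p \<beta> (X n) \<sigma>) \<le> \<bar>M\<bar> * W"
        unfolding real_norm_def abs_mult
        using F(2)[OF s] wW[OF s, of n] by (intro mult_mono) (auto simp: gibbs_weight_def)
    qed
    show "AE \<sigma> in sphere_volume N. (\<lambda>n. F \<sigma> * gibbs_weight N p \<beta> (X n) \<sigma>) \<longlonglongrightarrow> F \<sigma> * gibbs_weight N p \<beta> J \<sigma>"
      by (intro AE_I2 tendsto_mult tendsto_const lim)
    show "(\<lambda>\<sigma>. F \<sigma> * gibbs_weight N p \<beta> J \<sigma>) \<in> borel_measurable (sphere_volume N)"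
      "(\<lambda>\<sigma>. F \<sigma> * gibbs_weight N p \<beta> (X n) \<sigma>) \<in> borel_measurable (sphere_volume N)" for n
      unfolding measurable_sphere_volume by (intro borel_measurable_times F gibbs_weight_measurable)+
  qed
qed

lemma unnormalized_lsi_closed:
  assumes N: "0 < N" and f: "smooth_on_sphere N f"
    and X: "\<And>n. unnormalized_lsi N p \<beta> c (X n) f" "\<And>i. i \<in> spin_indices N p \<Longrightarrow> (\<lambda>n. X n i) \<longlonglongrightarrow> J i"
  shows "unnormalized_lsi N p \<beta> c J f"
proof -
  obtain F U where "sphere_extension N f F U" using smooth_sphere_extension[OF N f] by blast
  then interpret sphere_extension N f F U .
  let ?V = "sphere_volume N" and ?w = "gibbs_weight N p \<beta>"
  obtain M where M: "\<And>\<sigma>. \<sigma> \<in> spin_sphere N \<Longrightarrow> \<bar>f \<sigma>\<bar> \<le> M" using f_bounded by blast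
  obtain Gm where Gm: "\<And>\<sigma>. \<sigma> \<in> spin_sphere N \<Longrightarrow> grad_sq \<sigma> \<le> Gm" using grad_sq_bounded by blast
  define M2 where "M2 = max 1 (M\<^sup>2)"
  have f2: "(f \<sigma>)\<^sup>2 \<le> M2" if "\<sigma> \<in> spin_sphere N" for \<sigma>
  proof -
    have "(f \<sigma>)\<^sup>2 \<le> M\<^sup>2" using M[OF that] by (simp add: abs_le_square_iff[symmetric])
    then show ?thesis by (simp add: M2_def)
  qed
  have fm[measurable]: "f \<in> borel_measurable (sphere_sigma N)" by (rule continuous_on_sphere_measurable[OF continuous_on_f])
  have gm[measurable]: "grad_sq \<in> borel_measurable (sphere_sigma N)" by (rule continuous_on_sphere_measurable[OF continuous_on_grad_sq])
  define A where "A J = (\<integral>\<sigma>. (f \<sigma>)\<^sup>2 * ln ((f \<sigma>)\<^sup>2) * ?w J \<sigma> \<partial>?V)" for J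
  define B where "B J = (\<integral>\<sigma>. (f \<sigma>)\<^sup>2 * ?w J \<sigma> \<partial>?V)" for J
  define G where "G J = (\<integral>\<sigma>. grad_sq \<sigma> * ?w J \<sigma> \<partial>?V)" for J
  let ?Z = "gibbs_mass N p \<beta>"
  have Z: "0 < ?Z J" for J by (rule gibbs_mass_pos[OF N])
  have B0: "0 \<le> B J" for J unfolding B_def by (rule integral_nonneg_AE) (auto simp: gibbs_weight_def)
  have iff: "unnormalized_lsi N p \<beta> c J f \<longleftrightarrow> A J - ?Z J * (B J / ?Z J * ln (B J / ?Z J)) \<le> 2 * c * G J" for J
    using Z[of J] unfolding unnormalized_lsi_def A_def B_def G_def grad_sq_def by simp
  have Alim: "(\<lambda>n. A (X n)) \<longlonglongrightarrow> A J" unfolding A_def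
  proof (rule tendsto_integral_gibbs_weight[OF N _ _ X(2)])
    show "\<bar>(f \<sigma>)\<^sup>2 * ln ((f \<sigma>)\<^sup>2)\<bar> \<le> 1 + M2 * ln M2" if "\<sigma> \<in> spin_sphere N" for \<sigma>
      by (rule xlnx_bound) (use f2[OF that] in \<open>auto simp: M2_def\<close>)
  qed measurable
  have Blim: "(\<lambda>n. B (X n)) \<longlonglongrightarrow> B J" unfolding B_def
  proof (rule tendsto_integral_gibbs_weight[OF N _ _ X(2)])
    show "\<bar>(f \<sigma>)\<^sup>2\<bar> \<le> M2" if "\<sigma> \<in> spin_sphere N" for \<sigma> using f2[OF that] by simp
  qed measurable
  have Glim: "(\<lambda>n. G (X n)) \<longlonglongrightarrow> G J" unfolding G_def
  proof (rule tendsto_integral_gibbs_weight[OF N gm _ X(2)])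
    show "\<bar>grad_sq \<sigma>\<bar> \<le> Gm" if "\<sigma> \<in> spin_sphere N" for \<sigma> using Gm[OF that] grad_sq_nonneg[of \<sigma>] by simp
  qed
  have Zlim: "(\<lambda>n. ?Z (X n)) \<longlonglongrightarrow> ?Z J"
    using tendsto_integral_gibbs_weight[OF N _ _ X(2), of "\<lambda>_. 1" 1] by (simp add: gibbs_mass_def)
  have "(\<lambda>n. B (X n) / ?Z (X n)) \<longlonglongrightarrow> B J / ?Z J"
    using Z[of J] by (intro tendsto_divide Blim Zlim) simp
  then have "(\<lambda>n. B (X n) / ?Z (X n) * ln (B (X n) / ?Z (X n))) \<longlonglongrightarrow> B J / ?Z J * ln (B J / ?Z J)"
    by (rule tendsto_xlnx) (use B0 Z in \<open>auto intro!: divide_nonneg_pos\<close>)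
  then have "(\<lambda>n. A (X n) - ?Z (X n) * (B (X n) / ?Z (X n) * ln (B (X n) / ?Z (X n))))
      \<longlonglongrightarrow> A J - ?Z J * (B J / ?Z J * ln (B J / ?Z J))"
    by (intro tendsto_diff tendsto_mult[OF Zlim] Alim)
  moreover have "(\<lambda>n. 2 * c * G (X n)) \<longlonglongrightarrow> 2 * c * G J" by (intro tendsto_mult tendsto_const Glim)
  ultimately have "A J - ?Z J * (B J / ?Z J * ln (B J / ?Z J)) \<le> 2 * c * G J"
    by (rule LIMSEQ_le) (use X(1) iff in blast)
  then show ?thesis using iff by blast
qed

text \<open>The test functions are uncountably many, so measurability of each single event would not
  be enough; sequentially closed sets are stable under arbitrary intersections.\<close>

lemma log_sobolev_event_measurable:
  assumes N: "0 < N" and c: "0 < c"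
  shows "{J \<in> space (disorder_law N p). log_sobolev N (gibbs_measure N p \<beta> J) c} \<in> sets (disorder_law N p)"
  unfolding sets_disorder_law log_sobolev_gibbs_iff[OF N c]
proof (rule sequentially_closed_in_sets_PiM[OF finite_spin_indices])
  have space: "space (disorder_law N p) = spin_indices N p \<rightarrow>\<^sub>E UNIV"
    by (simp add: disorder_law_def space_PiM)
  let ?E = "{J \<in> space (disorder_law N p). \<forall>f. smooth_on_sphere N f \<longrightarrow> unnormalized_lsi N p \<beta> c J f}"
  show "?E \<subseteq> spin_indices N p \<rightarrow>\<^sub>E UNIV" by (auto simp: space)
  fix X J assume X: "\<And>n. X n \<in> ?E" "J \<in> spin_indices N p \<rightarrow>\<^sub>E UNIV"
    "\<And>i. i \<in> spin_indices N p \<Longrightarrow> (\<lambda>n. X n i) \<longlonglongrightarrow> J i"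
  have "unnormalized_lsi N p \<beta> c J f" if f: "smooth_on_sphere N f" for f
    by (rule unnormalized_lsi_closed[OF N f _ X(3)]) (use X(1) f in auto)
  then show "J \<in> ?E" using X(2) by (simp add: space)
qed

theorem proposition3:
  fixes p :: nat
  assumes "p \<ge> 3"
  shows "\<exists>\<beta>\<^sub>h>0. \<forall>\<beta>::real. 0 < \<beta> \<and> \<beta> < \<beta>\<^sub>h \<longrightarrow>
           (\<exists>c\<^sub>L>0. \<exists>c>0.
              (\<lambda>N. 1 - \<P>(J in disorder_law N p. log_sobolev N (gibbs_measure N p \<beta> J) c\<^sub>L))
                \<in> O(\<lambda>N. exp (- c * real N)))"
proof -
  \<comment> \<open>The smallest constant allowed by \<open>prob_good_disorder\<close>. It depends
    on p only, and so does the threshold 1 / (8 C p^2) for \<beta>.\<close>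
  define C where "C = 6 * real p + 4 ^ p / 2 + 1"
  have C: "0 < C" by (simp add: C_def add_nonneg_pos)
  have D: "0 < C * (real p)\<^sup>2" using C assms by simp
  show ?thesis
  proof (rule exI[of _ "1 / (8 * (C * (real p)\<^sup>2))"], intro conjI allI impI)
    show "0 < 1 / (8 * (C * (real p)\<^sup>2))" using D by simp
    fix \<beta> :: real assume "0 < \<beta> \<and> \<beta> < 1 / (8 * (C * (real p)\<^sup>2))"
    then have \<beta>: "0 \<le> \<beta>" "\<beta> * (C * (real p)\<^sup>2) \<le> 1 / 8" using D by (auto simp: field_simps)
    let ?c = "32 * exp (9 / 8) :: real"
    have bound: "norm (1 - \<P>(J in disorder_law N p. log_sobolev N (gibbs_measure N p \<beta> J) ?c)) \<le> 1 * norm (exp (- 1 * real N))"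
      if N: "12 \<le> N" for N
    proof -
      have N0: "0 < N" using N by simp
      interpret D: prob_space "disorder_law N p" by (rule prob_space_disorder_law)
      let ?E = "{J \<in> space (disorder_law N p). log_sobolev N (gibbs_measure N p \<beta> J) ?c}"
      have "good_disorder N p C \<subseteq> ?E"
      proof
        fix J assume J: "J \<in> good_disorder N p C"
        have "log_sobolev N (gibbs_measure N p \<beta> J) ?c"
          by (rule log_sobolev_good_disorder[OF N _ _ J \<beta>(1)]) (use assms C \<beta>(2) in \<open>auto simp: mult.assoc\<close>)
        then show "J \<in> ?E" using J by (simp add: good_disorder_def)
      qed
      \<comment> \<open>Monotonicity needs the larger event to be measurable, since
        \<open>measure\<close> is 0 on sets outside the sigma-algebra.\<close>
      then have "measure (disorder_law N p) (good_disorder N p C) \<le> measure (disorder_law N p) ?E"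
        by (rule D.finite_measure_mono) (rule log_sobolev_event_measurable[OF N0], simp)
      then have "1 - measure (disorder_law N p) ?E \<le> exp (- real N)"
        using prob_good_disorder[OF N0, of p C] by (simp add: C_def)
      then show ?thesis using D.prob_le_1[of ?E] by simp
    qed
    \<comment> \<open>Both the rate c and the constant of the O-bound are 1; \<open>bound\<close>
      holds for all N \<ge> 12, hence eventually.\<close>
    have "(\<lambda>N. 1 - \<P>(J in disorder_law N p. log_sobolev N (gibbs_measure N p \<beta> J) ?c)) \<in> O(\<lambda>N. exp (- 1 * real N))"
      by (rule bigoI[where c = 1], rule eventually_mono[OF eventually_ge_at_top[of 12]], rule bound)
    then show "\<exists>c\<^sub>L>0. \<exists>c>0. (\<lambda>N. 1 - \<P>(J in disorder_law N p. log_sobolev N (gibbs_measure N p \<beta> J) c\<^sub>L))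
                \<in> O(\<lambda>N. exp (- c * real N))"
      by - (rule exI[of _ ?c], rule conjI, simp, rule exI[of _ "1::real"], rule conjI, simp)
  qed
qed

end
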